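(* Let $d,k,p,m\geq 1$ be integers and set $x=p/d^k$. Let $M_{p,d,k}=\sum_{s=1}^p \varphi_s$, where $\varphi_s=|\varphi_s\rangle\langle\varphi_s|$ and $|\varphi_s\rangle=|\varphi_s^1\rangle\otimes\cdots\otimes|\varphi_s^k\rangle\in(\mathbb{C}^d)^{\otimes k}$, the $pk$ vectors $|\varphi_s^i\rangle$ ($s\in[p]$, $i\in[k]$) being independent and uniformly distributed on the unit sphere of $\mathbb{C}^d$. Let $\beta_m(x)=\sum_{\ell=1}^m N(m,\ell)x^\ell$ with $N(m,\ell)=\frac{1}{m}\binom{m}{\ell-1}\binom{m}{\ell}$. Then $$\left(1-\frac{m^2}{p}\right)\beta_m\!\left(\frac{p}{d^k}\right)\leq \frac{1}{d^k}\mathbb{E}[\operatorname{tr}(M_{p,d,k}^m)]\leq \exp\!\left(\frac{3m^{k+4}}{x d^{1/k}}\right)\beta_m\!\left(\frac{p}{d^k}\right),$$ where the lower bound is asserted only when $m<\sqrt{p}$. Consequently, for all $m\geq 1$, $k\geq 1$, $x>0$, with $p=xd^k$, $$\lim_{d\to\infty}\frac{1}{d^k}\mathbb{E}[\operatorname{tr}(M_{p,d,k}^m)]=\beta_m(x).$$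
   Context: $N(m,\ell)$ are the Narayana numbers. In the limit statement $k$, $m$ and $x$ are fixed and $d\to\infty$ with $p=xd^k$. *)

theory Defs
  imports "HOL-Probability.Probability"
begin

text \<open>Vectors of C^d are functions on {..<d} (extensional, elements of PiM).
  The uniform distribution on the unit sphere of C^d is realised as the
  cone measure: the image of the uniform distribution on the (punctured)
  unit ball of C^d = R^(2d) under v \<mapsto> v / |v|.\<close>

definition cvec_space :: "nat \<Rightarrow> (nat \<Rightarrow> complex) measure" where
  "cvec_space d = PiM {..<d} (\<lambda>_. lborel)"

definition sqnorm :: "nat \<Rightarrow> (nat \<Rightarrow> complex) \<Rightarrow> real" where
  "sqnorm d v = (\<Sum>j<d. (cmod (v j))\<^sup>2)"

definition unit_ball_punct :: "nat \<Rightarrow> (nat \<Rightarrow> complex) set" where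
  "unit_ball_punct d = {v \<in> space (cvec_space d). 0 < sqnorm d v \<and> sqnorm d v \<le> 1}"

definition normalize_vec :: "nat \<Rightarrow> (nat \<Rightarrow> complex) \<Rightarrow> (nat \<Rightarrow> complex)" where
  "normalize_vec d v = restrict (\<lambda>j. v j / complex_of_real (sqrt (sqnorm d v))) {..<d}"

definition unif_sphere :: "nat \<Rightarrow> (nat \<Rightarrow> complex) measure" where
  "unif_sphere d = distr (uniform_measure (cvec_space d) (unit_ball_punct d))
                         (PiM {..<d} (\<lambda>_. borel)) (normalize_vec d)"

definition sphere_family :: "nat \<Rightarrow> nat \<Rightarrow> nat \<Rightarrow> (nat \<times> nat \<Rightarrow> nat \<Rightarrow> complex) measure" where
  "sphere_family d p k = PiM ({..<p} \<times> {..<k}) (\<lambda>_. unif_sphere d)"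

text \<open>Basis of (C^d)^{\<otimes>k}: multi-indices a with a i < d for i < k.\<close>

definition tidx :: "nat \<Rightarrow> nat \<Rightarrow> (nat \<Rightarrow> nat) set" where
  "tidx d k = PiE {..<k} (\<lambda>_. {..<d})"

definition tensor_vec :: "nat \<Rightarrow> (nat \<times> nat \<Rightarrow> nat \<Rightarrow> complex) \<Rightarrow> nat \<Rightarrow> (nat \<Rightarrow> nat) \<Rightarrow> complex" where
  "tensor_vec k \<omega> s a = (\<Prod>i<k. \<omega> (s, i) (a i))"

definition Mmat :: "nat \<Rightarrow> nat \<Rightarrow> (nat \<times> nat \<Rightarrow> nat \<Rightarrow> complex) \<Rightarrow> (nat \<Rightarrow> nat) \<Rightarrow> (nat \<Rightarrow> nat) \<Rightarrow> complex" where
  "Mmat p k \<omega> a b = (\<Sum>s<p. tensor_vec k \<omega> s a * cnj (tensor_vec k \<omega> s b))"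

definition mat_mult :: "'i set \<Rightarrow> ('i \<Rightarrow> 'i \<Rightarrow> complex) \<Rightarrow> ('i \<Rightarrow> 'i \<Rightarrow> complex) \<Rightarrow> 'i \<Rightarrow> 'i \<Rightarrow> complex" where
  "mat_mult I A B = (\<lambda>a b. \<Sum>c\<in>I. A a c * B c b)"

fun mat_pow :: "'i set \<Rightarrow> ('i \<Rightarrow> 'i \<Rightarrow> complex) \<Rightarrow> nat \<Rightarrow> 'i \<Rightarrow> 'i \<Rightarrow> complex" where
  "mat_pow I A 0 = (\<lambda>a b. if a = b then 1 else 0)"
| "mat_pow I A (Suc n) = mat_mult I (mat_pow I A n) A"

definition mat_trace :: "'i set \<Rightarrow> ('i \<Rightarrow> 'i \<Rightarrow> complex) \<Rightarrow> complex" where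
  "mat_trace I A = (\<Sum>a\<in>I. A a a)"

text \<open>E[tr(M_{p,d,k}^m)] (the trace is real since M is Hermitian).\<close>

definition expected_trace :: "nat \<Rightarrow> nat \<Rightarrow> nat \<Rightarrow> nat \<Rightarrow> real" where
  "expected_trace d k p m =
     (\<integral>\<omega>. Re (mat_trace (tidx d k) (mat_pow (tidx d k) (Mmat p k \<omega>) m)) \<partial>sphere_family d p k)"

definition narayana :: "nat \<Rightarrow> nat \<Rightarrow> real" where
  "narayana m l = (1 / real m) * real (m choose (l - 1)) * real (m choose l)"

definition beta_poly :: "nat \<Rightarrow> real \<Rightarrow> real" where
  "beta_poly m x = (\<Sum>l=1..m. narayana m l * x ^ l)"

end

theory Submission
  imports Defs "HOL-Computational_Algebra.Formal_Power_Series"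
begin

text \<open>
  Expanding the trace gives \<open>E tr M^m = \<Sum>s. E(s)^k\<close>, the sum over words \<open>s\<close> of length \<open>m\<close> in \<open>p\<close> letters, where
  \<open>E(s)\<close> is the expected trace of the product along \<open>s\<close> of independent random rank one projections
  of \<open>C^d\<close>. Integration by parts on the sphere yields a loop equation with nonnegative terms, which
  expresses \<open>E\<close> of a product of traces through shorter words. It shows \<open>E(s) \<ge> 0\<close> and
  \<open>E(s) \<le> d^(1-l)\<close> for a word with \<open>l\<close> distinct letters.

  Upper bound: \<open>E(s)^k \<le> d^((1-l)(k-1)) E(s)\<close> reduces the problem to a weighted sum of the \<open>E(s)\<close>, and
  the loop equation, summed over all words of given lengths, becomes the quadratic recursion of the
  Narayana polynomials up to corrections, which are controlled by
  \<open>x \<beta>\<^bsub>a+b-1\<^esub> \<le> a^2 b \<beta>\<^bsub>a\<^esub> \<beta>\<^bsub>b\<^esub>\<close>.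

  Lower bound: for noncrossing words \<open>E(s) = d^(1-l)\<close> exactly, all other words contribute
  nonnegatively, and the number of noncrossing words is governed by the same quadratic recursion.
\<close>

section \<open>Narayana polynomials\<close>

text \<open>Kets and bras are treated as independent variables, so that integration by parts becomes
  an identity between formal polynomials. On the sphere it carries a factor d + b that depends on
  the degree in the letter concerned; hence derivatives are tracked together with bidegrees. One
  trace turns into products of traces, so every estimate is proved for lists of words, although only
  single words occur in the expansion. The main obstacle of the upper bound is that merging two
  traces produces a longer one: its Narayana value has to be paid for by the product of the two
  separate values. The losses accumulate to the exponent 2 m^5 / (x d), which is sharper than the
  one claimed. The Narayana polynomials are met through the recursion of \<open>nc_poly\<close>,
  whose first summand stands for a first letter that does not recur and whose second one cuts at its
  next occurrence. This recursion and the explicit binomial formula are matched by a common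
  three-term recurrence in m.\<close>

fun nc_poly :: "nat \<Rightarrow> real poly" where
  "nc_poly 0 = 1"
| "nc_poly (Suc n) = pCons 0 (nc_poly n) + (\<Sum>j<n. nc_poly (Suc j) * nc_poly (n - 1 - j))"

declare nc_poly.simps(2) [simp del]

definition nc_val :: "real \<Rightarrow> nat \<Rightarrow> real" where
  "nc_val x n = poly (nc_poly n) x"

lemma nc_val_0 [simp]: "nc_val x 0 = 1"
  by (simp add: nc_val_def)

lemma nc_val_Suc:
  "nc_val x (Suc n) = x * nc_val x n + (\<Sum>j<n. nc_val x (Suc j) * nc_val x (n - 1 - j))"
  by (subst nc_val_def, subst nc_poly.simps(2), simp only: poly_add poly_pCons poly_sum poly_mult add_0)
     (simp only: nc_val_def)

lemma nc_val_nonneg: "0 \<le> x \<Longrightarrow> 0 \<le> nc_val x n"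
proof (induction n rule: less_induct)
  case (less n)
  show ?case
  proof (cases n)
    case (Suc k)
    show ?thesis unfolding Suc nc_val_Suc[of x k]
      by (intro add_nonneg_nonneg mult_nonneg_nonneg sum_nonneg less) (use Suc in auto)
  qed simp
qed

lemma nc_val_Suc_ge: "0 \<le> x \<Longrightarrow> x * nc_val x n \<le> nc_val x (Suc n)"
  unfolding nc_val_Suc[of x n] by (simp add: sum_nonneg nc_val_nonneg)

lemma nc_val_pos: "0 < x \<Longrightarrow> 0 < nc_val x n"
proof (induction n)
  case (Suc n)
  then show ?case using nc_val_Suc_ge[of x n] mult_pos_pos[of x "nc_val x n"] by linarith
qed simp

text \<open>The generating function B of \<open>nc_val x\<close> is a root of a quadratic equation
  over power series, so R = S - 2 X B is a square root of the discriminant D. Hence 2 D R' = D' R, a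
  linear differential equation with polynomial coefficients, and comparing coefficients gives a
  three-term recurrence.\<close>

lemma nc_val_recurrence:
  fixes x :: real
  shows "(real n + 3) * nc_val x (n + 2) =
    (2 * real n + 3) * (1 + x) * nc_val x (n + 1) - real n * (1 - x)^2 * nc_val x n"
proof -
  define B where "B = Abs_fps (nc_val x)"
  define S where "S = 1 + fps_X - fps_const x * fps_X"
  define R where "R = S - 2 * fps_X * B"
  define D where "D = 1 - fps_const (2*(1+x)) * fps_X + fps_const ((1-x)^2) * fps_X^2"
  have quad: "B = 1 + fps_X * (fps_const x * B + (B - 1) * B)"
  proof (rule fps_ext)
    fix n
    show "fps_nth B n = fps_nth (1 + fps_X * (fps_const x * B + (B - 1) * B)) n"
    proof (cases n)
      case (Suc k)
      have "fps_nth ((B - 1) * B) k = (\<Sum>j=0..k. fps_nth (B - 1) j * fps_nth B (k - j))"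
        by (rule fps_mult_nth)
      also have "\<dots> = (\<Sum>j=1..k. fps_nth (B - 1) j * fps_nth B (k - j))"
        by (rule sum.mono_neutral_right) (auto simp: B_def not_less_eq_eq)
      also have "\<dots> = (\<Sum>j<k. nc_val x (Suc j) * nc_val x (k - 1 - j))"
        by (rule sum.reindex_bij_witness[of _ Suc "\<lambda>j. j - 1"]) (auto simp: B_def)
      finally show ?thesis using Suc by (simp add: B_def nc_val_Suc[of x k])
    qed (simp add: B_def)
  qed
  \<comment> \<open>The quadratic equation reads X B^2 - S B + 1 = 0; completing the square leaves D
    = S^2 - 4 X.\<close>
  have "R^2 = S^2 + 4 * fps_X * (fps_X * B^2 - S * B)"
    unfolding R_def by (simp add: power2_eq_square algebra_simps)
  also have "fps_X * B^2 - S * B = -1"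
    using quad unfolding S_def by (simp add: power2_eq_square algebra_simps)
  also have "S^2 + 4 * fps_X * (-1) = D"
    unfolding S_def D_def
    by (simp add: power2_eq_square algebra_simps flip: fps_const_add fps_const_mult fps_const_sub)
  finally have R2: "R^2 = D" .
  have "fps_deriv D = 2 * R * fps_deriv R"
    unfolding R2[symmetric] by (simp add: fps_deriv_power algebra_simps)
  hence ode: "2 * D * fps_deriv R = fps_deriv D * R"
    unfolding R2[symmetric] by (simp add: power2_eq_square algebra_simps)
  have D_nth: "fps_nth (D * F) (k + 2) =
      fps_nth F (k + 2) - 2*(1+x) * fps_nth F (k + 1) + (1-x)^2 * fps_nth F k" for F k
  proof -
    have "D * F = F - fps_const (2*(1+x)) * (fps_X * F) + fps_const ((1-x)^2) * (fps_X * (fps_X * F))"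
      unfolding D_def by (simp add: algebra_simps power2_eq_square)
    thus ?thesis by simp
  qed
  \<comment> \<open>From index 2 on the linear series S drops out. The factor X shifts by one, so
    the coefficients n+3, n+2, n+1 of R belong to \<open>nc_val\<close> at n+2, n+1, n.\<close>
  have Rn: "fps_nth R (k + 2) = - 2 * nc_val x (k + 1)" for k
    unfolding R_def S_def B_def by (simp add: numeral_fps_const mult.assoc)
  have "fps_nth (2 * D * fps_deriv R) (n+2) = fps_nth (fps_deriv D * R) (n+2)" using ode by simp
  moreover have "fps_nth (2 * D * fps_deriv R) (n+2) =
    2 * (real (n+3) * fps_nth R (n+3) - 2*(1+x) * (real (n+2) * fps_nth R (n+2)) + (1-x)^2 * (real (n+1) * fps_nth R (n+1)))"
  proof -
    have "2 * D * fps_deriv R = D * fps_deriv R + D * fps_deriv R"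
      by (simp add: algebra_simps)
    hence "fps_nth (2 * D * fps_deriv R) (n+2) = 2 * fps_nth (D * fps_deriv R) (n+2)"
      by (simp only: fps_add_nth mult_2)
    thus ?thesis unfolding D_nth by (simp add: numeral_3_eq_3 algebra_simps)
  qed
  moreover have "fps_nth (fps_deriv D * R) (n+2) = - 2*(1+x) * fps_nth R (n+2) + 2 * (1-x)^2 * fps_nth R (n+1)"
  proof -
    have "fps_deriv D = fps_const (- 2*(1+x)) + fps_const (2*(1-x)^2) * fps_X"
      unfolding D_def by (simp add: fps_deriv_power numeral_fps_const algebra_simps)
    thus ?thesis by (simp add: algebra_simps)
  qed
  ultimately have "(real n+3) * fps_nth R (n+3) = (2*real n+3)*(1+x) * fps_nth R (n+2) - real n * (1-x)^2 * fps_nth R (n+1)"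
    by (simp add: algebra_simps)
  moreover have "fps_nth R (n+3) = -2 * nc_val x (n+2)" using Rn[of "n+1"] by (simp add: numeral_3_eq_3)
  \<comment> \<open>\<open>Rn\<close> covers the index n+1 only for n > 0; for n = 0 the factor n
    removes the term.\<close>
  moreover have "real n * fps_nth R (n+1) = - 2 * real n * nc_val x n"
  proof (cases n)
    case (Suc k) thus ?thesis using Rn[of k] by (simp add: algebra_simps)
  qed simp
  ultimately show ?thesis using Rn[of n] by algebra
qed

section \<open>The same three-term recurrence for the explicit Narayana polynomials\<close>

lemma Suc_times_binomial_real:
  "(real k + 1) * real (n choose Suc k) = (real n - real k) * real (n choose k)"
proof (cases "k \<le> n")
  case True
  have "Suc k * (n choose Suc k) = (n - k) * (n choose k)"
    by (simp only: binomial_absorb_comp binomial_absorption)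
  hence "real (Suc k) * real (n choose Suc k) = real (n - k) * real (n choose k)"
    unfolding of_nat_mult[symmetric] by simp
  thus ?thesis using True by (simp add: of_nat_diff algebra_simps)
qed (simp add: binomial_eq_0)

text \<open>This is the coefficient of x^(l+3) in the three-term recurrence. By Pascal's rule all
  binomials that occur are combinations of n choose l, ..., n choose (l+3), and these four are
  polynomial multiples of a single quantity, so that a polynomial identity in n and l
  remains.\<close>

lemma narayana_recurrence:
  assumes n: "n \<ge> 1"
  shows "(real n + 3) * narayana (n + 2) (l + 3) = (2 * real n + 3) * (narayana (n+1) (l+3) + narayana (n+1) (l+2))
    - real n * (narayana n (l+3) - 2 * narayana n (l+2) + narayana n (l+1))"
proof -
  define e where "e i = real (n choose (l + i))" for i
  have e: "(real l + real i + 1) * e (Suc i) = (real n - real l - real i) * e i" for i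
    unfolding e_def using Suc_times_binomial_real[of "l+i" n] by simp
  have c1: "real (Suc n choose (l + Suc i)) = e i + e (Suc i)" for i
    by (simp add: e_def)
  have c2: "real (Suc (Suc n) choose (l + Suc (Suc i))) = e i + 2 * e (Suc i) + e (Suc (Suc i))" for i
    by (simp add: e_def)
  define N where "N = real n"
  define q where "q = real l"
  define z where "z = e 1"
  show ?thesis
  proof (cases "l \<le> n + 1")
    case True
    hence pos: "N > 0" "q \<ge> 0" using n by (auto simp: N_def q_def)
    \<comment> \<open>The divisor collects the denominators of the successive quotients (N - q - i)
      / (q + i + 1), so that \<open>e 0\<close>, ..., \<open>e 3\<close> are all polynomials in N
      and q times \<open>w\<close>.\<close>
    define w where "w = e 0 / ((q + 1) * (q + 2) * (q + 3))"
    have e0: "e 0 = w * (q + 1) * (q + 2) * (q + 3)" unfolding w_def using pos by simp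
    have "(q + 1) * e 1 = (N - q) * e 0" using e[of 0] by (simp add: N_def q_def)
    hence "(q + 1) * e 1 = (q + 1) * (w * (N - q) * (q + 2) * (q + 3))" unfolding e0 by (simp add: mult_ac)
    hence e1: "e 1 = w * (N - q) * (q + 2) * (q + 3)" using pos by simp
    have "(q + 2) * e 2 = (N - q - 1) * e 1" using e[of 1] by (simp add: N_def q_def numeral_2_eq_2 algebra_simps)
    hence "(q + 2) * e 2 = (q + 2) * (w * (N - q) * (N - q - 1) * (q + 3))" unfolding e1 by (simp add: mult_ac)
    hence e2: "e 2 = w * (N - q) * (N - q - 1) * (q + 3)" using pos by simp
    have "(q + 3) * e 3 = (N - q - 2) * e 2" using e[of 2] by (simp add: N_def q_def numeral_3_eq_3 numeral_2_eq_2 algebra_simps)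
    hence "(q + 3) * e 3 = (q + 3) * (w * (N - q) * (N - q - 1) * (N - q - 2))" unfolding e2 by (simp add: mult_ac)
    hence e3: "e 3 = w * (N - q) * (N - q - 1) * (N - q - 2)" using pos by simp
    have s01: "e 0 + e 1 = w * (q + 2) * (q + 3) * (N + 1)" unfolding e0 e1 by (simp add: algebra_simps)
    have s12: "e 1 + e 2 = w * (N - q) * (q + 3) * (N + 1)" unfolding e1 e2 by (simp add: algebra_simps)
    have s23: "e 2 + e 3 = w * (N - q) * (N - q - 1) * (N + 1)" unfolding e2 e3 by (simp add: algebra_simps)
    have s012: "(e 0 + e 1) + (e 1 + e 2) = w * (q + 3) * (N + 1) * (N + 2)"
      unfolding s01 s12 by (simp add: algebra_simps)
    have s123: "(e 1 + e 2) + (e 2 + e 3) = w * (N - q) * (N + 1) * (N + 2)"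
      unfolding s12 s23 by (simp add: algebra_simps)
    \<comment> \<open>A common factor of all six Narayana numbers involved; their cofactors satisfy
      the polynomial identity checked at the end.\<close>
    define c where "c = w^2 * (N - q) * (q + 3)"
    have "narayana (n+2) (l+3) = ((e 0 + e 1) + (e 1 + e 2)) * ((e 1 + e 2) + (e 2 + e 3)) / (N + 2)"
      using c2[of 0] c2[of 1] by (simp add: narayana_def N_def numeral_2_eq_2 numeral_3_eq_3 add_ac)
    hence b: "narayana (n+2) (l+3) = c * ((N + 1)^2 * (N + 2))"
      unfolding s012 s123 c_def using pos by (simp add: power2_eq_square)
    have "narayana (n+1) (l+3) = (e 1 + e 2) * (e 2 + e 3) / (N + 1)"
      using c1[of 1] c1[of 2] by (simp add: narayana_def N_def numeral_2_eq_2 numeral_3_eq_3)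
    hence b1: "narayana (n+1) (l+3) = c * ((N - q) * (N - q - 1) * (N + 1))"
      unfolding s12 s23 c_def using pos by (simp add: power2_eq_square)
    have "narayana (n+1) (l+2) = (e 0 + e 1) * (e 1 + e 2) / (N + 1)"
      using c1[of 0] c1[of 1] by (simp add: narayana_def N_def numeral_2_eq_2 numeral_3_eq_3)
    hence b2: "narayana (n+1) (l+2) = c * ((q + 2) * (q + 3) * (N + 1))"
      unfolding s01 s12 c_def using pos by (simp add: power2_eq_square)
    have "N * narayana n (l+3) = e 2 * e 3" "N * narayana n (l+2) = e 1 * e 2" "N * narayana n (l+1) = e 0 * e 1"
      using n by (simp_all add: narayana_def N_def e_def numeral_2_eq_2 numeral_3_eq_3)
    hence b3: "N * narayana n (l+3) = c * ((N - q) * (N - q - 1)^2 * (N - q - 2))"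
        "N * narayana n (l+2) = c * ((N - q) * (N - q - 1) * (q + 2) * (q + 3))"
        "N * narayana n (l+1) = c * ((q + 1) * (q + 2)^2 * (q + 3))"
      unfolding e0 e1 e2 e3 c_def by (simp_all add: power2_eq_square)
    have "(N + 3) * ((N + 1)^2 * (N + 2)) = (2 * N + 3) * ((N - q) * (N - q - 1) * (N + 1) + (q + 2) * (q + 3) * (N + 1))
        - ((N - q) * (N - q - 1)^2 * (N - q - 2) - 2 * ((N - q) * (N - q - 1) * (q + 2) * (q + 3)) + (q + 1) * (q + 2)^2 * (q + 3))"
      by (simp add: power2_eq_square algebra_simps)
    from arg_cong[OF this, of "\<lambda>t. c * t"]
    have "(N + 3) * narayana (n+2) (l+3) = (2 * N + 3) * (narayana (n+1) (l+3) + narayana (n+1) (l+2))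
        - (N * narayana n (l+3) - 2 * (N * narayana n (l+2)) + N * narayana n (l+1))"
      unfolding b b1 b2 b3 by (simp only: ring_distribs mult_ac)
    thus ?thesis by (simp add: N_def algebra_simps)
  next
    case False
    thus ?thesis by (simp add: narayana_def binomial_eq_0)
  qed
qed

definition narayana_poly :: "nat \<Rightarrow> real poly" where
  "narayana_poly n = (\<Sum>l=1..n. monom (narayana n l) l)"

text \<open>The constant coefficient is set apart: l - 1 truncates at 0, so
  \<open>narayana n 0\<close> is 1/n and not 0.\<close>

lemma coeff_narayana_poly:
  "n \<ge> 1 \<Longrightarrow> coeff (narayana_poly n) l = (if l = 0 then 0 else narayana n l)"
  by (auto simp: narayana_poly_def coeff_sum narayana_def not_le binomial_eq_0)

lemma poly_narayana_poly: "poly (narayana_poly n) x = beta_poly n x"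
  by (simp add: narayana_poly_def beta_poly_def poly_sum poly_monom)

lemma narayana_1: "n \<ge> 1 \<Longrightarrow> narayana n (Suc 0) = 1"
  by (simp add: narayana_def)

text \<open>Comparison of coefficients: from degree 3 on it is \<open>narayana_recurrence\<close>;
  the lower degrees touch index 0 and are computed directly.\<close>

lemma beta_poly_recurrence:
  assumes n: "n \<ge> 1"
  shows "(real n + 3) * beta_poly (n + 2) x =
    (2 * real n + 3) * (1 + x) * beta_poly (n + 1) x - real n * (1 - x)^2 * beta_poly n x"
proof -
  have "smult (real n + 3) (narayana_poly (n + 2)) =
     smult (2 * real n + 3) (narayana_poly (n+1) + pCons 0 (narayana_poly (n+1)))
      - smult (real n) (narayana_poly n - smult 2 (pCons 0 (narayana_poly n)) + pCons 0 (pCons 0 (narayana_poly n)))"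
    (is "?l = ?r")
  proof (rule poly_eqI)
    fix i
    consider "i = 0" | "i = Suc 0" | "i = Suc (Suc 0)" | l where "i = l + 3"
    proof -
      have "i = 0 \<or> i = Suc 0 \<or> i = Suc (Suc 0) \<or> i = (i - 3) + 3" by arith
      thus ?thesis using that by blast
    qed
    thus "coeff ?l i = coeff ?r i"
    proof cases
      case 3
      have "real (n choose 2) = real n * (real n - 1) / 2"
        using n by (simp add: choose_two real_of_nat_div even_mult_iff of_nat_diff)
      hence "(n choose Suc (Suc 0)) = real n * (real n - 1) / 2" by (simp add: numeral_2_eq_2)
      thus ?thesis using n 3
        by (simp add: coeff_narayana_poly narayana_1 narayana_def field_simps)
    next
      case 4
      have "l + 3 = Suc (Suc (Suc l))" "l + 2 = Suc (Suc l)" "l + 1 = Suc l" by simp_all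
      note rec = narayana_recurrence[OF n, of l, unfolded this]
      show ?thesis using n rec unfolding 4 \<open>l + 3 = _\<close>
        by (simp only: coeff_diff coeff_add coeff_smult coeff_pCons_Suc coeff_narayana_poly)
           (simp add: coeff_narayana_poly)
    qed (use n in \<open>auto simp: coeff_narayana_poly narayana_1\<close>)
  qed
  hence "poly ?l x = poly ?r x" by simp
  thus ?thesis
    by (simp add: poly_narayana_poly algebra_simps power2_eq_square)
qed

text \<open>Both sides obey the same recurrence from index 1 on and agree at 1 and 2. At m = 0 they
  differ: the empty sum is 0, whereas \<open>nc_val x 0\<close> is 1.\<close>

lemma beta_poly_eq_nc_val: "m \<ge> 1 \<Longrightarrow> beta_poly m x = nc_val x m"
proof (induction m rule: less_induct)
  case (less m)
  consider "m = 1" | "m = 2" | n where "m = n + 2" "n \<ge> 1"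
  proof -
    have "m = 1 \<or> m = 2 \<or> (m = (m - 2) + 2 \<and> m - 2 \<ge> 1)" using less.prems by arith
    thus ?thesis using that by blast
  qed
  thus ?case
  proof cases
    case 1 thus ?thesis using nc_val_Suc[of x 0] by (simp add: beta_poly_def narayana_def)
  next
    case 2 
    have "{1..2::nat} = {1,2}" by auto
    thus ?thesis using 2 nc_val_Suc[of x 0] nc_val_Suc[of x 1]
      by (simp add: beta_poly_def narayana_def numeral_2_eq_2)
  next
    case (3 n)
    have "(real n + 3) * beta_poly m x = (real n + 3) * nc_val x m"
      unfolding 3(1) beta_poly_recurrence[OF 3(2)] nc_val_recurrence
      using less.IH[of n] less.IH[of "n+1"] 3 by simp
    thus ?thesis by simp
  qed
qed

section \<open>Words of rank one projections\<close>

definition vmono :: "'v set \<Rightarrow> ('v \<Rightarrow> nat) \<Rightarrow> ('v \<Rightarrow> complex) \<Rightarrow> complex" where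
  "vmono V \<alpha> x = (\<Prod>z\<in>V. x z ^ \<alpha> z)"

text \<open>The exponent truncates at 0, but a decreased monomial always comes with the factor
  \<open>\<alpha> u\<close>, which vanishes in that case.\<close>

definition decr :: "'v \<Rightarrow> ('v \<Rightarrow> nat) \<Rightarrow> 'v \<Rightarrow> nat" where
  "decr u \<alpha> = \<alpha>(u := \<alpha> u - 1)"

lemma vmono_add: "vmono V (\<lambda>z. \<alpha> z + \<beta> z) x = vmono V \<alpha> x * vmono V \<beta> x"
  by (simp add: vmono_def power_add prod.distrib)

lemma vmono_0 [simp]: "vmono V (\<lambda>_. 0) x = 1"
  by (simp add: vmono_def)

lemma vmono_incr:
  assumes "finite V" "w \<in> V"
  shows "vmono V (\<alpha>(w := Suc (\<alpha> w))) x = x w * vmono V \<alpha> x"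
proof -
  have "(\<Prod>z\<in>V-{w}. x z ^ (if z = w then Suc (\<alpha> w) else \<alpha> z)) = (\<Prod>z\<in>V-{w}. x z ^ \<alpha> z)"
    by (rule prod.cong) auto
  thus ?thesis using assms by (simp add: vmono_def prod.remove[of V w] fun_upd_def)
qed

lemma vmono_single:
  assumes "finite V" "w \<in> V"
  shows "vmono V ((\<lambda>_. 0)(w := Suc 0)) x = x w"
  using vmono_incr[OF assms, of "\<lambda>_. 0" x] by simp

text \<open>\<open>poly_deriv V A B u P Q f f'\<close>: \<open>f\<close> is a polynomial in the variables \<open>V\<close>, homogeneous of
  degree \<open>P\<close> in \<open>A\<close> and \<open>Q\<close> in \<open>B\<close>, and \<open>f'\<close> is its formal derivative in the variable \<open>u\<close>.\<close>

inductive poly_deriv :: "'v set \<Rightarrow> 'v set \<Rightarrow> 'v set \<Rightarrow> 'v \<Rightarrow> nat \<Rightarrow> nat \<Rightarrow>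
    (('v \<Rightarrow> complex) \<Rightarrow> complex) \<Rightarrow> (('v \<Rightarrow> complex) \<Rightarrow> complex) \<Rightarrow> bool"
  for V A B u where
  mono: "sum \<alpha> A = P \<Longrightarrow> sum \<alpha> B = Q \<Longrightarrow>
    poly_deriv V A B u P Q (\<lambda>x. k * vmono V \<alpha> x) (\<lambda>x. k * (of_nat (\<alpha> u) * vmono V (decr u \<alpha>) x))"
| add: "poly_deriv V A B u P Q f f' \<Longrightarrow> poly_deriv V A B u P Q g g' \<Longrightarrow>
    poly_deriv V A B u P Q (\<lambda>x. f x + g x) (\<lambda>x. f' x + g' x)"

lemma poly_deriv_cong:
  assumes "poly_deriv V A B u P Q f f'" "\<And>x. f x = g x" "\<And>x. f' x = g' x" "P = P'" "Q = Q'"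
  shows "poly_deriv V A B u P' Q' g g'"
proof -
  have "f = g" "f' = g'" using assms by auto
  thus ?thesis using assms by simp
qed

lemma poly_deriv_const: "poly_deriv V A B u 0 0 (\<lambda>x. k) (\<lambda>x. 0)"
  by (rule poly_deriv_cong[OF poly_deriv.mono[where \<alpha> = "\<lambda>_. 0" and k = k]]) auto

lemma poly_deriv_var:
  assumes "finite V" "w \<in> V" "finite A" "finite B"
  shows "poly_deriv V A B u (if w \<in> A then 1 else 0) (if w \<in> B then 1 else 0)
    (\<lambda>x. x w) (\<lambda>x. if u = w then 1 else 0)"
proof (rule poly_deriv_cong[OF poly_deriv.mono[where \<alpha> = "(\<lambda>_. 0)(w := Suc 0)" and k = 1]])
  show "1 * vmono V ((\<lambda>_. 0)(w := Suc 0)) x = x w" for x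
    using vmono_single[OF assms(1,2)] by simp
  show "1 * (of_nat (((\<lambda>_. 0)(w := Suc 0)) u) * vmono V (decr u ((\<lambda>_. 0)(w := Suc 0))) x)
     = (if u = w then 1 else 0)" for x
  proof (cases "u = w")
    case True
    have "decr u ((\<lambda>_. 0)(w := Suc 0)) = (\<lambda>_. 0)" using True by (auto simp: decr_def)
    thus ?thesis using True by simp
  qed simp
qed (use assms in \<open>auto simp: sum.delta fun_upd_def\<close>)

text \<open>The Leibniz rule for two monomials, to which \<open>poly_deriv_mult\<close> reduces the
  general one.\<close>

lemma vmono_decr_add:
  fixes \<alpha> \<beta> :: "'v \<Rightarrow> nat"
  shows "of_nat (\<alpha> u + \<beta> u) * vmono V (decr u (\<lambda>z. \<alpha> z + \<beta> z)) x =
   of_nat (\<alpha> u) * vmono V (decr u \<alpha>) x * vmono V \<beta> x + vmono V \<alpha> x * (of_nat (\<beta> u) * vmono V (decr u \<beta>) x)"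
proof -
  have 1: "of_nat (\<alpha> u) * vmono V (decr u (\<lambda>z. \<alpha> z + \<beta> z)) x = of_nat (\<alpha> u) * (vmono V (decr u \<alpha>) x * vmono V \<beta> x)"
    for \<alpha> \<beta> :: "'v \<Rightarrow> nat"
  proof (cases "\<alpha> u = 0")
    case False
    hence "decr u (\<lambda>z. \<alpha> z + \<beta> z) = (\<lambda>z. decr u \<alpha> z + \<beta> z)"
      by (auto simp: decr_def)
    thus ?thesis by (simp add: vmono_add)
  qed simp
  have "(\<lambda>z. \<beta> z + \<alpha> z) = (\<lambda>z. \<alpha> z + \<beta> z)" by (simp add: add.commute)
  with 1[of \<alpha> \<beta>] 1[of \<beta> \<alpha>] show ?thesis
    by (simp only: of_nat_add ring_distribs mult_ac)
qed

lemma poly_deriv_mult: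
  assumes "poly_deriv V A B u P Q f f'" "poly_deriv V A B u P' Q' g g'"
  shows "poly_deriv V A B u (P + P') (Q + Q') (\<lambda>x. f x * g x) (\<lambda>x. f' x * g x + f x * g' x)"
  using assms(1)
proof induction
  case (mono \<alpha> P Q k)
  from assms(2) show ?case
  proof induction
    case (mono \<beta> P' Q' l)
    show ?case
      by (rule poly_deriv_cong[OF poly_deriv.mono[where \<alpha> = "\<lambda>z. \<alpha> z + \<beta> z" and k = "k * l"]])
         (use mono \<open>sum \<alpha> A = P\<close> \<open>sum \<alpha> B = Q\<close> in
           \<open>simp_all only: sum.distrib vmono_add vmono_decr_add, simp_all add: algebra_simps\<close>)
  next
    case (add P' Q' f1 f1' f2 f2')
    show ?case
      by (rule poly_deriv_cong[OF poly_deriv.add[OF add.IH]]) (simp_all add: algebra_simps)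
  qed
next
  case (add P Q f1 f1' f2 f2')
  show ?case
    by (rule poly_deriv_cong[OF poly_deriv.add[OF add.IH]]) (simp_all add: algebra_simps)
qed

lemma poly_deriv_sum:
  assumes "finite I" "I \<noteq> {}" "\<And>i. i \<in> I \<Longrightarrow> poly_deriv V A B u P Q (f i) (f' i)"
  shows "poly_deriv V A B u P Q (\<lambda>x. \<Sum>i\<in>I. f i x) (\<lambda>x. \<Sum>i\<in>I. f' i x)"
  using assms
proof (induction rule: finite_ne_induct)
  case (insert i F)
  show ?case
    by (rule poly_deriv_cong[OF poly_deriv.add[of _ _ _ _ _ _ "f i" "f' i" "\<lambda>x. \<Sum>i\<in>F. f i x" "\<lambda>x. \<Sum>i\<in>F. f' i x"]])
       (use insert in auto)
qed simp

lemma poly_deriv_integrable: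
  assumes "poly_deriv V A B u P Q f f'" "\<And>\<alpha>. integrable M (\<lambda>\<omega>. vmono V \<alpha> (X \<omega>))"
  shows "integrable M (\<lambda>\<omega>. f (X \<omega>))" "integrable M (\<lambda>\<omega>. f' (X \<omega>))"
  using assms(1) by induction (auto intro!: integrable_mult_right assms(2))

text \<open>Both sides are linear in the pair of f and f', so the identity for monomials suffices.
  The constant \<kappa> may depend on the bidegree, which is why \<open>poly_deriv\<close> keeps P
  and Q fixed under addition.\<close>

lemma poly_deriv_by_parts:
  assumes "poly_deriv V A B u P Q f f'" "\<And>\<alpha>. integrable M (\<lambda>\<omega>. vmono V \<alpha> (X \<omega>))"
    and "finite V" "w \<in> V"
    and ibp: "\<And>\<alpha>. sum \<alpha> A = P \<Longrightarrow> sum \<alpha> B = Q \<Longrightarrow>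
      \<kappa> * (\<integral>\<omega>. vmono V (\<alpha>(w := Suc (\<alpha> w))) (X \<omega>) \<partial>M) = of_nat (\<alpha> u) * (\<integral>\<omega>. vmono V (decr u \<alpha>) (X \<omega>) \<partial>M)"
  shows "integrable M (\<lambda>\<omega>. X \<omega> w * f (X \<omega>)) \<and>
    \<kappa> * (\<integral>\<omega>. X \<omega> w * f (X \<omega>) \<partial>M) = (\<integral>\<omega>. f' (X \<omega>) \<partial>M)"
  using assms(1) ibp
proof induction
  case (mono \<alpha> P Q k)
  have eq: "X \<omega> w * (k * vmono V \<alpha> (X \<omega>)) = k * vmono V (\<alpha>(w := Suc (\<alpha> w))) (X \<omega>)" for \<omega>
    using vmono_incr[OF assms(3,4)] by simp
  have "\<kappa> * (\<integral>\<omega>. X \<omega> w * (k * vmono V \<alpha> (X \<omega>)) \<partial>M) =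
      k * (\<kappa> * (\<integral>\<omega>. vmono V (\<alpha>(w := Suc (\<alpha> w))) (X \<omega>) \<partial>M))"
    unfolding eq by simp
  also have "\<dots> = (\<integral>\<omega>. k * (of_nat (\<alpha> u) * vmono V (decr u \<alpha>) (X \<omega>)) \<partial>M)"
    unfolding mono.prems[OF mono.hyps] by simp
  finally show ?case unfolding eq by (simp add: assms(2))
next
  case (add P Q f f' g g')
  note i = poly_deriv_integrable[OF add.hyps(1) assms(2)] poly_deriv_integrable[OF add.hyps(2) assms(2)]
  from add.IH[OF add.prems] i show ?case
    by (simp add: ring_distribs)
qed

text \<open>Needed to factor expectations over independent tensor factors: a product of k traces
  becomes a sum of products of monomials.\<close>

lemma poly_deriv_repr:
  assumes "poly_deriv V A B u P Q f f'"
  shows "\<exists>(n::nat) k \<alpha>. \<forall>x. f x = (\<Sum>i<n. k i * vmono V (\<alpha> i) x)"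
  using assms
proof induction
  case (mono \<alpha> P Q k)
  show ?case by (rule exI[of _ 1], rule exI[of _ "\<lambda>_. k"], rule exI[of _ "\<lambda>_. \<alpha>"]) simp
next
  case (add P Q f f' g g')
  then obtain n m :: nat and k \<alpha> l \<beta> where *:
    "\<And>x. f x = (\<Sum>i<n. k i * vmono V (\<alpha> i) x)" "\<And>x. g x = (\<Sum>i<m. l i * vmono V (\<beta> i) x)"
    by metis
  have split: "(\<Sum>i<n+m. h i) = (\<Sum>i<n. h i) + (\<Sum>i<m. h (n + i))" for h :: "nat \<Rightarrow> complex"
    by (induction m) (simp_all add: add.assoc)
  show ?case
    by (rule exI[of _ "n + m"], rule exI[of _ "\<lambda>i. if i < n then k i else l (i - n)"],
        rule exI[of _ "\<lambda>i. if i < n then \<alpha> i else \<beta> (i - n)"]) (simp add: split *)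
qed

section \<open>Traces of words as polynomials in kets and bras\<close>

type_synonym config = "bool \<times> nat \<times> nat \<Rightarrow> complex"

text \<open>A configuration holds the entries \<open>x (True, t, i)\<close> of kets and \<open>x (False, t, i)\<close> of bras,
  treated as independent variables; \<open>word_mat\<close> multiplies the rank one matrices along a word.\<close>

fun word_mat :: "nat \<Rightarrow> config \<Rightarrow> nat list \<Rightarrow> nat \<Rightarrow> nat \<Rightarrow> complex" where
  "word_mat d x [] i j = (if i = j then 1 else 0)"
| "word_mat d x (t # w) i j = x (True, t, i) * (\<Sum>l<d. x (False, t, l) * word_mat d x w l j)"

definition word_tr :: "nat \<Rightarrow> config \<Rightarrow> nat list \<Rightarrow> complex" where
  "word_tr d x w = (\<Sum>i<d. word_mat d x w i i)"

definition words_tr :: "nat \<Rightarrow> config \<Rightarrow> nat list list \<Rightarrow> complex" where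
  "words_tr d x ws = (\<Prod>w\<leftarrow>ws. word_tr d x w)"

text \<open>The matrix of \<open>w\<close> applied to the ket of \<open>a\<close>: what is left of a
  trace after a bra coordinate of \<open>a\<close> has been removed from it.\<close>

definition word_vec :: "nat \<Rightarrow> config \<Rightarrow> nat \<Rightarrow> nat list \<Rightarrow> nat \<Rightarrow> complex" where
  "word_vec d x a w j = (\<Sum>l<d. word_mat d x w j l * x (True, a, l))"

lemma word_mat_append:
  "i < d \<Longrightarrow> word_mat d x (u @ w) i j = (\<Sum>l<d. word_mat d x u i l * word_mat d x w l j)"
proof (induction u arbitrary: i)
  case Nil
  have "(\<Sum>l<d. (if i = l then 1 else 0) * word_mat d x w l j) = (\<Sum>l<d. if i = l then word_mat d x w l j else 0)"
    by (rule sum.cong) auto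
  thus ?case using Nil by simp
next
  case (Cons t u)
  have "word_mat d x ((t # u) @ w) i j =
      x (True, t, i) * (\<Sum>m<d. x (False, t, m) * (\<Sum>l<d. word_mat d x u m l * word_mat d x w l j))"
    using Cons.IH by simp
  also have "\<dots> = (\<Sum>l<d. x (True, t, i) * (\<Sum>m<d. x (False, t, m) * word_mat d x u m l) * word_mat d x w l j)"
    by (simp add: sum_distrib_left sum_distrib_right mult_ac) (rule sum.swap)
  finally show ?case by simp
qed

lemma word_tr_commute: "word_tr d x (u @ w) = word_tr d x (w @ u)"
  unfolding word_tr_def by (simp add: word_mat_append, subst sum.swap) (simp add: mult_ac)

lemma word_vec_append:
  "j < d \<Longrightarrow> word_vec d x a (u @ w) j = (\<Sum>l<d. word_mat d x u j l * word_vec d x a w l)"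
  unfolding word_vec_def
  by (simp add: word_mat_append sum_distrib_left sum_distrib_right mult_ac) (rule sum.swap)

lemma word_tr_Cons: "word_tr d x (a # w) = (\<Sum>l<d. x (False, a, l) * word_vec d x a w l)"
  unfolding word_tr_def word_vec_def
  by (simp add: sum_distrib_left sum_distrib_right mult_ac) (rule sum.swap)

lemma word_tr_Nil [simp]: "word_tr d x [] = of_nat d"
  by (simp add: word_tr_def)

lemma words_tr_Nil [simp]: "words_tr d x [] = 1"
  and words_tr_Cons [simp]: "words_tr d x (w # ws) = word_tr d x w * words_tr d x ws"
  by (simp_all add: words_tr_def)

definition cvars :: "nat \<Rightarrow> nat \<Rightarrow> (bool \<times> nat \<times> nat) set" where
  "cvars p d = UNIV \<times> {..<p} \<times> {..<d}"

definition letter_vars :: "nat \<Rightarrow> nat \<Rightarrow> bool \<Rightarrow> (bool \<times> nat \<times> nat) set" where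
  "letter_vars d a b = {b} \<times> {a} \<times> {..<d}"

lemma finite_vars [simp]: "finite (cvars p d)" "finite (letter_vars d a b)"
  by (simp_all add: cvars_def letter_vars_def)

abbreviation cpoly :: "nat \<Rightarrow> nat \<Rightarrow> nat \<Rightarrow> nat \<Rightarrow> nat \<Rightarrow> nat \<Rightarrow> (config \<Rightarrow> complex) \<Rightarrow> (config \<Rightarrow> complex) \<Rightarrow> bool" where
  "cpoly p d a i \<equiv> poly_deriv (cvars p d) (letter_vars d a True) (letter_vars d a False) (False, a, i)"

lemma cpoly_ket:
  assumes "t < p" "j < d"
  shows "cpoly p d a i (if t = a then 1 else 0) 0 (\<lambda>x. x (True, t, j)) (\<lambda>x. 0)"
  by (rule poly_deriv_cong[OF poly_deriv_var[where w = "(True, t, j)"]])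
     (use assms in \<open>auto simp: cvars_def letter_vars_def\<close>)

lemma cpoly_bra:
  assumes "t < p" "j < d"
  shows "cpoly p d a i 0 (if t = a then 1 else 0) (\<lambda>x. x (False, t, j)) (\<lambda>x. if t = a \<and> j = i then 1 else 0)"
  by (rule poly_deriv_cong[OF poly_deriv_var[where w = "(False, t, j)"]])
     (use assms in \<open>auto simp: cvars_def letter_vars_def\<close>)

text \<open>Differentiation by a bra coordinate of \<open>a\<close> deletes one bra, so at each
  occurrence of \<open>a\<close> the product falls apart: the part up to the ket of that occurrence
  is a \<open>word_vec\<close>, and the rest starts at row i. Each occurrence of \<open>a\<close>
  brings one ket and one bra, whence the bidegree.\<close>

lemma cpoly_word_mat:
  assumes "d \<ge> 1" "i < d" "set w \<subseteq> {..<p}" "j < d" "k < d"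
  shows "cpoly p d a i (count_list w a) (count_list w a) (\<lambda>x. word_mat d x w j k)
    (\<lambda>x. \<Sum>n<length w. if w ! n = a then word_vec d x a (take n w) j * word_mat d x (drop (Suc n) w) i k else 0)"
  using assms(3,4)
proof (induction w arbitrary: j)
  case Nil
  show ?case by (rule poly_deriv_cong[OF poly_deriv_const[where k = "if j = k then 1 else 0"]]) auto
next
  case (Cons t w)
  define D where "D x l = (\<Sum>n<length w. if w ! n = a then word_vec d x a (take n w) l * word_mat d x (drop (Suc n) w) i k else 0)"
    for x l
  have IH: "cpoly p d a i (count_list w a) (count_list w a) (\<lambda>x. word_mat d x w l k) (\<lambda>x. D x l)" if "l < d" for l
    unfolding D_def using Cons that by auto
  have t: "t < p" using Cons.prems by simp
  have S: "cpoly p d a i (0 + count_list w a) ((if t = a then 1 else 0) + count_list w a)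
      (\<lambda>x. \<Sum>l<d. x (False, t, l) * word_mat d x w l k)
      (\<lambda>x. \<Sum>l<d. (if t = a \<and> l = i then 1 else 0) * word_mat d x w l k + x (False, t, l) * D x l)"
    by (intro poly_deriv_sum poly_deriv_mult cpoly_bra IH) (use assms t in \<open>auto simp: lessThan_empty_iff\<close>)
  show ?case
  proof (rule poly_deriv_cong[OF poly_deriv_mult[OF cpoly_ket[OF t Cons.prems(2)] S]])
    fix x :: config
    have v0: "word_vec d x a [] j = x (True, a, j)"
      using Cons.prems by (simp add: word_vec_def if_distrib[of "\<lambda>z. z * _"] cong: if_cong)
    define B where "B u = (\<Sum>l<d. x (False, t, l) * word_vec d x a u l)" for u
    have v1: "word_vec d x a (t # u) j = x (True, t, j) * B u" for u
      using Cons.prems unfolding B_def by (simp add: word_vec_def sum_distrib_left sum_distrib_right mult_ac) (rule sum.swap)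
    have "(\<Sum>l<d. (if t = a \<and> l = i then 1 else 0) * word_mat d x w l k) =
        (\<Sum>l<d. if l = i then (if t = a then word_mat d x w i k else 0) else 0)"
      by (rule sum.cong) auto
    also have "\<dots> = (if t = a then word_mat d x w i k else 0)" using assms by simp
    finally have e1: "(\<Sum>l<d. (if t = a \<and> l = i then 1 else 0) * word_mat d x w l k) = \<dots>" .
    have "(\<Sum>l<d. x (False, t, l) * D x l) = (\<Sum>n<length w. if w ! n = a then
       B (take n w) * word_mat d x (drop (Suc n) w) i k else 0)"
      unfolding D_def B_def sum_distrib_left
      by (subst sum.swap, rule sum.cong) (auto simp: sum_distrib_left sum_distrib_right mult_ac)
    thus "0 * (\<Sum>l<d. x (False, t, l) * word_mat d x w l k) + x (True, t, j) *
       (\<Sum>l<d. (if t = a \<and> l = i then 1 else 0) * word_mat d x w l k + x (False, t, l) * D x l) =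
      (\<Sum>n<length (t # w). if (t # w) ! n = a then word_vec d x a (take n (t # w)) j *
          word_mat d x (drop (Suc n) (t # w)) i k else 0)"
      by (simp only: sum.distrib e1 length_Cons sum.lessThan_Suc_shift)
         (simp add: v0 v1 sum_distrib_left distrib_left if_distrib[of "\<lambda>z. _ * z"] mult.assoc cong: if_cong)
  qed auto
qed

text \<open>The cyclic word with position \<open>n\<close> removed, read from the letter that
  follows it.\<close>

definition open_at :: "nat \<Rightarrow> 'a list \<Rightarrow> 'a list" where
  "open_at n w = drop (Suc n) w @ take n w"

lemma length_open_at: "n < length w \<Longrightarrow> Suc (length (open_at n w)) = length w"
  by (simp add: open_at_def)

lemma set_open_at: "n < length w \<Longrightarrow> set w = insert (w ! n) (set (open_at n w))"
  unfolding open_at_def by (subst (1) id_take_nth_drop[of n w]) auto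

lemma cpoly_word_tr:
  assumes "d \<ge> 1" "i < d" "set w \<subseteq> {..<p}"
  shows "cpoly p d a i (count_list w a) (count_list w a) (\<lambda>x. word_tr d x w)
    (\<lambda>x. \<Sum>n<length w. if w ! n = a then word_vec d x a (open_at n w) i else 0)"
proof (rule poly_deriv_cong)
  show "cpoly p d a i (count_list w a) (count_list w a) (\<lambda>x. \<Sum>j<d. word_mat d x w j j) 
    (\<lambda>x. \<Sum>j<d. \<Sum>n<length w. if w ! n = a then word_vec d x a (take n w) j * word_mat d x (drop (Suc n) w) i j else 0)"
    by (intro poly_deriv_sum cpoly_word_mat) (use assms in \<open>auto simp: lessThan_empty_iff\<close>)
  show "(\<Sum>j<d. word_mat d x w j j) = word_tr d x w" for x by (simp add: word_tr_def)
  show "(\<Sum>j<d. \<Sum>n<length w. if w ! n = a then word_vec d x a (take n w) j * word_mat d x (drop (Suc n) w) i j else 0)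
     = (\<Sum>n<length w. if w ! n = a then word_vec d x a (open_at n w) i else 0)" for x
    by (subst sum.swap, rule sum.cong) (use assms in \<open>auto simp: open_at_def word_vec_append mult_ac\<close>)
qed auto

definition remove_nth :: "nat \<Rightarrow> 'a list \<Rightarrow> 'a list" where
  "remove_nth n xs = take n xs @ drop (Suc n) xs"

lemma remove_nth_simps [simp]:
  "remove_nth 0 (x # xs) = xs" "remove_nth (Suc n) (x # xs) = x # remove_nth n xs"
  by (simp_all add: remove_nth_def)

lemma cpoly_words_tr:
  assumes "d \<ge> 1" "i < d" "\<forall>w\<in>set ws. set w \<subseteq> {..<p}"
  shows "cpoly p d a i (\<Sum>w\<leftarrow>ws. count_list w a) (\<Sum>w\<leftarrow>ws. count_list w a) (\<lambda>x. words_tr d x ws)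
    (\<lambda>x. \<Sum>m<length ws. \<Sum>n<length (ws ! m). if ws ! m ! n = a
       then word_vec d x a (open_at n (ws ! m)) i * words_tr d x (remove_nth m ws) else 0)"
  using assms(3)
proof (induction ws)
  case Nil
  show ?case by (rule poly_deriv_cong[OF poly_deriv_const[where k = 1]]) auto
next
  case (Cons w ws)
  show ?case
  proof (rule poly_deriv_cong[OF poly_deriv_mult[OF cpoly_word_tr[of d i w p a] Cons.IH]])
    fix x :: config
    show "(\<Sum>n<length w. if w ! n = a then word_vec d x a (open_at n w) i else 0) * words_tr d x ws +
         word_tr d x w * (\<Sum>m<length ws. \<Sum>n<length (ws ! m). if ws ! m ! n = a then
           word_vec d x a (open_at n (ws ! m)) i * words_tr d x (remove_nth m ws) else 0) =
        (\<Sum>m<length (w # ws). \<Sum>n<length ((w # ws) ! m). if (w # ws) ! m ! n = a then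
         word_vec d x a (open_at n ((w # ws) ! m)) i * words_tr d x (remove_nth m (w # ws)) else 0)"
      by (simp only: length_Cons sum.lessThan_Suc_shift)
         (simp add: sum_distrib_left sum_distrib_right if_distrib[of "\<lambda>z. _ * z"] if_distrib[of "\<lambda>z. z * _"] mult_ac cong: if_cong)
  qed (use assms Cons.prems in auto)
qed

section \<open>Moments of the complex Gaussian\<close>

text \<open>Gaussian integration by parts for powers, read off from the closed forms of the even and
  odd moments. At n = 0 the truncated exponent n - 1 is harmless because of the factor n.\<close>

lemma std_normal_moment_Suc:
  "(\<integral>x. std_normal_density x * x ^ Suc n \<partial>lborel) = real n * (\<integral>x. std_normal_density x * x ^ (n - 1) \<partial>lborel)"
proof -
  define m where "m k = (\<integral>x. std_normal_density x * x ^ k \<partial>lborel)" for k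
  have ev: "m (2 * k) = fact (2 * k) / (2 ^ k * fact k)" for k
    unfolding m_def using std_normal_moment_even by (rule has_bochner_integral_integral_eq)
  have od: "m (2 * k + 1) = 0" for k
    unfolding m_def using std_normal_moment_odd by (rule has_bochner_integral_integral_eq)
  have "m (Suc n) = real n * m (n - 1)"
  proof (cases "even n")
    case True
    then obtain k where k: "n = 2 * k" by blast
    have "real n * m (n - 1) = 0"
    proof (cases k)
      case (Suc j)
      have "n - 1 = 2 * j + 1" using k Suc by simp
      thus ?thesis using od[of j] by (simp only: mult_zero_right)
    qed (simp add: k)
    moreover have "m (Suc n) = 0" using od[of k] k by simp
    ultimately show ?thesis by simp
  next
    case False
    then obtain k where k: "n = 2 * k + 1" using oddE by blast
    have "m (Suc n) = m (2 * Suc k)" using k by simp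
    also have "\<dots> = fact (Suc (Suc (2 * k))) / (2 * 2 ^ k * fact (Suc k))" unfolding ev by simp
    also have "\<dots> = real n * (fact (2 * k) / (2 ^ k * fact k))"
      by (simp add: k divide_simps) (simp add: algebra_simps)?
    finally show ?thesis using k by (simp add: ev)
  qed
  thus ?thesis by (simp add: m_def)
qed

text \<open>A standard Gaussian pair of real coordinates. It is indexed by \<open>Basis\<close>
  because \<open>lborel\<close> on the complex numbers is the image of the product measure over
  \<open>Basis\<close>.\<close>

definition gauss2 :: "(complex \<Rightarrow> real) measure" where
  "gauss2 = density (PiM Basis (\<lambda>_. lborel)) (\<lambda>f. \<Prod>b\<in>Basis. std_normal_density (f b))"

lemma gauss2_vmono:
  "integrable gauss2 (\<lambda>f. vmono Basis \<alpha> (\<lambda>b. complex_of_real (f b)))"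
  "(\<integral>f. vmono Basis \<alpha> (\<lambda>b. complex_of_real (f b)) \<partial>gauss2) =
     of_real (\<Prod>b\<in>Basis. \<integral>x. std_normal_density x * x ^ \<alpha> b \<partial>lborel)"
proof -
  interpret product_sigma_finite "\<lambda>_::complex. lborel :: real measure"
    by standard
  have eq: "(\<Prod>b\<in>Basis. std_normal_density (f b)) *\<^sub>R vmono Basis \<alpha> (\<lambda>b. complex_of_real (f b)) =
     (\<Prod>b\<in>Basis. complex_of_real (std_normal_density (f b) * f b ^ \<alpha> b))" for f :: "complex \<Rightarrow> real"
    by (simp add: vmono_def scaleR_conv_of_real prod.distrib del: Basis_complex_def)
  have int: "integrable lborel (\<lambda>x. complex_of_real (std_normal_density x * x ^ n))" for n
    using integrable_std_normal_moment[of n] by (rule integrable_of_real)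
  have meas: "(\<lambda>f. vmono Basis \<alpha> (\<lambda>b. complex_of_real (f b))) \<in> borel_measurable (PiM Basis (\<lambda>_. lborel))"
    unfolding vmono_def by measurable
  have nn: "AE f in PiM Basis (\<lambda>_. lborel). 0 \<le> (\<Prod>b\<in>Basis. std_normal_density (f b))"
    by (auto intro!: AE_I2 prod_nonneg)
  have meas2: "(\<lambda>f::complex\<Rightarrow>real. \<Prod>b\<in>Basis. std_normal_density (f b)) \<in> borel_measurable (PiM Basis (\<lambda>_. lborel))"
    by measurable
  show "integrable gauss2 (\<lambda>f. vmono Basis \<alpha> (\<lambda>b. complex_of_real (f b)))"
    unfolding gauss2_def integrable_density[OF meas meas2 nn] eq
    by (rule product_integrable_prod[OF _ int]) simp
  show "(\<integral>f. vmono Basis \<alpha> (\<lambda>b. complex_of_real (f b)) \<partial>gauss2) =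
     of_real (\<Prod>b\<in>Basis. \<integral>x. std_normal_density x * x ^ \<alpha> b \<partial>lborel)"
    unfolding gauss2_def integral_density[OF meas meas2 nn] eq
    by (subst product_integral_prod[OF _ int]) (simp_all only: integral_complex_of_real of_real_prod finite_Basis)
qed

lemma poly_deriv_power:
  assumes "poly_deriv V {} {} u 0 0 f f'"
  shows "poly_deriv V {} {} u 0 0 (\<lambda>x. f x ^ n) (\<lambda>x. of_nat n * f x ^ (n - 1) * f' x)"
proof (induction n)
  case 0
  show ?case by (rule poly_deriv_cong[OF poly_deriv_const[where k = 1]]) auto
next
  case (Suc n)
  show ?case
  proof (rule poly_deriv_cong[OF poly_deriv_mult[OF assms Suc]])
    show "f' x * f x ^ n + f x * (of_nat n * f x ^ (n - 1) * f' x) = of_nat (Suc n) * f x ^ (Suc n - 1) * f' x" for x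
      by (cases n) (simp_all add: algebra_simps)
  qed simp_all
qed

text \<open>For P = z and Q = cnj z as polynomials in the two real coordinates, the derivative in 1
  plus \<i> times the derivative in \<i> annihilates P and sends Q to 2. Integration by parts
  therefore gives E[z^(a+1) cnj z^b] = 2 b E[z^a cnj z^(b-1)]. The powers of 2 reflect that both
  coordinates have variance 1.\<close>

lemma gauss2_moment:
  fixes z :: "(complex \<Rightarrow> real) \<Rightarrow> complex"
  defines "z \<equiv> \<lambda>f. of_real (f 1) + \<i> * of_real (f \<i>)"
  shows "integrable gauss2 (\<lambda>f. z f ^ \<alpha> * cnj (z f) ^ \<beta>)"
    and "(\<integral>f. z f ^ \<alpha> * cnj (z f) ^ \<beta> \<partial>gauss2) = (if \<alpha> = \<beta> then 2 ^ \<alpha> * fact \<alpha> else 0)"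
proof -
  define X where "X f b = complex_of_real (f b)" for f :: "complex \<Rightarrow> real" and b
  define P where "P = (\<lambda>x :: complex \<Rightarrow> complex. x 1 + \<i> * x \<i>)"
  define Q where "Q = (\<lambda>x :: complex \<Rightarrow> complex. x 1 + (- \<i>) * x \<i>)"
  have zP: "z f ^ a * cnj (z f) ^ b = P (X f) ^ a * Q (X f) ^ b" for f a b
    by (simp add: z_def P_def Q_def X_def)
  note int = gauss2_vmono(1)[folded X_def]
  have lin: "poly_deriv Basis {} {} u 0 0 (\<lambda>x. x 1 + c * x \<i>) (\<lambda>x. (if u = 1 then 1 else 0) + c * (if u = \<i> then 1 else 0))"
    for u c
  proof -
    have var: "poly_deriv Basis {} {} u 0 0 (\<lambda>x. x w) (\<lambda>x. if u = w then 1 else 0)" if "w \<in> Basis" for w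
      by (rule poly_deriv_cong[OF poly_deriv_var[where w = w]]) (use that in auto)
    have b: "1 \<in> (Basis :: complex set)" "\<i> \<in> (Basis :: complex set)" by (auto simp: Basis_complex_def)
    show ?thesis
      by (rule poly_deriv_cong[OF poly_deriv.add[OF var[OF b(1)]
            poly_deriv_cong[OF poly_deriv_mult[OF poly_deriv_const[where k = c] var[OF b(2)]]]]]) auto
  qed
  have pol: "poly_deriv Basis {} {} u 0 0 (\<lambda>x. P x ^ a * Q x ^ b)
     (\<lambda>x. (of_nat a * P x ^ (a - 1) * ((if u = 1 then 1 else 0) + \<i> * (if u = \<i> then 1 else 0))) * Q x ^ b +
          P x ^ a * (of_nat b * Q x ^ (b - 1) * ((if u = 1 then 1 else 0) + (-\<i>) * (if u = \<i> then 1 else 0))))" for u a b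
    by (rule poly_deriv_cong[OF poly_deriv_mult[OF poly_deriv_power[OF lin[of u \<i>, folded P_def]]
          poly_deriv_power[OF lin[of u "- \<i>", folded Q_def]]]]) simp_all
  have intPQ: "integrable gauss2 (\<lambda>f. P (X f) ^ a * Q (X f) ^ b)" for a b
    by (rule poly_deriv_integrable(1)[OF pol[of 1] int])
  show "integrable gauss2 (\<lambda>f. z f ^ \<alpha> * cnj (z f) ^ \<beta>)"
    unfolding zP by (rule intPQ)
  define K where "K a b = (\<integral>f. z f ^ a * cnj (z f) ^ b \<partial>gauss2)" for a b
  have mom: "(\<integral>f. vmono Basis (\<alpha>(w := Suc (\<alpha> w))) (X f) \<partial>gauss2) =
      of_nat (\<alpha> w) * (\<integral>f. vmono Basis (decr w \<alpha>) (X f) \<partial>gauss2)" if w: "w \<in> Basis" for w \<alpha>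
  proof -
    define m where "m k = (\<integral>x. std_normal_density x * x ^ k \<partial>lborel)" for k
    have "(\<Prod>b\<in>Basis. m ((\<alpha>(w := Suc (\<alpha> w))) b)) = m (Suc (\<alpha> w)) * (\<Prod>b\<in>Basis - {w}. m (\<alpha> b))"
      using w by (subst prod.remove[OF finite_Basis w]) auto
    moreover have "(\<Prod>b\<in>Basis. m (decr w \<alpha> b)) = m (\<alpha> w - 1) * (\<Prod>b\<in>Basis - {w}. m (\<alpha> b))"
      using w by (subst prod.remove[OF finite_Basis w]) (auto simp: decr_def)
    moreover have "m (Suc (\<alpha> w)) = real (\<alpha> w) * m (\<alpha> w - 1)"
      unfolding m_def by (rule std_normal_moment_Suc)
    ultimately show ?thesis
      unfolding X_def gauss2_vmono(2) m_def[symmetric] by simp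
  qed
  have rec: "K (Suc a) b = 2 * of_nat b * K a (b - 1)" for a b
  proof -
    define F where "F x = P x ^ a * Q x ^ b" for x
    define G H where "G f = of_nat a * (P (X f) ^ (a - 1) * Q (X f) ^ b)"
      and "H f = of_nat b * (P (X f) ^ a * Q (X f) ^ (b - 1))" for f
    have B: "1 \<in> (Basis :: complex set)" "\<i> \<in> (Basis :: complex set)" by (auto simp: Basis_complex_def)
    have parts: "integrable gauss2 (\<lambda>f. X f u * F (X f)) \<and> 1 * (\<integral>f. X f u * F (X f) \<partial>gauss2) =
        (\<integral>f. (of_nat a * P (X f) ^ (a - 1) * ((if u = 1 then 1 else 0) + \<i> * (if u = \<i> then 1 else 0))) * Q (X f) ^ b +
          P (X f) ^ a * (of_nat b * Q (X f) ^ (b - 1) * ((if u = 1 then 1 else 0) + (-\<i>) * (if u = \<i> then 1 else 0))) \<partial>gauss2)"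
      if "u \<in> Basis" for u
      unfolding F_def
      by (rule poly_deriv_by_parts[OF pol int finite_Basis that]) (simp add: mom[OF that])
    have ne: "\<i> \<noteq> 1" "1 \<noteq> \<i>" by (auto simp: complex_eq_iff)
    have 1: "integrable gauss2 (\<lambda>f. X f 1 * F (X f))"
      "(\<integral>f. X f 1 * F (X f) \<partial>gauss2) = (\<integral>f. G f + H f \<partial>gauss2)"
      using parts[OF B(1)] ne by (simp_all add: G_def H_def mult_ac)
    have 2: "integrable gauss2 (\<lambda>f. X f \<i> * F (X f))"
      "(\<integral>f. X f \<i> * F (X f) \<partial>gauss2) = (\<integral>f. \<i> * (G f - H f) \<partial>gauss2)"
      using parts[OF B(2)] ne by (simp_all add: G_def H_def algebra_simps)
    have iGH: "integrable gauss2 G" "integrable gauss2 H"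
      unfolding G_def H_def by (intro integrable_mult_right intPQ)+
    have "K (Suc a) b = (\<integral>f. X f 1 * F (X f) + \<i> * (X f \<i> * F (X f)) \<partial>gauss2)"
      unfolding K_def zP F_def by (rule Bochner_Integration.integral_cong[OF refl]) (simp add: P_def algebra_simps)
    also have "\<dots> = (\<integral>f. X f 1 * F (X f) \<partial>gauss2) + \<i> * (\<integral>f. X f \<i> * F (X f) \<partial>gauss2)"
      using 1 2 by simp
    also have "\<dots> = 2 * (\<integral>f. H f \<partial>gauss2)"
      unfolding 1 2 using iGH by (simp add: algebra_simps)
    also have "\<dots> = 2 * of_nat b * (\<integral>f. P (X f) ^ a * Q (X f) ^ (b - 1) \<partial>gauss2)"
      unfolding H_def by simp
    finally show ?thesis by (simp add: K_def zP)
  qed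
  have K0: "K 0 0 = 1"
  proof -
    have "K 0 0 = (\<integral>f. vmono Basis (\<lambda>_. 0) (X f) \<partial>gauss2)" by (simp add: K_def)
    also have "\<dots> = of_real (\<Prod>b\<in>(Basis::complex set). \<integral>x. std_normal_density x * x ^ 0 \<partial>lborel)"
      unfolding X_def gauss2_vmono(2) by simp
    also have "(\<integral>x. std_normal_density x * x ^ 0 \<partial>lborel) = 1"
      using std_normal_moment_even[of 0] by (simp add: has_bochner_integral_iff)
    finally show ?thesis by simp
  qed
  \<comment> \<open>The recursion lowers the first exponent only; conjugation gives access to
    \<open>K 0 b\<close> with b > 0.\<close>
  have Kc: "K a b = cnj (K b a)" for a b
    unfolding K_def by (simp flip: Bochner_Integration.integral_cnj add: mult.commute)
  have "K a b = (if a = b then 2 ^ a * fact a else 0)" for a b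
  proof (induction a arbitrary: b)
    case 0
    show ?case
    proof (cases b)
      case (Suc c)
      thus ?thesis using rec[of c 0] Kc[of 0 b] by simp
    qed (simp add: K0)
  next
    case (Suc a)
    show ?case by (cases b) (auto simp: rec Suc algebra_simps)
  qed
  thus "(\<integral>f. z f ^ \<alpha> * cnj (z f) ^ \<beta> \<partial>gauss2) = (if \<alpha> = \<beta> then 2 ^ \<alpha> * fact \<alpha> else 0)"
    by (simp add: K_def)
qed

lemma borel_measurable_cnj [measurable]: "cnj \<in> borel_measurable borel"
  by (intro borel_measurable_continuous_onI continuous_intros)

definition gdens :: "complex \<Rightarrow> real" where
  "gdens z = std_normal_density (Re z) * std_normal_density (Im z)"

lemma gdens_eq: "gdens z = exp (- (cmod z)\<^sup>2 / 2) / (2 * pi)"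
  by (simp add: gdens_def std_normal_density_def cmod_power2 exp_add[symmetric] add_divide_distrib[symmetric])

lemma gdens_moment:
  "integrable lborel (\<lambda>z. gdens z *\<^sub>R (z ^ \<alpha> * cnj z ^ \<beta>))"
  "(\<integral>z. gdens z *\<^sub>R (z ^ \<alpha> * cnj z ^ \<beta>) \<partial>lborel) = (if \<alpha> = \<beta> then 2 ^ \<alpha> * fact \<alpha> else 0)"
proof -
  let ?T = "\<lambda>f. \<Sum>b\<in>(Basis::complex set). f b *\<^sub>R b"
  let ?F = "\<lambda>z. gdens z *\<^sub>R (z ^ \<alpha> * cnj z ^ \<beta>)"
  have T: "?T f = of_real (f 1) + \<i> * of_real (f \<i>)" for f
    by (simp add: Basis_complex_def scaleR_conv_of_real mult.commute)
  have meas: "?F \<in> borel_measurable borel" unfolding gdens_def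
    by measurable
  have mT: "?T \<in> measurable (PiM Basis (\<lambda>_. lborel)) borel"
    by (auto intro!: borel_measurable_sum borel_measurable_scaleR measurable_component_singleton)
  have nn: "AE f in PiM Basis (\<lambda>_. lborel). 0 \<le> (\<Prod>b\<in>(Basis::complex set). std_normal_density (f b))"
    by (auto intro!: AE_I2 prod_nonneg)
  have meas2: "(\<lambda>f. \<Prod>b\<in>(Basis::complex set). std_normal_density (f b)) \<in> borel_measurable (PiM Basis (\<lambda>_. lborel))"
    by measurable
  define z where "z f = complex_of_real (f 1) + \<i> * of_real (f \<i>)" for f
  have mz: "(\<lambda>f. z f ^ \<alpha> * cnj (z f) ^ \<beta>) \<in> borel_measurable (PiM Basis (\<lambda>_. lborel))"
    using borel_measurable_integrable[OF gauss2_moment(1)[of \<alpha> \<beta>]] unfolding gauss2_def z_def by simp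
  have "gdens (z f) = (\<Prod>b\<in>(Basis::complex set). std_normal_density (f b))" for f
    by (simp add: gdens_def Basis_complex_def z_def)
  hence Fz: "?F (z f) = (\<Prod>b\<in>(Basis::complex set). std_normal_density (f b)) *\<^sub>R (z f ^ \<alpha> * cnj (z f) ^ \<beta>)" for f
    by simp
  have eq: "?F (?T f) = (\<Prod>b\<in>(Basis::complex set). std_normal_density (f b)) *\<^sub>R (z f ^ \<alpha> * cnj (z f) ^ \<beta>)" for f
    using Fz[of f] unfolding T z_def .
  show "integrable lborel ?F"
    unfolding lborel_eq[where 'a = complex]
    by (subst integrable_distr_eq[OF mT meas], unfold eq)
       (use gauss2_moment(1)[of \<alpha> \<beta>] in \<open>simp only: gauss2_def z_def[symmetric] integrable_density[OF mz meas2 nn]\<close>)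
  show "(\<integral>z. ?F z \<partial>lborel) = (if \<alpha> = \<beta> then 2 ^ \<alpha> * fact \<alpha> else 0)"
    unfolding lborel_eq[where 'a = complex]
    by (subst integral_distr[OF mT meas], unfold eq)
       (use gauss2_moment(2)[of \<alpha> \<beta>] in \<open>simp only: gauss2_def z_def[symmetric] integral_density[OF mz meas2 nn]\<close>)
qed

section \<open>Polar coordinates\<close>

lemma space_cvec: "space (cvec_space d) = PiE {..<d} (\<lambda>_. UNIV)"
  and sets_cvec: "sets (cvec_space d) = sets (PiM {..<d} (\<lambda>_. borel))"
  by (auto simp: cvec_space_def space_PiM intro!: sets_PiM_cong)

lemma measurable_cvec_component [measurable]:
  "j < d \<Longrightarrow> (\<lambda>v. v j) \<in> borel_measurable (cvec_space d)"
  unfolding cvec_space_def using measurable_component_singleton[of j "{..<d}" "\<lambda>_. lborel"] by simp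

lemma measurable_sqnorm [measurable]: "sqnorm d \<in> borel_measurable (cvec_space d)"
  unfolding sqnorm_def[abs_def] by (auto intro!: borel_measurable_sum)

lemma measurable_normalize_vec [measurable]:
  "normalize_vec d \<in> measurable (cvec_space d) (PiM {..<d} (\<lambda>_. borel))"
  unfolding normalize_vec_def[abs_def]
  by (intro measurable_restrict borel_measurable_divide borel_measurable_of_real borel_measurable_sqrt) auto

lemma sqnorm_nonneg [simp]: "0 \<le> sqnorm d v"
  by (auto simp: sqnorm_def sum_nonneg)

definition dilate :: "nat \<Rightarrow> real \<Rightarrow> (nat \<Rightarrow> complex) \<Rightarrow> nat \<Rightarrow> complex" where
  "dilate d c v = restrict (\<lambda>j. c *\<^sub>R v j) {..<d}"

lemma sqnorm_dilate: "sqnorm d (dilate d c v) = c\<^sup>2 * sqnorm d v"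
  by (simp add: sqnorm_def dilate_def sum_distrib_left power_mult_distrib)

lemma normalize_dilate:
  assumes "c > 0" shows "normalize_vec d (dilate d c v) = normalize_vec d v"
proof -
  have "of_real c * v j / of_real (c * r) = v j / of_real r" for j and r :: real
    using assms by simp
  thus ?thesis using assms unfolding normalize_vec_def sqnorm_dilate
    by (intro restrict_ext) (simp add: real_sqrt_mult dilate_def scaleR_conv_of_real)
qed

lemma measurable_dilate [measurable]: "dilate d c \<in> measurable (cvec_space d) (cvec_space d)"
proof -
  have "dilate d c \<in> measurable (cvec_space d) (PiM {..<d} (\<lambda>_. lborel))"
    unfolding dilate_def[abs_def] by (intro measurable_restrict) auto
  thus ?thesis by (simp add: cvec_space_def)
qed

text \<open>Both sides are measures in \<open>B\<close>. On boxes the identity is the scaling by c^2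
  of Lebesgue measure of the plane, once per coordinate, and boxes determine a product
  measure.\<close>

lemma emeasure_cvec_dilate:
  assumes c: "c > 0" and B: "B \<in> sets (cvec_space d)"
  shows "emeasure (cvec_space d) B =
    ennreal (c ^ (2 * d)) * emeasure (cvec_space d) (dilate d c -` B \<inter> space (cvec_space d))"
proof -
  interpret product_sigma_finite "\<lambda>_::nat. lborel :: complex measure" by standard
  define V where "V = cvec_space d"
  define P where "P = density (distr V V (dilate d c)) (\<lambda>_. ennreal (c ^ (2 * d)))"
  have mD: "dilate d c \<in> measurable V V" unfolding V_def by measurable
  have lb: "ennreal (c^2) * emeasure lborel ((\<lambda>z. c *\<^sub>R z) -` A) = emeasure lborel A" if "A \<in> sets borel"
    for A :: "complex set"
  proof -
    have "emeasure lborel A =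
        emeasure (density (distr lborel borel (\<lambda>x. 0 + c *\<^sub>R x)) (\<lambda>x. ennreal (\<bar>c\<bar> ^ DIM(complex)))) A"
      using c by (subst lborel_affine[of c 0]) simp_all
    also have "\<dots> = ennreal (c^2) * emeasure (distr lborel borel (\<lambda>x::complex. 0 + c *\<^sub>R x)) A"
      using that c by (subst emeasure_density) (auto simp: nn_integral_cmult_indicator)
    also have "emeasure (distr lborel borel (\<lambda>x::complex. 0 + c *\<^sub>R x)) A = emeasure lborel ((\<lambda>z. c *\<^sub>R z) -` A)"
      using that by (subst emeasure_distr) auto
    finally show ?thesis by simp
  qed
  have emP: "emeasure P A = ennreal (c ^ (2 * d)) * emeasure V (dilate d c -` A \<inter> space V)"
    if "A \<in> sets V" for A
    using that unfolding P_def
    by (subst emeasure_density) (auto simp: nn_integral_cmult_indicator emeasure_distr[OF mD])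
  have "P = PiM {..<d} (\<lambda>_. lborel)"
  proof (rule PiM_eqI)
    show "sets P = sets (PiM {..<d} (\<lambda>_. lborel))" by (simp add: P_def V_def cvec_space_def)
    fix A :: "nat \<Rightarrow> complex set" assume A: "\<And>i. i \<in> {..<d} \<Longrightarrow> A i \<in> sets lborel"
    have "PiE {..<d} A \<in> sets V" unfolding V_def cvec_space_def
      by (intro sets_PiM_I_finite) (use A in auto)
    moreover have "dilate d c -` PiE {..<d} A \<inter> space V = PiE {..<d} (\<lambda>j. (\<lambda>z. c *\<^sub>R z) -` A j)"
      by (auto simp: V_def space_cvec dilate_def PiE_iff)
    moreover have "emeasure V (PiE {..<d} (\<lambda>j. (\<lambda>z. c *\<^sub>R z) -` A j)) =
        (\<Prod>j<d. emeasure lborel ((\<lambda>z. c *\<^sub>R z) -` A j))"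
    proof -
      have "(\<lambda>z. c *\<^sub>R z) -` A j \<in> sets lborel" if "j < d" for j
      proof -
        have "(\<lambda>z. c *\<^sub>R z) \<in> measurable lborel (lborel :: complex measure)" by simp
        from measurable_sets[OF this A[of j]] that show ?thesis by simp
      qed
      thus ?thesis unfolding V_def cvec_space_def by (intro emeasure_PiM) auto
    qed
    moreover have "ennreal (c ^ (2 * d)) = (\<Prod>j<d. ennreal (c^2))"
      using c by (simp add: ennreal_power power_mult)
    ultimately have "emeasure P (PiE {..<d} A) =
        (\<Prod>j<d. ennreal (c^2) * emeasure lborel ((\<lambda>z. c *\<^sub>R z) -` A j))"
      by (simp add: emP prod.distrib)
    also have "\<dots> = (\<Prod>j<d. emeasure lborel (A j))"
      using A by (intro prod.cong lb) auto
    finally show "emeasure P (PiE {..<d} A) = (\<Prod>i\<in>{..<d}. emeasure lborel (A i))" .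
  qed simp
  hence PV: "P = V" by (simp add: V_def cvec_space_def)
  have "B \<in> sets V" using B by (simp add: V_def)
  from emP[OF this] show ?thesis unfolding PV by (simp only: V_def)
qed

section \<open>Independence of radius and direction under Lebesgue measure\<close>

context
  fixes d :: nat
  assumes d: "d \<ge> 1"
begin

text \<open>The cone over the directions \<open>A\<close>, truncated at squared radius
  \<open>s\<close>. The squared radius is used so that its volume scales as s^d.\<close>

definition shell :: "(nat \<Rightarrow> complex) set \<Rightarrow> real \<Rightarrow> (nat \<Rightarrow> complex) set" where
  "shell A s = {v \<in> space (cvec_space d). normalize_vec d v \<in> A \<and> 0 < sqnorm d v \<and> sqnorm d v \<le> s}"

lemma shell_sets [measurable]:
  assumes "A \<in> sets (PiM {..<d} (\<lambda>_. borel))"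
  shows "shell A s \<in> sets (cvec_space d)"
  unfolding shell_def using assms by measurable

lemma emeasure_shell:
  assumes A: "A \<in> sets (PiM {..<d} (\<lambda>_. borel))" and s: "s > 0"
  shows "emeasure (cvec_space d) (shell A s) = ennreal (s ^ d) * emeasure (cvec_space d) (shell A 1)"
proof -
  have "dilate d (sqrt s) -` shell A s \<inter> space (cvec_space d) = shell A 1"
    using s measurable_space[OF measurable_dilate]
    by (auto simp: shell_def normalize_dilate sqnorm_dilate zero_less_mult_iff)
  thus ?thesis
    using emeasure_cvec_dilate[of "sqrt s" "shell A s" d] s shell_sets[OF A] by (simp add: power_mult)
qed

lemma null_sqnorm: "emeasure (cvec_space d) {v \<in> space (cvec_space d). sqnorm d v \<le> 0} = 0"
proof -
  interpret product_sigma_finite "\<lambda>_::nat. lborel :: complex measure" by standard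
  have "{v \<in> space (cvec_space d). sqnorm d v \<le> 0} = PiE {..<d} (\<lambda>_. {0})"
  proof -
    have "sqnorm d v \<le> 0 \<longleftrightarrow> (\<forall>j<d. v j = 0)" for v
    proof -
      have "sqnorm d v \<le> 0 \<longleftrightarrow> sqnorm d v = 0" using sqnorm_nonneg[of d v] by linarith
      also have "\<dots> \<longleftrightarrow> (\<forall>j<d. v j = 0)" unfolding sqnorm_def by (subst sum_nonneg_eq_0_iff) auto
      finally show ?thesis .
    qed
    thus ?thesis by (auto simp: space_cvec PiE_iff extensional_def fun_eq_iff restrict_def)
  qed
  moreover have "emeasure (cvec_space d) (PiE {..<d} (\<lambda>_. {0})) = (\<Prod>j<d. emeasure lborel {0::complex})"
    unfolding cvec_space_def by (intro emeasure_PiM) auto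
  ultimately show ?thesis using d by (simp add: power_0_left)
qed

lemma AE_sqnorm_pos: "AE v in cvec_space d. 0 < sqnorm d v"
  by (rule AE_I[OF _ null_sqnorm]) auto

lemma unit_ball_shell: "unit_ball_punct d = shell (space (PiM {..<d} (\<lambda>_. borel))) 1"
  using measurable_space[OF measurable_normalize_vec, of _ d] by (auto simp: unit_ball_punct_def shell_def)

lemma unit_ball_sets [measurable]: "unit_ball_punct d \<in> sets (cvec_space d)"
  unfolding unit_ball_shell by measurable

lemma unit_ball_finite: "emeasure (cvec_space d) (unit_ball_punct d) \<noteq> \<infinity>"
proof -
  interpret product_sigma_finite "\<lambda>_::nat. lborel :: complex measure" by standard
  have "unit_ball_punct d \<subseteq> PiE {..<d} (\<lambda>_. cball 0 1)"
  proof
    fix v assume v: "v \<in> unit_ball_punct d"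
    have "cmod (v j) \<le> 1" if "j < d" for j
    proof -
      have "(cmod (v j))\<^sup>2 \<le> sqnorm d v" unfolding sqnorm_def
        by (rule member_le_sum) (use that in auto)
      also have "\<dots> \<le> 1" using v by (simp add: unit_ball_punct_def)
      finally show ?thesis by (simp add: power_le_one_iff abs_square_le_1)
    qed
    thus "v \<in> PiE {..<d} (\<lambda>_. cball 0 1)"
      using v by (auto simp: unit_ball_punct_def space_cvec PiE_iff)
  qed
  moreover have m: "PiE {..<d} (\<lambda>_. cball 0 1) \<in> sets (cvec_space d)"
    unfolding cvec_space_def by (intro sets_PiM_I_finite) auto
  ultimately have "emeasure (cvec_space d) (unit_ball_punct d) \<le> emeasure (cvec_space d) (PiE {..<d} (\<lambda>_. cball 0 1))"
    by (intro emeasure_mono)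
  also have "\<dots> = (\<Prod>j<d. emeasure lborel (cball (0::complex) 1))"
    unfolding cvec_space_def by (intro emeasure_PiM) auto
  also have "\<dots> < \<infinity>"
    using emeasure_lborel_cball_finite[of "0::complex" 1]
    by (simp only: prod_constant infinity_ennreal_def power_less_top_ennreal) simp
  finally show ?thesis by simp
qed

text \<open>If the ball were null, so would be all its dilates, and these exhaust the space up to
  the origin.\<close>

lemma unit_ball_pos: "emeasure (cvec_space d) (unit_ball_punct d) \<noteq> 0"
proof
  interpret product_sigma_finite "\<lambda>_::nat. lborel :: complex measure" by standard
  assume z: "emeasure (cvec_space d) (unit_ball_punct d) = 0"
  let ?S = "space (PiM {..<d} (\<lambda>_. borel :: complex measure))"
  let ?Z = "{v \<in> space (cvec_space d). sqnorm d v \<le> 0}"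
  have 0: "emeasure (cvec_space d) (shell ?S (real (Suc n))) = 0" for n
    using emeasure_shell[of ?S "real (Suc n)"] z unfolding unit_ball_shell by simp
  have "emeasure (cvec_space d) (\<Union>n. shell ?S (real (Suc n))) = 0"
    by (rule emeasure_UN_eq_0) (use 0 in auto)
  moreover have "space (cvec_space d) = (\<Union>n. shell ?S (real (Suc n))) \<union> ?Z"
  proof -
    have "\<exists>n. sqnorm d v \<le> real (Suc n)" for v
      using real_arch_simple[of "sqnorm d v"] by (metis le_Suc_eq lessI less_imp_le of_nat_le_iff order_trans)
    thus ?thesis using measurable_space[OF measurable_normalize_vec, of _ d] by (auto simp: shell_def not_le)
  qed
  ultimately have "emeasure (cvec_space d) (space (cvec_space d)) = 0"
    using null_sqnorm emeasure_subadditive[of "\<Union>n. shell ?S (real (Suc n))" "cvec_space d" ?Z] by auto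
  moreover have "emeasure (cvec_space d) (space (cvec_space d)) = (\<Prod>j<d. emeasure lborel (UNIV::complex set))"
    unfolding space_cvec unfolding cvec_space_def by (intro emeasure_PiM) auto
  ultimately show False using d by (simp add: ennreal_top_eq_mult_iff power_eq_0_iff)
qed

lemma prob_space_uniform_ball: "prob_space (uniform_measure (cvec_space d) (unit_ball_punct d))"
  by (rule prob_space_uniform_measure) (use unit_ball_finite unit_ball_pos in auto)

lemma measurable_normalize_uniform:
  "normalize_vec d \<in> measurable (uniform_measure (cvec_space d) (unit_ball_punct d)) (PiM {..<d} (\<lambda>_. borel))"
  by simp

lemma prob_space_unif_sphere: "prob_space (unif_sphere d)"
  unfolding unif_sphere_def
  by (rule prob_space.prob_space_distr[OF prob_space_uniform_ball measurable_normalize_uniform])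

lemma sets_unif_sphere [measurable_cong, simp]: "sets (unif_sphere d) = sets (PiM {..<d} (\<lambda>_. borel))"
  by (simp add: unif_sphere_def)

lemma emeasure_unif_sphere:
  assumes "A \<in> sets (PiM {..<d} (\<lambda>_. borel))"
  shows "emeasure (unif_sphere d) A =
    emeasure (cvec_space d) (shell A 1) / emeasure (cvec_space d) (unit_ball_punct d)"
proof -
  have "unit_ball_punct d \<inter> (normalize_vec d -` A \<inter> space (cvec_space d)) = shell A 1"
    by (auto simp: unit_ball_punct_def shell_def)
  moreover have "normalize_vec d -` A \<inter> space (cvec_space d) \<in> sets (cvec_space d)"
    using assms by (intro measurable_sets[OF measurable_normalize_vec])
  ultimately show ?thesis unfolding unif_sphere_def
    using assms by (subst emeasure_distr) (auto simp: emeasure_uniform_measure)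
qed

text \<open>\<open>N1\<close> is the law of the squared radius restricted to directions in
  \<open>A\<close>, and \<open>N2\<close> is q times the unrestricted law. On a half-line {..s} with
  s > 0 both equal s^d times q times the volume of the ball, and half-lines generate the Borel
  sets.\<close>

lemma nn_integral_polar:
  assumes A: "A \<in> sets (PiM {..<d} (\<lambda>_. borel))" and \<psi>: "\<psi> \<in> borel_measurable borel"
  shows "(\<integral>\<^sup>+v. \<psi> (sqnorm d v) * indicator A (normalize_vec d v) \<partial>cvec_space d) =
    emeasure (unif_sphere d) A * (\<integral>\<^sup>+v. \<psi> (sqnorm d v) \<partial>cvec_space d)"
proof -
  let ?V = "cvec_space d"
  define q where "q = emeasure (unif_sphere d) A"
  define N1 where "N1 = distr (density ?V (\<lambda>v. indicator A (normalize_vec d v))) borel (sqnorm d)"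
  define N2 where "N2 = density (distr ?V borel (sqnorm d)) (\<lambda>_. q)"
  let ?b = "emeasure ?V (unit_ball_punct d)"
  have mi: "(\<lambda>v. indicator A (normalize_vec d v) :: ennreal) \<in> borel_measurable ?V"
    using A by measurable
  have sph: "emeasure ?V (shell A 1) = q * ?b"
  proof -
    have "q * ?b = emeasure ?V (shell A 1) * ?b / ?b"
      unfolding q_def emeasure_unif_sphere[OF A]
      by (simp only: mult.commute[of _ ?b] ennreal_times_divide)
    thus ?thesis using unit_ball_finite unit_ball_pos by (simp add: ennreal_mult_divide_eq)
  qed
  have e1: "emeasure N1 {..s} = (if s \<le> 0 then 0 else ennreal (s ^ d) * (q * ?b))" for s
  proof -
    have "emeasure N1 {..s} = (\<integral>\<^sup>+v. indicator A (normalize_vec d v) * indicator {..s} (sqnorm d v) \<partial>?V)"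
      unfolding N1_def using mi
      by (subst emeasure_distr, simp, simp, subst emeasure_density)
         (auto intro!: nn_integral_cong simp: indicator_def measurable_sets[OF measurable_sqnorm])
    also have "\<dots> = (\<integral>\<^sup>+v. indicator (shell A s) v \<partial>?V)"
      by (rule nn_integral_cong_AE) (use AE_sqnorm_pos AE_space in eventually_elim, auto simp: indicator_def shell_def)
    also have "\<dots> = emeasure ?V (shell A s)" using A by simp
    also have "\<dots> = (if s \<le> 0 then 0 else ennreal (s ^ d) * (q * ?b))"
    proof (cases "s \<le> 0")
      case True
      hence "shell A s = {}" by (auto simp: shell_def)
      thus ?thesis using True by simp
    next
      case False thus ?thesis using emeasure_shell[OF A, of s] sph by simp
    qed
    finally show ?thesis .
  qed
  have e2: "emeasure N2 {..s} = (if s \<le> 0 then 0 else ennreal (s ^ d) * (q * ?b))" for s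
  proof -
    let ?S = "space (PiM {..<d} (\<lambda>_. borel :: complex measure))"
    have "emeasure N2 {..s} = q * emeasure ?V {v \<in> space ?V. sqnorm d v \<le> s}"
      unfolding N2_def
      by (subst emeasure_density) (auto simp: nn_integral_cmult_indicator emeasure_distr vimage_def Int_def conj_commute)
    also have "emeasure ?V {v \<in> space ?V. sqnorm d v \<le> s} = emeasure ?V (shell ?S s)"
    proof (rule emeasure_eq_AE)
      show "AE v in ?V. (v \<in> {v \<in> space ?V. sqnorm d v \<le> s}) = (v \<in> shell ?S s)"
        using AE_sqnorm_pos AE_space
      proof eventually_elim
        case (elim v)
        thus ?case using measurable_space[OF measurable_normalize_vec, of v d] by (auto simp: shell_def)
      qed
    qed measurable
    also have "\<dots> = (if s \<le> 0 then 0 else ennreal (s ^ d) * ?b)"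
    proof (cases "s \<le> 0")
      case True
      hence "shell ?S s = {}" by (auto simp: shell_def)
      thus ?thesis using True by simp
    next
      case False thus ?thesis using emeasure_shell[of ?S s] unfolding unit_ball_shell by simp
    qed
    finally show ?thesis by (simp add: mult_ac)
  qed
  have qfin: "q \<noteq> \<infinity>" unfolding q_def
    using prob_space.emeasure_space_1[OF prob_space_unif_sphere] emeasure_space[of "unif_sphere d" A]
    by (metis ennreal_one_neq_top infinity_ennreal_def neq_top_trans)
  have "N1 = N2"
  proof (rule measure_eqI_generator_eq[where E = "range atMost" and \<Omega> = UNIV and A = "\<lambda>i. {..real i}"])
    show "Int_stable (range (atMost :: real \<Rightarrow> _))" by (auto simp: Int_stable_def)
    show "emeasure N1 X = emeasure N2 X" if "X \<in> range atMost" for X using that e1 e2 by auto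
    show "sets N1 = sigma_sets UNIV (range atMost)" "sets N2 = sigma_sets UNIV (range atMost)"
      unfolding N1_def N2_def by (simp_all add: borel_eq_atMost)
    show "(\<Union>i. {..real i}) = UNIV" using real_arch_simple by auto
    show "emeasure N1 {..real i} \<noteq> \<infinity>" for i
      unfolding e1 using qfin unit_ball_finite by (simp add: ennreal_mult_eq_top_iff)
  qed auto
  hence "(\<integral>\<^sup>+s. \<psi> s \<partial>N1) = (\<integral>\<^sup>+s. \<psi> s \<partial>N2)" by simp
  moreover have "(\<integral>\<^sup>+s. \<psi> s \<partial>N1) = (\<integral>\<^sup>+v. \<psi> (sqnorm d v) * indicator A (normalize_vec d v) \<partial>?V)"
    unfolding N1_def using mi \<psi> by (simp add: nn_integral_distr nn_integral_density mult.commute)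
  moreover have "(\<integral>\<^sup>+s. \<psi> s \<partial>N2) = q * (\<integral>\<^sup>+v. \<psi> (sqnorm d v) \<partial>?V)"
    unfolding N2_def using \<psi> by (simp add: nn_integral_distr nn_integral_density nn_integral_cmult)
  ultimately show ?thesis by (simp add: q_def)
qed

text \<open>Under a radial weight of total mass c the normalized vector is distributed as c times
  the sphere measure; this is the independence above for complex integrands.\<close>

lemma integral_polar:
  fixes h :: "(nat \<Rightarrow> complex) \<Rightarrow> complex"
  assumes \<psi>: "\<psi> \<in> borel_measurable borel" "\<And>s. 0 \<le> \<psi> s" and h: "h \<in> borel_measurable (PiM {..<d} (\<lambda>_. borel))"
    and c: "(\<integral>\<^sup>+v. ennreal (\<psi> (sqnorm d v)) \<partial>cvec_space d) = ennreal c" "c \<ge> 0"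
  shows "(\<integral>v. \<psi> (sqnorm d v) *\<^sub>R h (normalize_vec d v) \<partial>cvec_space d) = c *\<^sub>R (\<integral>v. h v \<partial>unif_sphere d)"
proof -
  let ?V = "cvec_space d" and ?S = "PiM {..<d} (\<lambda>_. borel :: complex measure)"
  have mn: "normalize_vec d \<in> measurable (density ?V (\<lambda>v. ennreal (\<psi> (sqnorm d v)))) ?S" by simp
  have eq: "distr (density ?V (\<lambda>v. ennreal (\<psi> (sqnorm d v)))) ?S (normalize_vec d) = density (unif_sphere d) (\<lambda>_. ennreal c)"
  proof (rule measure_eqI)
    fix A assume "A \<in> sets (distr (density ?V (\<lambda>v. ennreal (\<psi> (sqnorm d v)))) ?S (normalize_vec d))"
    hence A: "A \<in> sets ?S" by simp
    have "emeasure (distr (density ?V (\<lambda>v. ennreal (\<psi> (sqnorm d v)))) ?S (normalize_vec d)) A =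
       (\<integral>\<^sup>+v. ennreal (\<psi> (sqnorm d v)) * indicator A (normalize_vec d v) \<partial>?V)"
      using A \<psi>(1) measurable_sets[OF measurable_normalize_vec A]
      by (subst emeasure_distr[OF mn A], subst emeasure_density)
         (auto intro!: nn_integral_cong simp: indicator_def)
    also have "\<dots> = emeasure (unif_sphere d) A * ennreal c"
      using nn_integral_polar[OF A, of "\<lambda>s. ennreal (\<psi> s)"] \<psi>(1) c by simp
    also have "\<dots> = emeasure (density (unif_sphere d) (\<lambda>_. ennreal c)) A"
      using A by (subst emeasure_density) (auto simp: nn_integral_cmult_indicator mult.commute)
    finally show "emeasure (distr (density ?V (\<lambda>v. ennreal (\<psi> (sqnorm d v)))) ?S (normalize_vec d)) A =
       emeasure (density (unif_sphere d) (\<lambda>_. ennreal c)) A" .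
  qed simp
  have "c *\<^sub>R (\<integral>v. h v \<partial>unif_sphere d) = (\<integral>v. h v \<partial>density (unif_sphere d) (\<lambda>_. ennreal c))"
    using h c by (subst integral_density) (auto simp: measurable_cong_sets[OF sets_unif_sphere refl])
  also have "\<dots> = (\<integral>v. h (normalize_vec d v) \<partial>density ?V (\<lambda>v. ennreal (\<psi> (sqnorm d v))))"
    unfolding eq[symmetric] by (rule integral_distr[OF mn h])
  also have "\<dots> = (\<integral>v. \<psi> (sqnorm d v) *\<^sub>R h (normalize_vec d v) \<partial>?V)"
    using \<psi> by (subst integral_density) (auto intro: measurable_compose[OF measurable_normalize_vec h] measurable_compose[OF measurable_sqnorm])
  finally show ?thesis by simp
qed

end

section \<open>Moments of the uniform distribution on the sphere\<close>

definition cfg :: "(nat \<Rightarrow> nat \<Rightarrow> complex) \<Rightarrow> config" where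
  "cfg \<omega> = (\<lambda>(b, t, j). if b then \<omega> t j else cnj (\<omega> t j))"

definition smono :: "nat \<Rightarrow> (nat \<Rightarrow> nat) \<Rightarrow> (nat \<Rightarrow> nat) \<Rightarrow> (nat \<Rightarrow> complex) \<Rightarrow> complex" where
  "smono d \<alpha> \<beta> v = (\<Prod>j<d. v j ^ \<alpha> j * cnj (v j) ^ \<beta> j)"

lemma vmono_cfg:
  "vmono (cvars p d) \<alpha> (cfg \<omega>) = (\<Prod>t<p. smono d (\<lambda>j. \<alpha> (True, t, j)) (\<lambda>j. \<alpha> (False, t, j)) (\<omega> t))"
proof -
  have "cvars p d = {False, True} \<times> ({..<p} \<times> {..<d})" by (auto simp: cvars_def)
  hence "vmono (cvars p d) \<alpha> (cfg \<omega>) = (\<Prod>b\<in>{False, True}. \<Prod>t<p. \<Prod>j<d. cfg \<omega> (b, t, j) ^ \<alpha> (b, t, j))"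
    by (simp add: vmono_def prod.cartesian_product case_prod_unfold)
  thus ?thesis by (simp add: cfg_def smono_def prod.distrib mult.commute)
qed

lemma smono_measurable [measurable]: "smono d \<alpha> \<beta> \<in> borel_measurable (PiM {..<d} (\<lambda>_. borel))"
proof -
  have "(\<lambda>v. v j ^ \<alpha> j * cnj (v j) ^ \<beta> j) \<in> borel_measurable (PiM {..<d} (\<lambda>_. borel))" if "j < d" for j
  proof -
    have [measurable]: "(\<lambda>v. v j) \<in> borel_measurable (PiM {..<d} (\<lambda>_. borel :: complex measure))"
      using that by (intro measurable_component_singleton) simp
    show ?thesis by measurable
  qed
  thus ?thesis unfolding smono_def[abs_def] by (intro borel_measurable_prod) auto
qed

definition cgauss :: "nat \<Rightarrow> (nat \<Rightarrow> complex) measure" where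
  "cgauss d = density (cvec_space d) (\<lambda>v. \<Prod>j<d. gdens (v j))"

lemma gdens_nonneg [simp]: "0 \<le> gdens z"
  by (simp add: gdens_def)

lemma gdens_measurable [measurable]: "gdens \<in> borel_measurable borel"
  unfolding gdens_def[abs_def] by measurable

text \<open>The Gaussian density is radial, which is what links Gaussian and spherical
  moments.\<close>

lemma prod_gdens: "(\<Prod>j<d. gdens (v j)) = exp (- sqnorm d v / 2) / (2 * pi) ^ d"
  by (simp add: gdens_eq sqnorm_def prod_dividef exp_sum[symmetric] sum_negf sum_divide_distrib)

lemma cgauss_aux:
  "(\<lambda>v. \<Prod>j<d. gdens (v j)) \<in> borel_measurable (cvec_space d)"
  "AE v in cvec_space d. 0 \<le> (\<Prod>j<d. gdens (v j))"
  "smono d \<alpha> \<beta> \<in> borel_measurable (cvec_space d)"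
proof -
  show "(\<lambda>v. \<Prod>j<d. gdens (v j)) \<in> borel_measurable (cvec_space d)"
    by (intro borel_measurable_prod measurable_compose[OF measurable_cvec_component gdens_measurable]) auto
  show "AE v in cvec_space d. 0 \<le> (\<Prod>j<d. gdens (v j))"
    by (auto intro!: AE_I2 prod_nonneg)
  show "smono d \<alpha> \<beta> \<in> borel_measurable (cvec_space d)"
    using smono_measurable[of d \<alpha> \<beta>] by (simp add: measurable_cong_sets[OF sets_cvec refl])
qed

definition gauss_moment :: "nat \<Rightarrow> (nat \<Rightarrow> nat) \<Rightarrow> (nat \<Rightarrow> nat) \<Rightarrow> complex" where
  "gauss_moment d \<alpha> \<beta> = (\<Prod>j<d. if \<alpha> j = \<beta> j then 2 ^ \<alpha> j * fact (\<alpha> j) else 0)"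

lemma cgauss_smono:
  "integrable (cgauss d) (smono d \<alpha> \<beta>)"
  "(\<integral>v. smono d \<alpha> \<beta> v \<partial>cgauss d) = gauss_moment d \<alpha> \<beta>"
proof -
  interpret product_sigma_finite "\<lambda>_::nat. lborel :: complex measure" by standard
  have eq: "(\<Prod>j<d. gdens (v j)) *\<^sub>R smono d \<alpha> \<beta> v = (\<Prod>j<d. gdens (v j) *\<^sub>R (v j ^ \<alpha> j * cnj (v j) ^ \<beta> j))" for v
    by (simp add: smono_def scaleR_conv_of_real prod.distrib)
  show "integrable (cgauss d) (smono d \<alpha> \<beta>)"
    unfolding cgauss_def integrable_density[OF cgauss_aux(3) cgauss_aux(1,2)] eq
    unfolding cvec_space_def
    by (rule product_integrable_prod[OF _ gdens_moment(1)]) simp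
  show "(\<integral>v. smono d \<alpha> \<beta> v \<partial>cgauss d) = gauss_moment d \<alpha> \<beta>"
    unfolding cgauss_def integral_density[OF cgauss_aux(3) cgauss_aux(1,2)] eq
    unfolding cvec_space_def
    by (subst product_integral_prod[OF _ gdens_moment(1)]) (simp_all only: finite_lessThan gdens_moment(2) gauss_moment_def)
qed

lemma smono_normalize:
  assumes "0 < sqnorm d v"
  shows "smono d \<alpha> \<beta> v = of_real (sqrt (sqnorm d v) ^ (sum \<alpha> {..<d} + sum \<beta> {..<d})) * smono d \<alpha> \<beta> (normalize_vec d v)"
proof -
  let ?r = "complex_of_real (sqrt (sqnorm d v))"
  have r: "?r \<noteq> 0" using assms by simp
  have "smono d \<alpha> \<beta> (normalize_vec d v) = (\<Prod>j<d. v j ^ \<alpha> j * cnj (v j) ^ \<beta> j / ?r ^ (\<alpha> j + \<beta> j))"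
    unfolding smono_def by (rule prod.cong) (auto simp: normalize_vec_def power_divide power_add)
  also have "\<dots> = smono d \<alpha> \<beta> v / ?r ^ (sum \<alpha> {..<d} + sum \<beta> {..<d})"
    by (simp add: prod_dividef smono_def power_sum[symmetric] sum.distrib[symmetric])
  finally show ?thesis using r by simp
qed

context
  fixes d :: nat
  assumes d: "d \<ge> 1"
begin

lemma AE_unif_sphere: "AE v in unif_sphere d. sqnorm d v = 1"
proof -
  have n: "sqnorm d (normalize_vec d v) = 1" if "0 < sqnorm d v" for v
    using that by (simp add: normalize_vec_def sqnorm_def norm_divide power_divide sum_divide_distrib[symmetric] real_sqrt_pow2)
  have "{v \<in> space (PiM {..<d} (\<lambda>_. borel)). sqnorm d v = 1} \<in> sets (PiM {..<d} (\<lambda>_. borel))"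
    using measurable_sqnorm[of d] by (simp add: measurable_cong_sets[OF sets_cvec refl])
  thus ?thesis unfolding unif_sphere_def
  proof (subst AE_distr_iff[OF measurable_normalize_uniform[OF d]])
    show "AE v in uniform_measure (cvec_space d) (unit_ball_punct d). sqnorm d (normalize_vec d v) = 1"
      by (rule AE_uniform_measureI[OF unit_ball_sets[OF d]]) (auto simp: unit_ball_punct_def n)
  qed
qed

lemma measurable_unif_sphere: "measurable (unif_sphere d) N = measurable (PiM {..<d} (\<lambda>_. borel)) N"
  by (rule measurable_cong_sets[OF sets_unif_sphere[OF d] refl])

lemma integrable_smono: "integrable (unif_sphere d) (smono d \<alpha> \<beta>)"
proof (rule finite_measure.integrable_const_bound[where B = 1])
  show "finite_measure (unif_sphere d)" using prob_space_unif_sphere[OF d] by (simp add: prob_space_def)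
  show "AE v in unif_sphere d. norm (smono d \<alpha> \<beta> v) \<le> 1"
    using AE_unif_sphere
  proof eventually_elim
    case (elim v)
    have "cmod (v j) \<le> 1" if "j < d" for j
    proof -
      have "(cmod (v j))\<^sup>2 \<le> sqnorm d v" unfolding sqnorm_def
        by (rule member_le_sum) (use that in auto)
      thus ?thesis using elim by (simp add: power_le_one_iff abs_square_le_1)
    qed
    thus ?case unfolding smono_def
      by (simp add: prod_norm[symmetric] norm_mult norm_power)
         (intro prod_le_1 conjI mult_nonneg_nonneg mult_le_one power_le_one zero_le_power, auto)
  qed
qed (simp add: measurable_unif_sphere)

definition radial_moment :: "nat \<Rightarrow> real" where
  "radial_moment b = (\<integral>v. sqnorm d v ^ b \<partial>cgauss d)"

lemma integrable_radial: "integrable (cgauss d) (\<lambda>v. sqnorm d v ^ b)"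
proof -
  \<comment> \<open>The squared norm as a polynomial in the ket and bra coordinates of one letter.
    The empty degree sets below make the homogeneity conditions trivial.\<close>
  define f :: "config \<Rightarrow> complex" where "f x = (\<Sum>j<d. x (True, 0, j) * x (False, 0, j))" for x
  have int: "integrable (cgauss d) (\<lambda>v. vmono (cvars 1 d) \<alpha> (cfg (\<lambda>_. v)))" for \<alpha>
    unfolding vmono_cfg using cgauss_smono(1) by simp
  have 1: "\<exists>P Q f'. poly_deriv (cvars 1 d) {} {} u P Q f f'" for u
  proof -
    have var: "poly_deriv (cvars 1 d) {} {} u 0 0 (\<lambda>x. x w) (\<lambda>x. if u = w then 1 else 0)" if "w \<in> cvars 1 d" for w
      by (rule poly_deriv_cong[OF poly_deriv_var[where w = w]]) (use that in auto)
    have "poly_deriv (cvars 1 d) {} {} u (0+0) (0+0) f (\<lambda>x. \<Sum>j<d. (if u = (True, 0, j) then 1 else 0) * x (False, 0, j)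
        + x (True, 0, j) * (if u = (False, 0, j) then 1 else 0))"
      unfolding f_def
      by (intro poly_deriv_sum poly_deriv_mult var) (use d in \<open>auto simp: cvars_def lessThan_empty_iff\<close>)
    thus ?thesis by blast
  qed
  have "\<exists>P Q f'. poly_deriv (cvars 1 d) {} {} u P Q (\<lambda>x. f x ^ b) f'" for u
  proof (induction b)
    case 0
    have "poly_deriv (cvars 1 d) {} {} u 0 0 (\<lambda>x. f x ^ 0) (\<lambda>x. 0)"
      by (rule poly_deriv_cong[OF poly_deriv_const[where k = 1]]) auto
    thus ?case by blast
  next
    case (Suc b)
    obtain P Q f' g P' Q' where *: "poly_deriv (cvars 1 d) {} {} u P Q f f'"
      "poly_deriv (cvars 1 d) {} {} u P' Q' (\<lambda>x. f x ^ b) g" using 1 Suc by metis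
    show ?case using poly_deriv_mult[OF *] by auto
  qed
  then obtain P Q f' where "poly_deriv (cvars 1 d) {} {} (True, 0, 0) P Q (\<lambda>x. f x ^ b) f'" by blast
  from poly_deriv_integrable(1)[OF this int]
  have "integrable (cgauss d) (\<lambda>v. f (cfg (\<lambda>_. v)) ^ b)" .
  moreover have "f (cfg (\<lambda>_. v)) = of_real (sqnorm d v)" for v
    unfolding f_def cfg_def sqnorm_def by (simp add: complex_norm_square[symmetric])
  ultimately have "integrable (cgauss d) (\<lambda>v. complex_of_real (sqnorm d v ^ b))" by simp
  thus ?thesis by (simp only: complex_of_real_integrable_eq)
qed

text \<open>A Gaussian vector has independent radius and uniform direction, and a monomial of
  bidegree (b, b) is homogeneous of degree 2b: its Gaussian moment is the spherical moment times E
  |v|^(2b).\<close>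

lemma sphere_gauss:
  assumes "sum \<alpha> {..<d} = b" "sum \<beta> {..<d} = b"
  shows "of_real (radial_moment b) * (\<integral>v. smono d \<alpha> \<beta> v \<partial>unif_sphere d) =
    gauss_moment d \<alpha> \<beta>"
proof -
  define \<psi> where "\<psi> s = exp (- s / 2) / (2 * pi) ^ d * \<bar>s\<bar> ^ b" for s :: real
  have \<psi>1: "\<psi> \<in> borel_measurable borel"
    unfolding \<psi>_def by measurable
  have \<psi>2: "0 \<le> \<psi> s" for s
    unfolding \<psi>_def by simp
  note \<psi> = \<psi>1 \<psi>2
  have msq: "(\<lambda>v. sqnorm d v ^ b) \<in> borel_measurable (cvec_space d)" by measurable
  have ps: "\<psi> (sqnorm d v) = (\<Prod>j<d. gdens (v j)) *\<^sub>R sqnorm d v ^ b" for v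
    by (simp add: \<psi>_def prod_gdens)
  have i: "integrable (cvec_space d) (\<lambda>v. \<psi> (sqnorm d v))"
    using integrable_radial[of b] unfolding cgauss_def integrable_density[OF msq cgauss_aux(1,2)] ps .
  have rm: "radial_moment b = (\<integral>v. \<psi> (sqnorm d v) \<partial>cvec_space d)"
    unfolding radial_moment_def cgauss_def integral_density[OF msq cgauss_aux(1,2)] ps ..
  have c: "(\<integral>\<^sup>+v. ennreal (\<psi> (sqnorm d v)) \<partial>cvec_space d) = ennreal (radial_moment b)" "radial_moment b \<ge> 0"
    unfolding rm using i \<psi>(2) by (auto intro!: nn_integral_eq_integral)
  have "gauss_moment d \<alpha> \<beta> = (\<integral>v. (\<Prod>j<d. gdens (v j)) *\<^sub>R smono d \<alpha> \<beta> v \<partial>cvec_space d)"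
    unfolding cgauss_smono(2)[symmetric] cgauss_def integral_density[OF cgauss_aux(3) cgauss_aux(1,2)] ..
  also have "\<dots> = (\<integral>v. \<psi> (sqnorm d v) *\<^sub>R smono d \<alpha> \<beta> (normalize_vec d v) \<partial>cvec_space d)"
  proof (rule integral_cong_AE)
    show "AE v in cvec_space d. (\<Prod>j<d. gdens (v j)) *\<^sub>R smono d \<alpha> \<beta> v = \<psi> (sqnorm d v) *\<^sub>R smono d \<alpha> \<beta> (normalize_vec d v)"
      using AE_sqnorm_pos[OF d]
    proof eventually_elim
      case (elim v)
      have "sqrt (sqnorm d v) ^ (b + b) = sqnorm d v ^ b"
        by (simp add: power_add power_mult_distrib[symmetric])
      thus ?case using smono_normalize[OF elim, of \<alpha> \<beta>] assms by (simp add: ps scaleR_conv_of_real)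
    qed
  qed (use \<psi>(1) in \<open>auto intro!: borel_measurable_scaleR cgauss_aux
      measurable_compose[OF measurable_normalize_vec smono_measurable] measurable_compose[OF measurable_sqnorm]\<close>)
  also have "\<dots> = radial_moment b *\<^sub>R (\<integral>v. smono d \<alpha> \<beta> v \<partial>unif_sphere d)"
    by (rule integral_polar[OF d \<psi> smono_measurable c])
  finally show ?thesis by (simp add: scaleR_conv_of_real)
qed

lemma sum_incr: "i < d \<Longrightarrow> sum (\<alpha>(i := Suc (\<alpha> i))) {..<d} = Suc (sum \<alpha> {..<d})"
  for \<alpha> :: "nat \<Rightarrow> nat"
  by (subst (1 2) sum.remove[of _ i]) auto

lemma gauss_moment_incr:
  assumes "i < d"
  shows "gauss_moment d (\<alpha>(i := Suc (\<alpha> i))) (\<alpha>(i := Suc (\<alpha> i))) = 2 * (of_nat (\<alpha> i) + 1) * gauss_moment d \<alpha> \<alpha>"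
proof -
  have "(\<Prod>j\<in>{..<d}-{i}. 2 ^ (\<alpha>(i := Suc (\<alpha> i))) j * fact ((\<alpha>(i := Suc (\<alpha> i))) j)) =
    (\<Prod>j\<in>{..<d}-{i}. 2 ^ \<alpha> j * fact (\<alpha> j) :: complex)" by (rule prod.cong) auto
  thus ?thesis using assms by (simp add: gauss_moment_def prod.remove[of _ i] algebra_simps)
qed

lemma gauss_moment_cong:
  "(\<And>j. j < d \<Longrightarrow> \<alpha> j = \<alpha>' j) \<Longrightarrow> (\<And>j. j < d \<Longrightarrow> \<beta> j = \<beta>' j) \<Longrightarrow> gauss_moment d \<alpha> \<beta> = gauss_moment d \<alpha>' \<beta>'"
  unfolding gauss_moment_def by (intro prod.cong) auto

lemma gauss_moment_eq_0: "j < d \<Longrightarrow> \<alpha> j \<noteq> \<beta> j \<Longrightarrow> gauss_moment d \<alpha> \<beta> = 0"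
  unfolding gauss_moment_def by (rule prod_zero) auto

text \<open>The recursion is found without computing a radial integral. The monomial |v_0|^(2b) is
  multiplied by 1 = |v|^2 on the sphere and both sides are converted to Gaussian moments; raising
  the i-th exponent there costs 2 (\<alpha> i + 1), and the sum over i is 2 (b + d).\<close>

lemma radial_moment_pos: "radial_moment b \<noteq> 0"
  and radial_moment_Suc: "radial_moment (Suc b) = 2 * (real b + real d) * radial_moment b"
proof -
  define \<alpha> :: "nat \<Rightarrow> nat" where "\<alpha> = (\<lambda>_. 0)(0 := b)"
  have s: "sum \<alpha> {..<d} = b" using d by (simp add: \<alpha>_def sum.delta)
  define e where "e \<alpha> = gauss_moment d \<alpha> \<alpha>" for \<alpha>
  have e0: "e \<alpha> \<noteq> 0" for \<alpha> by (simp add: e_def gauss_moment_def)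
  define E where "E \<alpha> = (\<integral>v. smono d \<alpha> \<alpha> v \<partial>unif_sphere d)" for \<alpha>
  have g: "of_real (radial_moment (sum \<alpha> {..<d})) * E \<alpha> = e \<alpha>" for \<alpha>
    using sphere_gauss[of \<alpha> "sum \<alpha> {..<d}" \<alpha>] by (simp add: E_def e_def)
  show "radial_moment b \<noteq> 0" using g[of \<alpha>] e0[of \<alpha>] s by auto
  have "E \<alpha> = (\<integral>v. (\<Sum>i<d. smono d (\<alpha>(i := Suc (\<alpha> i))) (\<alpha>(i := Suc (\<alpha> i))) v) \<partial>unif_sphere d)"
    unfolding E_def
  proof (rule integral_cong_AE)
    show "AE v in unif_sphere d. smono d \<alpha> \<alpha> v = (\<Sum>i<d. smono d (\<alpha>(i := Suc (\<alpha> i))) (\<alpha>(i := Suc (\<alpha> i))) v)"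
      using AE_unif_sphere
    proof eventually_elim
      case (elim v)
      have "smono d (\<alpha>(i := Suc (\<alpha> i))) (\<alpha>(i := Suc (\<alpha> i))) v = of_real ((cmod (v i))\<^sup>2) * smono d \<alpha> \<alpha> v" if "i < d" for i
      proof -
        have "(\<Prod>j\<in>{..<d}-{i}. v j ^ (\<alpha>(i := Suc (\<alpha> i))) j * cnj (v j) ^ (\<alpha>(i := Suc (\<alpha> i))) j) =
            (\<Prod>j\<in>{..<d}-{i}. v j ^ \<alpha> j * cnj (v j) ^ \<alpha> j)" by (rule prod.cong) auto
        hence "smono d (\<alpha>(i := Suc (\<alpha> i))) (\<alpha>(i := Suc (\<alpha> i))) v = (v i * cnj (v i)) * smono d \<alpha> \<alpha> v"
          using that unfolding smono_def by (simp add: prod.remove[of _ i] mult_ac)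
        also have "v i * cnj (v i) = of_real ((cmod (v i))\<^sup>2)"
          using complex_norm_square[of "v i"] by simp
        finally show ?thesis .
      qed
      hence "(\<Sum>i<d. smono d (\<alpha>(i := Suc (\<alpha> i))) (\<alpha>(i := Suc (\<alpha> i))) v) = of_real (sqnorm d v) * smono d \<alpha> \<alpha> v"
        by (simp add: sqnorm_def sum_distrib_right)
      thus ?case using elim by simp
    qed
  qed (auto simp: measurable_unif_sphere)
  also have "\<dots> = (\<Sum>i<d. E (\<alpha>(i := Suc (\<alpha> i))))"
    unfolding E_def by (rule Bochner_Integration.integral_sum) (rule integrable_smono)
  finally have "of_real (radial_moment (Suc b)) * E \<alpha> = (\<Sum>i<d. of_real (radial_moment (Suc b)) * E (\<alpha>(i := Suc (\<alpha> i))))"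
    by (simp add: sum_distrib_left)
  also have "\<dots> = (\<Sum>i<d. e (\<alpha>(i := Suc (\<alpha> i))))"
  proof (rule sum.cong[OF refl])
    fix i assume "i \<in> {..<d}"
    thus "of_real (radial_moment (Suc b)) * E (\<alpha>(i := Suc (\<alpha> i))) = e (\<alpha>(i := Suc (\<alpha> i)))"
      using g[of "\<alpha>(i := Suc (\<alpha> i))"] sum_incr[of i \<alpha>] s by simp
  qed
  also have "\<dots> = (\<Sum>i<d. 2 * (of_nat (\<alpha> i) + 1) * e \<alpha>)"
    unfolding e_def by (intro sum.cong gauss_moment_incr) auto
  also have "\<dots> = 2 * (of_nat b + of_nat d) * e \<alpha>"
    unfolding s[symmetric] by (simp add: sum_distrib_right[symmetric] sum_distrib_left[symmetric] sum.distrib)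
  also have "\<dots> = 2 * (of_nat b + of_nat d) * (of_real (radial_moment b) * E \<alpha>)" using g[of \<alpha>] s by simp
  finally have "complex_of_real (radial_moment (Suc b)) * E \<alpha> = of_real (2 * (real b + real d) * radial_moment b) * E \<alpha>"
    by simp
  moreover have "E \<alpha> \<noteq> 0" using g[of \<alpha>] e0[of \<alpha>] by auto
  ultimately show "radial_moment (Suc b) = 2 * (real b + real d) * radial_moment b"
    by (simp only: mult_cancel_right of_real_eq_iff) simp
qed

text \<open>Gaussian integration by parts, transferred to the sphere. The two monomials have
  bidegrees (b+1, b+1) and (b, b), and the quotient 2 (b + d) of the radial moments is the source of
  the factor d + b.\<close>

lemma sphere_by_parts:
  assumes "i < d" "sum \<alpha> {..<d} = b" "sum \<beta> {..<d} = Suc b"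
  shows "(of_nat d + of_nat b) * (\<integral>v. smono d (\<alpha>(i := Suc (\<alpha> i))) \<beta> v \<partial>unif_sphere d) =
    of_nat (\<beta> i) * (\<integral>v. smono d \<alpha> (\<beta>(i := \<beta> i - 1)) v \<partial>unif_sphere d)"
proof -
  let ?\<alpha> = "\<alpha>(i := Suc (\<alpha> i))" and ?\<beta> = "\<beta>(i := \<beta> i - 1)"
  let ?E1 = "\<integral>v. smono d ?\<alpha> \<beta> v \<partial>unif_sphere d" and ?E2 = "\<integral>v. smono d \<alpha> ?\<beta> v \<partial>unif_sphere d"
  have 1: "of_real (radial_moment (Suc b)) * ?E1 = gauss_moment d ?\<alpha> \<beta>"
    by (rule sphere_gauss) (use assms sum_incr in auto)
  show ?thesis
  proof (cases "\<beta> i = 0")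
    case True
    hence "gauss_moment d ?\<alpha> \<beta> = 0" using assms(1) by (intro gauss_moment_eq_0[of i]) auto
    hence "?E1 = 0" using 1 radial_moment_pos by simp
    thus ?thesis using True by simp
  next
    case False
    hence b: "\<beta> = ?\<beta>(i := Suc (?\<beta> i))" by auto
    have "sum ?\<beta> {..<d} = b" using sum_incr[OF assms(1), of ?\<beta>] assms(3)
      unfolding b[symmetric] by (simp only: nat.inject)
    hence 2: "of_real (radial_moment b) * ?E2 = gauss_moment d \<alpha> ?\<beta>"
      by (rule sphere_gauss[OF assms(2)])
    have "gauss_moment d ?\<alpha> \<beta> = 2 * of_nat (\<beta> i) * gauss_moment d \<alpha> ?\<beta>"
    proof (cases "\<forall>j<d. ?\<alpha> j = \<beta> j")
      case True
      have e1: "\<beta> j = ?\<alpha> j" if "j < d" for j using True that by simp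
      have e2: "?\<beta> j = \<alpha> j" if "j < d" for j using e1[OF that] by (auto split: if_splits)
      have "gauss_moment d ?\<alpha> \<beta> = gauss_moment d ?\<alpha> ?\<alpha>" by (rule gauss_moment_cong[OF refl e1])
      moreover have "gauss_moment d \<alpha> ?\<beta> = gauss_moment d \<alpha> \<alpha>" by (rule gauss_moment_cong[OF refl e2])
      moreover have "complex_of_nat (\<alpha> i) + 1 = of_nat (\<beta> i)"
        using True assms(1) by (metis Suc_eq_plus1 fun_upd_same of_nat_1 of_nat_add)
      ultimately show ?thesis using gauss_moment_incr[OF assms(1), of \<alpha>] by simp
    next
      case F: False
      \<comment> \<open>As \<open>\<beta> i\<close> is positive, a coordinate with unequal exponents
        on the left has unequal exponents on the right as well, so both moments vanish.\<close>
      then obtain j where "j < d" "?\<alpha> j \<noteq> \<beta> j" "\<alpha> j \<noteq> ?\<beta> j" using False by (auto split: if_splits)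
      thus ?thesis by (simp add: gauss_moment_eq_0[of j] del: fun_upd_apply)
    qed
    hence "of_real (radial_moment (Suc b)) * ?E1 = 2 * of_nat (\<beta> i) * (of_real (radial_moment b) * ?E2)"
      unfolding 1 2 .
    hence "of_real (2 * radial_moment b) * ((of_nat d + of_nat b) * ?E1) = of_real (2 * radial_moment b) * (of_nat (\<beta> i) * ?E2)"
      unfolding radial_moment_Suc by (simp add: algebra_simps)
    thus ?thesis using radial_moment_pos by simp
  qed
qed

end

section \<open>The loop equation\<close>

text \<open>A single tensor factor: the p vectors belonging to one fixed index i < k.\<close>

definition sphere_prod :: "nat \<Rightarrow> nat \<Rightarrow> (nat \<Rightarrow> nat \<Rightarrow> complex) measure" where
  "sphere_prod d p = PiM {..<p} (\<lambda>_. unif_sphere d)"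

definition word_expect :: "nat \<Rightarrow> nat \<Rightarrow> nat list list \<Rightarrow> complex" where
  "word_expect d p ws = (\<integral>\<omega>. words_tr d (cfg \<omega>) ws \<partial>sphere_prod d p)"

definition letters :: "'a list list \<Rightarrow> 'a set" where
  "letters ws = \<Union> (set ` set ws)"

lemma letters_simps [simp]: "letters [] = {}" "letters (w # ws) = set w \<union> letters ws"
  by (auto simp: letters_def)

lemma letters_iff: "letters ws \<subseteq> S \<longleftrightarrow> (\<forall>w\<in>set ws. set w \<subseteq> S)"
  by (auto simp: letters_def)

lemma finite_letters [simp]: "finite (letters ws)"
  by (simp add: letters_def)

lemma letters_mset: "mset ws = mset ws' \<Longrightarrow> letters ws = letters ws'"
  unfolding letters_def by (metis set_mset_mset)

lemma letters_nth: "m < length ws \<Longrightarrow> set (ws ! m) \<subseteq> letters ws"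
  using nth_mem by (fastforce simp: letters_def)

lemma mset_remove_nth: "m < length ws \<Longrightarrow> mset ws = add_mset (ws ! m) (mset (remove_nth m ws))"
  unfolding remove_nth_def
  by (subst id_take_nth_drop[of m ws]) auto

lemma letters_remove: "m < length ws \<Longrightarrow> letters ws = set (ws ! m) \<union> letters (remove_nth m ws)"
  using letters_mset[of ws "ws ! m # remove_nth m ws"] mset_remove_nth[of m ws] by simp

lemma sum_list_remove_nth:
  fixes f :: "'a \<Rightarrow> nat"
  shows "m < length ws \<Longrightarrow> (\<Sum>w\<leftarrow>ws. f w) = f (ws ! m) + (\<Sum>w\<leftarrow>remove_nth m ws. f w)"
  unfolding remove_nth_def
  by (subst id_take_nth_drop[of m ws]) auto

lemma set_split_nth: "n < length u \<Longrightarrow> set u = insert (u ! n) (set (take n u) \<union> set (drop (Suc n) u))"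
  by (subst (1) id_take_nth_drop[of n u]) auto

lemma letters_split:
  "n < length u \<Longrightarrow> u ! n = a \<Longrightarrow> letters ((a # take n u) # drop (Suc n) u # R) = letters ((a # u) # R)"
  using set_split_nth[of n u] by auto

lemma letters_merge:
  assumes "m < length R" "n < length (R ! m)" "R ! m ! n = a"
  shows "letters ((a # u @ open_at n (R ! m)) # remove_nth m R) = letters ((a # u) # R)"
  using letters_remove[OF assms(1)] set_open_at[OF assms(2)] assms(3) by auto

lemma length_remove_nth: "m < length ws \<Longrightarrow> length (remove_nth m ws) = length ws - 1"
  by (simp add: remove_nth_def)

text \<open>The ket of the leading \<open>a\<close> can be paired with its own bra, which deletes
  the letter, with the bra of another \<open>a\<close> in \<open>u\<close>, which splits the trace,
  or with that of an \<open>a\<close> in a word of \<open>R\<close>, which merges two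
  traces.\<close>

definition loop_sum :: "(nat list list \<Rightarrow> 'a :: comm_monoid_add) \<Rightarrow> nat \<Rightarrow> nat list \<Rightarrow> nat list list \<Rightarrow> 'a" where
  "loop_sum F a u R = F (u # R) +
    (\<Sum>n<length u. if u ! n = a then F ((a # take n u) # drop (Suc n) u # R) else 0) +
    (\<Sum>m<length R. \<Sum>n<length (R ! m). if R ! m ! n = a then F ((a # u @ open_at n (R ! m)) # remove_nth m R) else 0)"

context
  fixes d p :: nat
  assumes d: "d \<ge> 1"
begin

lemma product_sigma_finite_sphere: "product_sigma_finite (\<lambda>_. unif_sphere d)"
  using prob_space_unif_sphere[OF d]
  by (auto simp: product_sigma_finite_def intro: prob_space_imp_sigma_finite)

lemma sphere_prod_vmono:
  "integrable (sphere_prod d p) (\<lambda>\<omega>. vmono (cvars p d) \<alpha> (cfg \<omega>))"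
  "(\<integral>\<omega>. vmono (cvars p d) \<alpha> (cfg \<omega>) \<partial>sphere_prod d p) =
     (\<Prod>t<p. \<integral>v. smono d (\<lambda>j. \<alpha> (True, t, j)) (\<lambda>j. \<alpha> (False, t, j)) v \<partial>unif_sphere d)"
proof -
  interpret product_sigma_finite "\<lambda>_::nat. unif_sphere d" by (rule product_sigma_finite_sphere)
  show "integrable (sphere_prod d p) (\<lambda>\<omega>. vmono (cvars p d) \<alpha> (cfg \<omega>))"
    unfolding vmono_cfg sphere_prod_def by (rule product_integrable_prod) (auto intro: integrable_smono[OF d])
  show "(\<integral>\<omega>. vmono (cvars p d) \<alpha> (cfg \<omega>) \<partial>sphere_prod d p) =
     (\<Prod>t<p. \<integral>v. smono d (\<lambda>j. \<alpha> (True, t, j)) (\<lambda>j. \<alpha> (False, t, j)) v \<partial>unif_sphere d)"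
    unfolding vmono_cfg sphere_prod_def by (rule product_integral_prod) (auto intro: integrable_smono[OF d])
qed

lemma sphere_prod_by_parts:
  assumes "a < p" "i < d" "sum \<alpha> (letter_vars d a True) = b" "sum \<alpha> (letter_vars d a False) = Suc b"
  shows "(of_nat d + of_nat b) *
      (\<integral>\<omega>. vmono (cvars p d) (\<alpha>((True, a, i) := Suc (\<alpha> (True, a, i)))) (cfg \<omega>) \<partial>sphere_prod d p) =
    of_nat (\<alpha> (False, a, i)) * (\<integral>\<omega>. vmono (cvars p d) (decr (False, a, i) \<alpha>) (cfg \<omega>) \<partial>sphere_prod d p)"
proof -
  define T where "T \<alpha> t = (\<integral>v. smono d (\<lambda>j. \<alpha> (True, t, j)) (\<lambda>j. \<alpha> (False, t, j)) v \<partial>unif_sphere d)"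
    for \<alpha> :: "bool \<times> nat \<times> nat \<Rightarrow> nat" and t
  let ?\<alpha> = "\<alpha>((True, a, i) := Suc (\<alpha> (True, a, i)))" and ?\<beta> = "decr (False, a, i) \<alpha>"
  have lv: "sum \<alpha> (letter_vars d a b) = (\<Sum>j<d. \<alpha> (b, a, j))" for b
    unfolding letter_vars_def
    by (rule sum.reindex_bij_witness[of _ "\<lambda>j. (b, a, j)" "\<lambda>(_, _, j). j"]) auto
  have o: "T ?\<alpha> t = T \<alpha> t" "T ?\<beta> t = T \<alpha> t" if "t \<noteq> a" for t
    using that by (auto simp: T_def decr_def)
  have "(\<Prod>t\<in>{..<p}-{a}. T ?\<alpha> t) = (\<Prod>t\<in>{..<p}-{a}. T \<alpha> t)" "(\<Prod>t\<in>{..<p}-{a}. T ?\<beta> t) = (\<Prod>t\<in>{..<p}-{a}. T \<alpha> t)"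
    by (auto intro!: prod.cong simp: o)
  moreover have "(of_nat d + of_nat b) * T ?\<alpha> a = of_nat (\<alpha> (False, a, i)) * T ?\<beta> a"
  proof -
    have "(\<lambda>j. ?\<alpha> (True, a, j)) = (\<lambda>j. \<alpha> (True, a, j))(i := Suc (\<alpha> (True, a, i)))"
      "(\<lambda>j. ?\<beta> (False, a, j)) = (\<lambda>j. \<alpha> (False, a, j))(i := \<alpha> (False, a, i) - 1)"
      by (auto simp: decr_def)
    thus ?thesis
      using sphere_by_parts[OF d assms(2), of "\<lambda>j. \<alpha> (True, a, j)" b "\<lambda>j. \<alpha> (False, a, j)"] assms(3,4)
      unfolding T_def lv by (simp add: decr_def)
  qed
  ultimately show ?thesis
    unfolding sphere_prod_vmono(2) T_def[symmetric] using assms(1) by (simp add: prod.remove[of _ a])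
qed

lemma integrable_words_tr:
  assumes "\<forall>w\<in>set ws. set w \<subseteq> {..<p}"
  shows "integrable (sphere_prod d p) (\<lambda>\<omega>. words_tr d (cfg \<omega>) ws)"
  by (rule poly_deriv_integrable(1)[OF cpoly_words_tr[OF d _ assms, of 0 0] sphere_prod_vmono(1)]) (use d in simp)

text \<open>Integration by parts in the ket of the leading \<open>a\<close>, the derivative falling
  on the bras of \<open>a\<close>. Apart from this ket the integrand contains b kets and b + 1 bras
  of \<open>a\<close>, where b counts the other occurrences; this gives the factor d + b.\<close>

lemma loop_equation:
  assumes "a < p" "set u \<subseteq> {..<p}" "letters R \<subseteq> {..<p}"
  shows "(of_nat d + of_nat (count_list u a + (\<Sum>w\<leftarrow>R. count_list w a))) * word_expect d p ((a # u) # R) =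
    loop_sum (word_expect d p) a u R"
proof -
  let ?M = "sphere_prod d p"
  define b where "b = count_list u a + (\<Sum>w\<leftarrow>R. count_list w a)"
  define D where "D i x l = (\<Sum>n<length u. if u ! n = a then word_vec d x a (take n u) l * word_mat d x (drop (Suc n) u) i i else 0)"
    for i x l
  define DR where "DR i x = (\<Sum>m<length R. \<Sum>n<length (R ! m). if R ! m ! n = a
       then word_vec d x a (open_at n (R ! m)) i * words_tr d x (remove_nth m R) else 0)" for i x
  \<comment> \<open>The word \<open>a # u\<close> with the ket of its leading letter taken
    off.\<close>
  define g where "g i x = (\<Sum>l<d. x (False, a, l) * word_mat d x u l i)" for i and x :: config
  define f' where "f' i x = (\<Sum>l<d. (if a = a \<and> l = i then 1 else 0) * word_mat d x u l i + x (False, a, l) * D i x l) * words_tr d x R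
      + g i x * DR i x" for i x
  have pol: "cpoly p d a i b (Suc b) (\<lambda>x. g i x * words_tr d x R) (f' i)" if i: "i < d" for i
  proof (rule poly_deriv_cong)
    show "cpoly p d a i (0 + count_list u a + (\<Sum>w\<leftarrow>R. count_list w a))
       ((if a = a then 1 else 0) + count_list u a + (\<Sum>w\<leftarrow>R. count_list w a)) (\<lambda>x. g i x * words_tr d x R) (f' i)"
      unfolding g_def f'_def D_def DR_def
      by (intro poly_deriv_mult poly_deriv_sum cpoly_bra cpoly_word_mat cpoly_words_tr)
        (use assms d i in \<open>auto simp: lessThan_empty_iff letters_iff\<close>)
  qed (auto simp: b_def)
  have parts: "integrable ?M (\<lambda>\<omega>. cfg \<omega> (True, a, i) * (g i (cfg \<omega>) * words_tr d (cfg \<omega>) R)) \<and>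
      (of_nat d + of_nat b) * (\<integral>\<omega>. cfg \<omega> (True, a, i) * (g i (cfg \<omega>) * words_tr d (cfg \<omega>) R) \<partial>?M) =
      (\<integral>\<omega>. f' i (cfg \<omega>) \<partial>?M)" if i: "i < d" for i
    by (rule poly_deriv_by_parts[OF pol[OF i] sphere_prod_vmono(1)])
       (use assms i sphere_prod_by_parts in \<open>auto simp: cvars_def\<close>)
  have int': "integrable ?M (\<lambda>\<omega>. f' i (cfg \<omega>))" if "i < d" for i
    by (rule poly_deriv_integrable(2)[OF pol[OF that] sphere_prod_vmono(1)])
  \<comment> \<open>Summation over the free index i closes all open strands to traces again.\<close>
  have pt: "(\<Sum>i<d. f' i x) = loop_sum (words_tr d x) a u R" for x
  proof -
    have 1: "(\<Sum>l<d. (if a = a \<and> l = i then 1 else 0) * word_mat d x u l i) = word_mat d x u i i" if "i < d" for i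
    proof -
      have "(\<Sum>l<d. (if a = a \<and> l = i then 1 else 0) * word_mat d x u l i) = (\<Sum>l<d. if l = i then word_mat d x u i i else 0)"
        by (rule sum.cong) auto
      thus ?thesis using that by simp
    qed
    have 2: "(\<Sum>i<d. \<Sum>l<d. x (False, a, l) * D i x l) =
       (\<Sum>n<length u. if u ! n = a then word_tr d x (a # take n u) * word_tr d x (drop (Suc n) u) else 0)"
    proof -
      define T where "T n i l = (if u ! n = a
        then x (False, a, l) * word_vec d x a (take n u) l * word_mat d x (drop (Suc n) u) i i else 0)" for n i l
      have "(\<Sum>i<d. \<Sum>l<d. x (False, a, l) * D i x l) = (\<Sum>i<d. \<Sum>l<d. \<Sum>n<length u. T n i l)"
        unfolding D_def T_def by (simp add: sum_distrib_left if_distrib[of "\<lambda>z. _ * z"] mult.assoc cong: if_cong)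
      also have "\<dots> = (\<Sum>i<d. \<Sum>n<length u. \<Sum>l<d. T n i l)" by (intro sum.cong refl sum.swap)
      also have "\<dots> = (\<Sum>n<length u. \<Sum>i<d. \<Sum>l<d. T n i l)" by (rule sum.swap)
      also have "\<dots> = (\<Sum>n<length u. if u ! n = a then word_tr d x (a # take n u) * word_tr d x (drop (Suc n) u) else 0)"
        unfolding T_def
        by (rule sum.cong[OF refl]) (simp add: word_tr_Cons word_tr_def[of d x "drop _ _"] sum_product, intro impI sum.swap)
      finally show ?thesis .
    qed
    have 3: "(\<Sum>i<d. g i x * word_vec d x a z i) = word_tr d x (a # u @ z)" for z
    proof -
      have "word_tr d x (a # u @ z) = (\<Sum>l<d. \<Sum>i<d. x (False, a, l) * word_mat d x u l i * word_vec d x a z i)"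
        unfolding word_tr_Cons
        by (intro sum.cong refl) (simp add: word_vec_append sum_distrib_left mult.assoc)
      also have "\<dots> = (\<Sum>i<d. \<Sum>l<d. x (False, a, l) * word_mat d x u l i * word_vec d x a z i)"
        by (rule sum.swap)
      finally show ?thesis by (simp add: g_def sum_distrib_right)
    qed
    have 4: "(\<Sum>i<d. g i x * DR i x) = (\<Sum>m<length R. \<Sum>n<length (R ! m). if R ! m ! n = a
       then word_tr d x (a # u @ open_at n (R ! m)) * words_tr d x (remove_nth m R) else 0)"
    proof -
      define T where "T m n i = (if R ! m ! n = a
        then g i x * word_vec d x a (open_at n (R ! m)) i * words_tr d x (remove_nth m R) else 0)" for m n i
      have "(\<Sum>i<d. g i x * DR i x) = (\<Sum>i<d. \<Sum>m<length R. \<Sum>n<length (R ! m). T m n i)"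
        unfolding DR_def T_def by (simp add: sum_distrib_left if_distrib[of "\<lambda>z. _ * z"] mult.assoc cong: if_cong)
      also have "\<dots> = (\<Sum>m<length R. \<Sum>i<d. \<Sum>n<length (R ! m). T m n i)" by (rule sum.swap)
      also have "\<dots> = (\<Sum>m<length R. \<Sum>n<length (R ! m). \<Sum>i<d. T m n i)" by (intro sum.cong refl sum.swap)
      also have "\<dots> = (\<Sum>m<length R. \<Sum>n<length (R ! m). if R ! m ! n = a
       then word_tr d x (a # u @ open_at n (R ! m)) * words_tr d x (remove_nth m R) else 0)"
        unfolding T_def by (intro sum.cong refl) (simp add: 3[symmetric] sum_distrib_right)
      finally show ?thesis .
    qed
    have "(\<Sum>i<d. f' i x) = (\<Sum>i<d. word_mat d x u i i * words_tr d x R +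
        (\<Sum>l<d. x (False, a, l) * D i x l) * words_tr d x R + g i x * DR i x)"
      unfolding f'_def by (rule sum.cong) (simp_all only: sum.distrib 1 lessThan_iff distrib_right)
    also have "\<dots> = word_tr d x u * words_tr d x R + (\<Sum>i<d. \<Sum>l<d. x (False, a, l) * D i x l) * words_tr d x R +
        (\<Sum>i<d. g i x * DR i x)"
      by (simp only: sum.distrib sum_distrib_right word_tr_def)
    finally show ?thesis
      unfolding 2 4 loop_sum_def by (simp add: sum_distrib_right if_distrib[of "\<lambda>z. z * _"] mult.assoc cong: if_cong)
  qed
  have hb: "has_bochner_integral ?M (\<lambda>\<omega>. words_tr d (cfg \<omega>) ws) (word_expect d p ws)" if "letters ws \<subseteq> {..<p}" for ws
    using integrable_words_tr that by (simp add: has_bochner_integral_iff word_expect_def letters_iff)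
  have hif: "has_bochner_integral ?M (\<lambda>\<omega>. if P then f \<omega> else 0) (if P then z else 0)"
    if "P \<Longrightarrow> has_bochner_integral ?M f z" for P f and z :: complex
    using that by (cases P) (simp_all add: has_bochner_integral_zero)
  have ls: "letters ((a # take n u) # drop (Suc n) u # R) \<subseteq> {..<p}" if "n < length u" "u ! n = a" for n
    by (subst letters_split[OF that]) (use assms in auto)
  have lm: "letters ((a # u @ open_at n (R ! m)) # remove_nth m R) \<subseteq> {..<p}"
    if "m < length R" "n < length (R ! m)" "R ! m ! n = a" for m n
    by (subst letters_merge[OF that]) (use assms in auto)
  have "has_bochner_integral ?M (\<lambda>\<omega>. loop_sum (words_tr d (cfg \<omega>)) a u R) (loop_sum (word_expect d p) a u R)"
    unfolding loop_sum_def
    by (intro has_bochner_integral_add has_bochner_integral_sum hif hb ls lm) (use assms in auto)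
  hence "loop_sum (word_expect d p) a u R = (\<integral>\<omega>. (\<Sum>i<d. f' i (cfg \<omega>)) \<partial>?M)"
    unfolding pt by (rule has_bochner_integral_integral_eq[symmetric])
  also have "\<dots> = (\<Sum>i<d. \<integral>\<omega>. f' i (cfg \<omega>) \<partial>?M)"
    using int' by (intro Bochner_Integration.integral_sum) auto
  also have "\<dots> = (of_nat d + of_nat b) * (\<integral>\<omega>. (\<Sum>i<d. cfg \<omega> (True, a, i) * (g i (cfg \<omega>) * words_tr d (cfg \<omega>) R)) \<partial>?M)"
    using parts by (simp add: Bochner_Integration.integral_sum sum_distrib_left)
  also have "(\<lambda>\<omega>. \<Sum>i<d. cfg \<omega> (True, a, i) * (g i (cfg \<omega>) * words_tr d (cfg \<omega>) R)) = (\<lambda>\<omega>. words_tr d (cfg \<omega>) ((a # u) # R))"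
    by (simp add: word_tr_def g_def sum_distrib_right mult.assoc)
  finally show ?thesis unfolding b_def word_expect_def by (rule sym)
qed

end

section \<open>Expected traces as sums over words\<close>

definition words :: "nat \<Rightarrow> nat \<Rightarrow> nat list set" where
  "words p m = {s. length s = m \<and> set s \<subseteq> {..<p}}"

lemma finite_words [simp]: "finite (words p m)"
  unfolding words_def using finite_lists_length_eq[of "{..<p}" m] by (simp add: conj_commute)

lemma words_0 [simp]: "words p 0 = {[]}"
  by (auto simp: words_def)

lemma sum_words_Suc: "(\<Sum>s\<in>words p (Suc m). f s) = (\<Sum>s\<in>words p m. \<Sum>t<p. f (s @ [t]))"
proof -
  have "words p (Suc m) = (\<lambda>(s, t). s @ [t]) ` (words p m \<times> {..<p})"
    by (fastforce simp: words_def image_iff length_Suc_conv_rev)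
  moreover have "inj_on (\<lambda>(s, t). s @ [t]) (words p m \<times> {..<p})" by (auto simp: inj_on_def)
  ultimately show ?thesis by (simp add: sum.reindex sum.cartesian_product case_prod_unfold)
qed

lemma sum_words_Cons: "(\<Sum>s\<in>words p (Suc m). f s) = (\<Sum>t<p. \<Sum>s\<in>words p m. f (t # s))"
proof -
  have "words p (Suc m) = (\<lambda>(t, s). t # s) ` ({..<p} \<times> words p m)"
    by (fastforce simp: words_def image_iff length_Suc_conv)
  moreover have "inj_on (\<lambda>(t, s). t # s) ({..<p} \<times> words p m)" by (auto simp: inj_on_def)
  ultimately show ?thesis by (simp add: sum.reindex sum.cartesian_product case_prod_unfold)
qed

abbreviation column :: "nat \<Rightarrow> (nat \<times> nat \<Rightarrow> nat \<Rightarrow> complex) \<Rightarrow> nat \<Rightarrow> nat \<Rightarrow> complex" where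
  "column i \<omega> \<equiv> (\<lambda>t. \<omega> (t, i))"

lemma word_mat_snoc:
  assumes "i < d" "j < d"
  shows "word_mat d (cfg \<omega>) (s @ [t]) i j = (\<Sum>l<d. word_mat d (cfg \<omega>) s i l * (\<omega> t l * cnj (\<omega> t j)))"
proof -
  have "(\<Sum>m<d. cnj (\<omega> t m) * (if m = j then 1 else 0)) = (\<Sum>m<d. if m = j then cnj (\<omega> t j) else 0)"
    by (rule sum.cong) auto
  hence "word_mat d (cfg \<omega>) [t] l j = \<omega> t l * cnj (\<omega> t j)" for l
    using assms by (simp add: cfg_def)
  thus ?thesis using word_mat_append[OF assms(1), of "cfg \<omega>" s "[t]" j] by simp
qed

text \<open>All tensor factors of a product of rank one matrices carry the same word, so the sum
  over an intermediate multi-index splits into k separate matrix products.\<close>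

lemma mat_pow_words:
  assumes "a \<in> tidx d k" "b \<in> tidx d k"
  shows "mat_pow (tidx d k) (Mmat p k \<omega>) m a b = (\<Sum>s\<in>words p m. \<Prod>i<k. word_mat d (cfg (column i \<omega>)) s (a i) (b i))"
  using assms(2)
proof (induction m arbitrary: b)
  case 0
  have "(\<Prod>i<k. if a i = b i then 1 else 0 :: complex) = (if a = b then 1 else 0)"
  proof (cases "a = b")
    case False
    then obtain i where "i < k" "a i \<noteq> b i"
      using assms(1) 0 by (metis PiE_ext lessThan_iff tidx_def)
    thus ?thesis using False by (auto intro!: prod_zero)
  qed simp
  thus ?case by simp
next
  case (Suc m)
  have bd: "a i < d" "b i < d" if "i < k" for i using assms(1) Suc.prems that by (auto simp: tidx_def)
  have "mat_pow (tidx d k) (Mmat p k \<omega>) (Suc m) a b =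
      (\<Sum>c\<in>tidx d k. (\<Sum>s\<in>words p m. \<Prod>i<k. word_mat d (cfg (column i \<omega>)) s (a i) (c i)) * Mmat p k \<omega> c b)"
    by (simp add: mat_mult_def Suc.IH)
  also have "\<dots> = (\<Sum>c\<in>tidx d k. \<Sum>s\<in>words p m. \<Sum>t<p. \<Prod>i<k. word_mat d (cfg (column i \<omega>)) s (a i) (c i) * (\<omega> (t, i) (c i) * cnj (\<omega> (t, i) (b i))))"
    by (simp add: Mmat_def tensor_vec_def sum_product prod.distrib mult.assoc)
  also have "\<dots> = (\<Sum>s\<in>words p m. \<Sum>t<p. \<Sum>c\<in>tidx d k. \<Prod>i<k. word_mat d (cfg (column i \<omega>)) s (a i) (c i) * (\<omega> (t, i) (c i) * cnj (\<omega> (t, i) (b i))))"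
    by (subst sum.swap) (intro sum.cong refl sum.swap)
  also have "\<dots> = (\<Sum>s\<in>words p m. \<Sum>t<p. \<Prod>i<k. word_mat d (cfg (column i \<omega>)) (s @ [t]) (a i) (b i))"
    unfolding tidx_def
    by (intro sum.cong refl, subst prod_sum_PiE[symmetric]) (auto intro!: prod.cong simp: word_mat_snoc bd)
  finally show ?case by (simp add: sum_words_Suc)
qed

lemma trace_words:
  "mat_trace (tidx d k) (mat_pow (tidx d k) (Mmat p k \<omega>) m) =
    (\<Sum>s\<in>words p m. \<Prod>i<k. word_tr d (cfg (column i \<omega>)) s)"
proof -
  have "mat_trace (tidx d k) (mat_pow (tidx d k) (Mmat p k \<omega>) m) =
      (\<Sum>s\<in>words p m. \<Sum>a\<in>tidx d k. \<Prod>i<k. word_mat d (cfg (column i \<omega>)) s (a i) (a i))"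
    unfolding mat_trace_def by (subst sum.swap) (simp add: mat_pow_words)
  also have "\<dots> = (\<Sum>s\<in>words p m. \<Prod>i<k. word_tr d (cfg (column i \<omega>)) s)"
    unfolding word_tr_def tidx_def by (intro sum.cong refl, subst prod_sum_PiE) auto
  finally show ?thesis .
qed

text \<open>The columns are independent copies, but a trace is no product over the vectors of its
  column. Expanded into monomials, the integrand becomes a sum of products over all pairs (t, i), to
  which the product measure applies.\<close>

lemma integral_columns:
  assumes d: "d \<ge> 1" and s: "set s \<subseteq> {..<p}"
  shows "integrable (sphere_family d p k) (\<lambda>\<omega>. \<Prod>i<k. word_tr d (cfg (column i \<omega>)) s)"
    and "(\<integral>\<omega>. (\<Prod>i<k. word_tr d (cfg (column i \<omega>)) s) \<partial>sphere_family d p k) = word_expect d p [s] ^ k"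
proof -
  interpret product_sigma_finite "\<lambda>_::nat \<times> nat. unif_sphere d"
    using prob_space_unif_sphere[OF d] by (auto simp: product_sigma_finite_def intro: prob_space_imp_sigma_finite)
  obtain N :: nat and c \<alpha> where rep: "\<And>x. word_tr d x s = (\<Sum>n<N. c n * vmono (cvars p d) (\<alpha> n) x)"
    using poly_deriv_repr[OF cpoly_word_tr[of d 0 s p 0]] d s by auto
  define T where "T g = (\<lambda>\<omega>. \<Prod>z\<in>{..<p} \<times> {..<k}.
      smono d (\<lambda>j. \<alpha> (g (snd z)) (True, fst z, j)) (\<lambda>j. \<alpha> (g (snd z)) (False, fst z, j)) (\<omega> z))"
    for g and \<omega> :: "nat \<times> nat \<Rightarrow> nat \<Rightarrow> complex"
  have eq: "(\<Prod>i<k. word_tr d (cfg (column i \<omega>)) s) = (\<Sum>g\<in>PiE {..<k} (\<lambda>_. {..<N}). (\<Prod>i<k. c (g i)) * T g \<omega>)" for \<omega>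
  proof -
    have "(\<Prod>i<k. word_tr d (cfg (column i \<omega>)) s) =
        (\<Sum>g\<in>PiE {..<k} (\<lambda>_. {..<N}). \<Prod>i<k. c (g i) * vmono (cvars p d) (\<alpha> (g i)) (cfg (column i \<omega>)))"
      unfolding rep by (rule prod_sum_PiE) auto
    also have "\<dots> = (\<Sum>g\<in>PiE {..<k} (\<lambda>_. {..<N}). (\<Prod>i<k. c (g i)) * T g \<omega>)"
      unfolding vmono_cfg prod.distrib T_def
      by (intro sum.cong refl arg_cong2[where f = "(*)"]) (subst prod.swap, simp add: prod.cartesian_product case_prod_unfold)
    finally show ?thesis .
  qed
  have iT: "integrable (sphere_family d p k) (T g)" for g
    unfolding T_def sphere_family_def
    by (rule product_integrable_prod) (auto intro: integrable_smono[OF d])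
  have eT: "(\<integral>\<omega>. T g \<omega> \<partial>sphere_family d p k) = (\<Prod>i<k. \<integral>\<omega>. vmono (cvars p d) (\<alpha> (g i)) (cfg \<omega>) \<partial>sphere_prod d p)" for g
  proof -
    have "(\<integral>\<omega>. T g \<omega> \<partial>sphere_family d p k) = (\<Prod>z\<in>{..<p} \<times> {..<k}.
        \<integral>v. smono d (\<lambda>j. \<alpha> (g (snd z)) (True, fst z, j)) (\<lambda>j. \<alpha> (g (snd z)) (False, fst z, j)) v \<partial>unif_sphere d)"
      unfolding T_def sphere_family_def
      by (rule product_integral_prod) (auto intro: integrable_smono[OF d])
    also have "\<dots> = (\<Prod>t<p. \<Prod>i<k. \<integral>v. smono d (\<lambda>j. \<alpha> (g i) (True, t, j)) (\<lambda>j. \<alpha> (g i) (False, t, j)) v \<partial>unif_sphere d)"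
      by (simp add: prod.cartesian_product case_prod_unfold)
    finally show ?thesis unfolding sphere_prod_vmono(2)[OF d] by (subst prod.swap)
  qed
  show "integrable (sphere_family d p k) (\<lambda>\<omega>. \<Prod>i<k. word_tr d (cfg (column i \<omega>)) s)"
    unfolding eq by (intro Bochner_Integration.integrable_sum integrable_mult_right iT)
  have "word_expect d p [s] = (\<Sum>n<N. c n * (\<integral>\<omega>. vmono (cvars p d) (\<alpha> n) (cfg \<omega>) \<partial>sphere_prod d p))"
    unfolding word_expect_def by (simp add: rep sphere_prod_vmono(1)[OF d])
  hence "word_expect d p [s] ^ k = (\<Prod>i<k. \<Sum>n<N. c n * (\<integral>\<omega>. vmono (cvars p d) (\<alpha> n) (cfg \<omega>) \<partial>sphere_prod d p))"
    by simp
  also have "\<dots> = (\<Sum>g\<in>PiE {..<k} (\<lambda>_. {..<N}). \<Prod>i<k. c (g i) * (\<integral>\<omega>. vmono (cvars p d) (\<alpha> (g i)) (cfg \<omega>) \<partial>sphere_prod d p))"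
    by (rule prod_sum_PiE) auto
  also have "\<dots> = (\<integral>\<omega>. (\<Sum>g\<in>PiE {..<k} (\<lambda>_. {..<N}). (\<Prod>i<k. c (g i)) * T g \<omega>) \<partial>sphere_family d p k)"
    using iT by (simp add: Bochner_Integration.integral_sum prod.distrib eT)
  finally show "(\<integral>\<omega>. (\<Prod>i<k. word_tr d (cfg (column i \<omega>)) s) \<partial>sphere_family d p k) = word_expect d p [s] ^ k"
    unfolding eq ..
qed

section \<open>Positivity and reduction rules for expectations of words\<close>

definition wexp :: "nat \<Rightarrow> nat \<Rightarrow> nat list list \<Rightarrow> real" where
  "wexp d p ws = Re (word_expect d p ws)"

context
  fixes d p :: nat
  assumes d: "d \<ge> 1"
begin

text \<open>The loop equation has nonnegative coefficients and smaller arguments. Letters are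
  counted twice in the induction measure because splitting a trace loses one letter but gains one
  word; an empty word is a factor d.\<close>

lemma word_expect_nonneg:
  assumes "letters ws \<subseteq> {..<p}"
  shows "word_expect d p ws \<in> \<real> \<and> 0 \<le> Re (word_expect d p ws)"
  using assms
proof (induction "2 * (\<Sum>w\<leftarrow>ws. length w) + length ws" arbitrary: ws rule: less_induct)
  case less
  show ?case
  proof (cases ws)
    case Nil
    interpret prob_space "sphere_prod d p"
      unfolding sphere_prod_def by (intro prob_space_PiM prob_space_unif_sphere d)
    show ?thesis using Nil by (simp add: word_expect_def prob_space)
  next
    case (Cons w R)
    show ?thesis
    proof (cases w)
      case Nil
      have "word_expect d p ws = of_nat d * word_expect d p R"
        unfolding Cons Nil word_expect_def by simp
      moreover have "word_expect d p R \<in> \<real> \<and> 0 \<le> Re (word_expect d p R)"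
        by (rule less.hyps) (use less.prems Cons in auto)
      ultimately show ?thesis by simp
    next
      case w: (Cons a u)
      define B where "B = real d + real (count_list u a + (\<Sum>w\<leftarrow>R. count_list w a))"
      have B: "B > 0" using d by (simp add: B_def)
      have lt: "a < p" "set u \<subseteq> {..<p}" "letters R \<subseteq> {..<p}" using less.prems Cons w by auto
      define X where "X = (\<lambda>z :: complex. z \<in> \<real> \<and> 0 \<le> Re z)"
      have Xs: "X (sum f S)" if "\<And>i. i \<in> S \<Longrightarrow> X (f i)" for f and S :: "nat set"
        using that by (auto simp: X_def intro!: sum_nonneg sum_in_Reals)
      have Xif: "X (if P then z else 0)" if "P \<Longrightarrow> X z" for P z
        using that by (auto simp: X_def)
      have Xa: "X (y + z)" if "X y" "X z" for y z
        using that by (auto simp: X_def)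
      have IH: "X (word_expect d p ws')" if "2 * (\<Sum>w\<leftarrow>ws'. length w) + length ws' <
          2 * (\<Sum>w\<leftarrow>(a # u) # R. length w) + length ((a # u) # R)" "letters ws' \<subseteq> {..<p}" for ws'
        using less.hyps[of ws'] that unfolding X_def Cons w by simp
      have "X (of_real B * word_expect d p ws)"
        unfolding Cons w B_def of_real_add of_real_of_nat_eq loop_equation[OF d lt] loop_sum_def
      proof (intro Xa Xs Xif IH)
        fix m n assume m: "m \<in> {..<length R}" and n: "n \<in> {..<length (R ! m)}" "R ! m ! n = a"
        have "(\<Sum>w\<leftarrow>R. length w) = length (R ! m) + (\<Sum>w\<leftarrow>remove_nth m R. length w)"
          using m by (intro sum_list_remove_nth) auto
        thus "2 * (\<Sum>w\<leftarrow>(a # u @ open_at n (R ! m)) # remove_nth m R. length w) + length ((a # u @ open_at n (R ! m)) # remove_nth m R)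
          < 2 * (\<Sum>w\<leftarrow>(a # u) # R. length w) + length ((a # u) # R)"
          using m n length_open_at[of n "R ! m"] by (simp add: length_remove_nth)
        show "letters ((a # u @ open_at n (R ! m)) # remove_nth m R) \<subseteq> {..<p}"
          using lt m n by (subst letters_merge) auto
      next
        fix n assume n: "n \<in> {..<length u}" "u ! n = a"
        show "letters ((a # take n u) # drop (Suc n) u # R) \<subseteq> {..<p}"
          using lt n by (subst letters_split) auto
      qed (use lt in auto)
      then obtain r where r: "of_real B * word_expect d p ws = of_real r" "r \<ge> 0"
        unfolding X_def by (metis Re_complex_of_real Reals_cases)
      hence "word_expect d p ws = of_real (r / B)" using B by (simp add: field_simps)
      thus ?thesis using r B by simp
    qed
  qed
qed

lemma wexp_nonneg: "letters ws \<subseteq> {..<p} \<Longrightarrow> 0 \<le> wexp d p ws"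
  using word_expect_nonneg by (simp add: wexp_def)

lemma word_expect_eq_wexp: "letters ws \<subseteq> {..<p} \<Longrightarrow> word_expect d p ws = of_real (wexp d p ws)"
  using word_expect_nonneg by (simp add: wexp_def)

lemma expected_trace_words: "expected_trace d k p m = (\<Sum>s\<in>words p m. wexp d p [s] ^ k)"
proof -
  have "expected_trace d k p m = Re (\<integral>\<omega>. mat_trace (tidx d k) (mat_pow (tidx d k) (Mmat p k \<omega>) m) \<partial>sphere_family d p k)"
    unfolding expected_trace_def trace_words
    by (rule integral_Re) (intro Bochner_Integration.integrable_sum integral_columns d, simp add: words_def)
  also have "\<dots> = (\<Sum>s\<in>words p m. Re (word_expect d p [s] ^ k))"
    unfolding trace_words
    by (subst Bochner_Integration.integral_sum) (auto simp: integral_columns[OF d] words_def)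
  also have "\<dots> = (\<Sum>s\<in>words p m. wexp d p [s] ^ k)"
    by (rule sum.cong) (auto simp: word_expect_eq_wexp words_def simp flip: of_real_power)
  finally show ?thesis .
qed

lemma wexp_Nil [simp]: "wexp d p [] = 1"
proof -
  interpret prob_space "sphere_prod d p"
    unfolding sphere_prod_def by (intro prob_space_PiM prob_space_unif_sphere d)
  show ?thesis by (simp add: wexp_def word_expect_def prob_space)
qed

lemma wexp_Nil_Cons [simp]: "wexp d p ([] # R) = real d * wexp d p R"
  by (simp add: wexp_def word_expect_def)

lemma wexp_rotate: "wexp d p ((u @ w) # R) = wexp d p ((w @ u) # R)"
  unfolding wexp_def word_expect_def words_tr_Cons word_tr_commute[of _ _ u w] ..

lemma wexp_mset: "mset ws = mset ws' \<Longrightarrow> wexp d p ws = wexp d p ws'"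
proof -
  assume m: "mset ws = mset ws'"
  have "words_tr d x ws = words_tr d x ws'" for x
    unfolding words_tr_def by (metis m mset_map prod_mset_prod_list)
  thus ?thesis by (simp add: wexp_def word_expect_def)
qed

lemma wexp_loop:
  assumes "a < p" "set u \<subseteq> {..<p}" "letters R \<subseteq> {..<p}"
  shows "(real d + real (count_list u a + (\<Sum>w\<leftarrow>R. count_list w a))) * wexp d p ((a # u) # R) = loop_sum (wexp d p) a u R"
proof -
  have "Re ((of_nat d + of_nat n) * z) = (real d + real n) * Re z" for z n
    by (simp flip: of_nat_add)
  thus ?thesis
    using arg_cong[OF loop_equation[OF d assms], of Re] unfolding loop_sum_def
    by (simp only: wexp_def plus_complex.sel Re_sum if_distrib[of Re] zero_complex.sel cong: if_cong)
qed

text \<open>The mean of a random rank one projection is 1/d times the identity; in the loop equation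
  only the term that deletes the letter survives.\<close>

lemma wexp_single:
  assumes "a < p" "set u \<subseteq> {..<p}" "letters R \<subseteq> {..<p}" "a \<notin> set u" "a \<notin> letters R"
  shows "real d * wexp d p ((a # u) # R) = wexp d p (u # R)"
proof -
  have 1: "count_list w a = 0" if "w \<in> set R" for w
    using assms(5) that by (auto simp: letters_def count_list_0_iff)
  have 2: "(\<Sum>w\<leftarrow>R. count_list w a) = 0" using 1 by (simp add: sum_list_eq_0_iff)
  have 3: "R ! m ! n \<noteq> a" if "m < length R" "n < length (R ! m)" for m n
    using letters_nth[OF that(1)] that(2) assms(5) by (metis nth_mem subsetD)
  have 4: "u ! n \<noteq> a" if "n < length u" for n using assms(4) that nth_mem by metis
  show ?thesis using wexp_loop[OF assms(1-3)] assms(4)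
    by (simp add: loop_sum_def 2 3 4 count_list_0_iff)
qed

text \<open>Rank one projections are idempotent because their vectors have norm 1 almost
  surely.\<close>

lemma wexp_repeat:
  assumes "a < p" "set u \<subseteq> {..<p}" "letters R \<subseteq> {..<p}"
  shows "wexp d p ((a # a # u) # R) = wexp d p ((a # u) # R)"
proof -
  have "AE \<omega> in sphere_prod d p. sqnorm d (\<omega> a) = 1"
    unfolding sphere_prod_def
    by (rule AE_PiM_component[where P = "\<lambda>v. sqnorm d v = 1"]) (use assms prob_space_unif_sphere[OF d] AE_unif_sphere[OF d] in auto)
  hence ae: "AE \<omega> in sphere_prod d p. words_tr d (cfg \<omega>) ((a # a # u) # R) = words_tr d (cfg \<omega>) ((a # u) # R)"
  proof eventually_elim
    case (elim \<omega>)
    have "(\<Sum>l<d. cnj (\<omega> a l) * (\<omega> a l * z)) = z" for z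
    proof -
      have "(\<Sum>l<d. cnj (\<omega> a l) * (\<omega> a l * z)) = (\<Sum>l<d. of_real ((cmod (\<omega> a l))\<^sup>2) * z)"
      proof (rule sum.cong[OF refl])
        fix l
        show "cnj (\<omega> a l) * (\<omega> a l * z) = of_real ((cmod (\<omega> a l))\<^sup>2) * z"
          using complex_norm_square[of "\<omega> a l"] by (simp add: mult_ac)
      qed
      also have "\<dots> = of_real (sqnorm d (\<omega> a)) * z"
        by (simp add: sqnorm_def sum_distrib_right)
      finally show ?thesis using elim by simp
    qed
    hence eqm: "word_mat d (cfg \<omega>) (a # a # u) i j = word_mat d (cfg \<omega>) (a # u) i j" for i j
      by (simp add: cfg_def)
    show ?case by (simp only: words_tr_Cons word_tr_def eqm)
  qed
  have "(\<integral>\<omega>. words_tr d (cfg \<omega>) ((a # a # u) # R) \<partial>sphere_prod d p) = (\<integral>\<omega>. words_tr d (cfg \<omega>) ((a # u) # R) \<partial>sphere_prod d p)"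
  proof (rule integral_cong_AE[OF _ _ ae])
    show "(\<lambda>\<omega>. words_tr d (cfg \<omega>) ((a # a # u) # R)) \<in> borel_measurable (sphere_prod d p)"
      "(\<lambda>\<omega>. words_tr d (cfg \<omega>) ((a # u) # R)) \<in> borel_measurable (sphere_prod d p)"
      by (intro borel_measurable_integrable integrable_words_tr[OF d]; use assms in \<open>auto simp: letters_iff\<close>)+
  qed
  thus ?thesis by (simp add: wexp_def word_expect_def)
qed

end

section \<open>Sums over words\<close>

lemma loop_sum_distrib: "(c :: real) * loop_sum F a u R = loop_sum (\<lambda>ws. c * F ws) a u R"
  by (simp add: loop_sum_def distrib_left sum_distrib_left if_distrib[of "\<lambda>z. _ * z"] cong: if_cong)

lemma sum_count_list:
  "(\<Sum>n<length w. if w ! n = a then c else 0) = of_nat (count_list w a) * (c :: real)"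
  by (induction w) (simp_all add: sum.lessThan_Suc_shift algebra_simps del: sum.lessThan_Suc)

lemma sum_list_nth_real:
  "(\<Sum>m<length R. f (R ! m)) = (\<Sum>w\<leftarrow>R. f w :: real)"
  by (simp add: sum_list_sum_nth atLeast0LessThan)

text \<open>The part after an occurrence of \<open>a\<close> avoids \<open>a\<close> only for the
  last occurrence, which therefore is the only one to receive the value x.\<close>

lemma sum_last_occurrence:
  "(\<Sum>n<length u. if u ! n = a then (if a \<in> set (drop (Suc n) u) then 1 else x) else 0) =
    (if a \<in> set u then real (count_list u a) - 1 + x else 0)"
proof (induction u)
  case (Cons b u)
  have "count_list u a = 0" if "a \<notin> set u" using that by (simp add: count_list_0_iff)
  thus ?case using Cons
    by (auto simp: sum.lessThan_Suc_shift simp del: sum.lessThan_Suc cong: if_cong)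
qed simp

definition avoiding :: "'a \<Rightarrow> 'a list list \<Rightarrow> nat" where
  "avoiding a ws = length (filter (\<lambda>w. a \<notin> set w) ws)"

lemma avoiding_simps [simp]:
  "avoiding a [] = 0" "avoiding a (w # ws) = (if a \<in> set w then 0 else 1) + avoiding a ws"
  by (simp_all add: avoiding_def)

lemma avoiding_mset: "mset ws = mset ws' \<Longrightarrow> avoiding a ws = avoiding a ws'"
  unfolding avoiding_def by (metis mset_filter size_mset)

lemma avoiding_less: "a \<in> letters ws \<Longrightarrow> avoiding a ws < length ws"
  unfolding avoiding_def letters_def by (auto intro: length_filter_less)

lemma avoiding_all: "a \<notin> letters ws \<Longrightarrow> avoiding a ws = length ws"
  unfolding avoiding_def letters_def by (simp add: filter_id_conv)

context
  fixes d p :: nat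
  assumes d: "d \<ge> 1"
begin

lemma wexp_empty: "letters ws = {} \<Longrightarrow> wexp d p ws = real d ^ length ws"
  using d by (induction ws) auto

text \<open>Of the pairings of the first occurrence of \<open>a\<close>, exactly one splits off a trace without \<open>a\<close>,
  and it is the only one that gains a factor \<open>d\<close>.\<close>

lemma wexp_letter_bound:
  assumes "letters ws \<subseteq> {..<p}" "a \<in> letters ws"
  shows "real d ^ card (letters ws) * wexp d p ws \<le> real d ^ (avoiding a ws + 1)"
  using assms
proof (induction "\<Sum>w\<leftarrow>ws. length w" arbitrary: ws a rule: less_induct)
  case less
  obtain m where m: "m < length ws" "a \<in> set (ws ! m)"
  proof -
    obtain w where "w \<in> set ws" "a \<in> set w" using less.prems(2) by (auto simp: letters_def)
    thus ?thesis using that by (metis in_set_conv_nth)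
  qed
  obtain u1 u2 where u12: "ws ! m = u1 @ a # u2" using split_list[OF m(2)] by blast
  define u R where "u = u2 @ u1" and "R = remove_nth m ws"
  have ms: "mset ws = mset ((ws ! m) # R)" using mset_remove_nth[OF m(1)] by (simp add: R_def)
  have E: "wexp d p ws = wexp d p ((a # u) # R)"
    using wexp_mset[OF d ms] wexp_rotate[OF d, of p u1 "a # u2" R] by (simp add: u12 u_def)
  have L: "letters ws = letters ((a # u) # R)"
    using letters_mset[OF ms] by (auto simp: u12 u_def)
  have A: "avoiding a ws = avoiding a R"
    using avoiding_mset[OF ms] m(2) by simp
  have len: "(\<Sum>w\<leftarrow>ws. length w) = Suc (length u + (\<Sum>w\<leftarrow>R. length w))"
    using sum_list_remove_nth[OF m(1), of length] by (simp add: R_def u12 u_def)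
  have lt: "a < p" "set u \<subseteq> {..<p}" "letters R \<subseteq> {..<p}" using less.prems(1) unfolding L by auto
  define c where "c = count_list u a + (\<Sum>w\<leftarrow>R. count_list w a)"
  define n where "n = avoiding a R"
  define l where "l = card (letters ws)"
  have d0: "real d \<ge> 1" using d by simp
  show ?case
  proof (cases "a \<in> letters (u # R)")
    case False
    have eq: "real d * wexp d p ((a # u) # R) = wexp d p (u # R)"
      using wexp_single[OF d lt] False by simp
    have n: "n = length R" using False unfolding n_def by (intro avoiding_all) simp
    have l: "l = Suc (card (letters (u # R)))"
    proof -
      have "letters ws = insert a (letters (u # R))" unfolding L by auto
      thus ?thesis unfolding l_def using card_insert_disjoint[OF finite_letters False] by (simp only:)
    qed
    \<comment> \<open>The n + 1 remaining words either contain no letter at all, with value d^(n+1),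
      or the bound applies to some other letter, which at most n of them avoid.\<close>
    have "real d ^ card (letters (u # R)) * wexp d p (u # R) \<le> real d ^ (n + 1)"
    proof (cases "letters (u # R) = {}")
      case True
      thus ?thesis unfolding n using wexp_empty[OF True] by simp
    next
      case nonempty: False
      then obtain a' where a': "a' \<in> letters (u # R)" by blast
      have "real d ^ card (letters (u # R)) * wexp d p (u # R) \<le> real d ^ (avoiding a' (u # R) + 1)"
        by (rule less.hyps) (use len a' lt in auto)
      also have "\<dots> \<le> real d ^ (n + 1)"
        using avoiding_less[OF a'] d0 n by (intro power_increasing) auto
      finally show ?thesis .
    qed
    hence "real d ^ card (letters (u # R)) * (real d * wexp d p ((a # u) # R)) \<le> real d ^ (n + 1)"
      unfolding eq .
    thus ?thesis unfolding E A l_def[symmetric] n_def[symmetric] l by (simp only: power_Suc mult_ac)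
  next
    case True
    have L': "letters (u # R) = letters ws" using True unfolding L by auto
    define D where "D = real d ^ (n + 1)"
    have D0: "D \<ge> 0" by (simp add: D_def)
    have T0: "real d ^ l * wexp d p (u # R) \<le> D * (if a \<in> set u then 1 else real d)"
    proof -
      have "real d ^ card (letters (u # R)) * wexp d p (u # R) \<le> real d ^ (avoiding a (u # R) + 1)"
        by (rule less.hyps) (use len True lt in auto)
      thus ?thesis unfolding L' l_def by (auto simp: n_def D_def mult_ac)
    qed
    have T1: "real d ^ l * wexp d p ((a # take i u) # drop (Suc i) u # R) \<le>
        D * (if a \<in> set (drop (Suc i) u) then 1 else real d)" if i: "i < length u" "u ! i = a" for i
    proof -
      note L'' = letters_split[OF i, of R, folded L]
      have "real d ^ card (letters ((a # take i u) # drop (Suc i) u # R)) * wexp d p ((a # take i u) # drop (Suc i) u # R)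
        \<le> real d ^ (avoiding a ((a # take i u) # drop (Suc i) u # R) + 1)"
        by (rule less.hyps) (use len i L'' less.prems in auto)
      thus ?thesis unfolding L'' l_def by (auto simp: n_def D_def mult_ac)
    qed
    have T2: "real d ^ l * wexp d p ((a # u @ open_at j (R ! i)) # remove_nth i R) \<le> D"
      if i: "i < length R" and j: "j < length (R ! i)" "R ! i ! j = a" for i j
    proof -
      note L'' = letters_merge[OF i j, of u, folded L]
      have av: "avoiding a R = avoiding a (remove_nth i R)"
        using avoiding_mset[of R "R ! i # remove_nth i R" a] mset_remove_nth[OF i] nth_mem[OF j(1)] j(2) by simp
      have "(\<Sum>w\<leftarrow>R. length w) = length (R ! i) + (\<Sum>w\<leftarrow>remove_nth i R. length w)"
        by (rule sum_list_remove_nth[OF i])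
      hence "real d ^ card (letters ((a # u @ open_at j (R ! i)) # remove_nth i R)) *
        wexp d p ((a # u @ open_at j (R ! i)) # remove_nth i R)
        \<le> real d ^ (avoiding a ((a # u @ open_at j (R ! i)) # remove_nth i R) + 1)"
        by (intro less.hyps) (use len j L'' less.prems length_open_at[OF j(1)] in auto)
      thus ?thesis unfolding L'' l_def by (simp add: n_def D_def av)
    qed
    have "(real d + real c) * (real d ^ l * wexp d p ws) = real d ^ l * loop_sum (wexp d p) a u R"
      unfolding c_def wexp_loop[OF d lt, symmetric] E by (simp add: mult_ac)
    also have "\<dots> = loop_sum (\<lambda>ws. real d ^ l * wexp d p ws) a u R"
      by (rule loop_sum_distrib)
    also have "\<dots> \<le> D * (if a \<in> set u then 1 else real d) +
      (\<Sum>i<length u. if u ! i = a then D * (if a \<in> set (drop (Suc i) u) then 1 else real d) else 0) +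
      (\<Sum>i<length R. \<Sum>j<length (R ! i). if R ! i ! j = a then D else 0)"
      unfolding loop_sum_def by (intro add_mono sum_mono) (use T0 T1 T2 in auto)
    also have "(\<Sum>i<length u. if u ! i = a then D * (if a \<in> set (drop (Suc i) u) then 1 else real d) else 0) =
      D * (if a \<in> set u then real (count_list u a) - 1 + real d else 0)"
      unfolding sum_last_occurrence[symmetric] sum_distrib_left by (intro sum.cong) auto
    also have "(\<Sum>i<length R. \<Sum>j<length (R ! i). if R ! i ! j = a then D else 0) = D * real (\<Sum>w\<leftarrow>R. count_list w a)"
      unfolding sum_count_list sum_list_nth_real[of "\<lambda>w. real (count_list w a) * D"]
      by (induction R) (simp_all add: algebra_simps)
    \<comment> \<open>The bounds add up to exactly d + c times D. The single factor d comes from the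
      last \<open>a\<close> in \<open>u\<close> if there is one, and from the deletion of the
      leading letter otherwise; all other pairings count 1.\<close>
    also have "D * (if a \<in> set u then 1 else real d) + D * (if a \<in> set u then real (count_list u a) - 1 + real d else 0) +
        D * real (\<Sum>w\<leftarrow>R. count_list w a) = (real d + real c) * D"
      by (auto simp: c_def algebra_simps count_list_0_iff)
    finally have "(real d + real c) * (real d ^ l * wexp d p ws) \<le> (real d + real c) * D" .
    moreover have "real d + real c > 0" using d by simp
    ultimately have "real d ^ l * wexp d p ws \<le> D" by simp
    thus ?thesis by (simp add: l_def D_def n_def A)
  qed
qed

lemma wexp_le:
  assumes "set s \<subseteq> {..<p}" "s \<noteq> []"
  shows "wexp d p [s] \<le> real d / real d ^ card (set s)"
proof -
  have "real d ^ card (letters [s]) * wexp d p [s] \<le> real d ^ (avoiding (hd s) [s] + 1)"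
    by (rule wexp_letter_bound) (use assms in auto)
  thus ?thesis using assms d by (simp add: field_simps)
qed

end

section \<open>Weighted sums over lists of words of prescribed lengths\<close>

definition word_lists :: "nat \<Rightarrow> nat list \<Rightarrow> nat list list set" where
  "word_lists p ns = {ws. map length ws = ns \<and> letters ws \<subseteq> {..<p}}"

lemma word_lists_Nil [simp]: "word_lists p [] = {[]}"
  by (auto simp: word_lists_def)

lemma word_lists_Cons: "word_lists p (n # ns) = (\<lambda>(w, R). w # R) ` (words p n \<times> word_lists p ns)"
  by (auto simp: word_lists_def words_def image_iff)

lemma finite_word_lists [simp]: "finite (word_lists p ns)"
  by (induction ns) (simp_all add: word_lists_Cons)

lemma sum_word_lists_Cons:
  "(\<Sum>ws\<in>word_lists p (n # ns). f ws) = (\<Sum>w\<in>words p n. \<Sum>R\<in>word_lists p ns. f (w # R))"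
proof -
  have "inj_on (\<lambda>(w, R). w # R) (words p n \<times> word_lists p ns)" by (auto simp: inj_on_def)
  thus ?thesis by (simp add: word_lists_Cons sum.reindex sum.cartesian_product case_prod_unfold)
qed

lemma sum_inj_le:
  fixes g :: "'b \<Rightarrow> real"
  assumes "finite B" "inj_on h A" "h ` A \<subseteq> B" "\<And>x. x \<in> B \<Longrightarrow> 0 \<le> g x"
  shows "(\<Sum>x\<in>A. g (h x)) \<le> (\<Sum>y\<in>B. g y)"
proof -
  have "(\<Sum>x\<in>A. g (h x)) = (\<Sum>y\<in>h ` A. g y)" using assms by (simp add: sum.reindex)
  also have "\<dots> \<le> (\<Sum>y\<in>B. g y)" using assms by (intro sum_mono2) auto
  finally show ?thesis .
qed

lemma remove_nth_inject:
  assumes "length R = length R'" "m < length R" "remove_nth m R = remove_nth m R'" "R ! m = R' ! m"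
  shows "R = R'"
proof -
  have "take m R = take m R' \<and> drop (Suc m) R = drop (Suc m) R'"
    using assms unfolding remove_nth_def by (simp add: append_eq_append_conv)
  thus ?thesis using assms by (metis id_take_nth_drop)
qed

lemma open_at_inject:
  assumes "length r = length r'" "j < length r" "r ! j = r' ! j" "open_at j r = open_at j r'"
  shows "r = r'"
proof -
  have "take j r = take j r' \<and> drop (Suc j) r = drop (Suc j) r'"
    using assms by (simp add: open_at_def append_eq_append_conv)
  thus ?thesis using assms by (metis id_take_nth_drop)
qed

context
  fixes d p :: nat and q :: real
  assumes d: "d \<ge> 1" and q: "q \<ge> 0"
begin

text \<open>Later q is d^(1-k), the price of a distinct letter in the k - 1 tensor factors that are
  estimated by \<open>wexp_le\<close>.\<close>

definition wsum :: "nat list \<Rightarrow> real" where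
  "wsum ns = (\<Sum>ws\<in>word_lists p ns. q ^ card (letters ws) * wexp d p ws)"

lemma wsum_term_nonneg: "ws \<in> word_lists p ns \<Longrightarrow> 0 \<le> q ^ card (letters ws) * wexp d p ws"
  using q wexp_nonneg[OF d] by (simp add: word_lists_def)

lemma wsum_Nil [simp]: "wsum [] = 1"
  using d by (simp add: wsum_def)

lemma wsum_0_Cons: "wsum (0 # ns) = real d * wsum ns"
  using d unfolding wsum_def by (simp add: sum_word_lists_Cons sum_distrib_left mult_ac)

lemma card_letters_le: "card (letters ws) \<le> (\<Sum>w\<leftarrow>ws. length w)"
proof (induction ws)
  case (Cons w ws)
  have "card (letters (w # ws)) \<le> card (set w) + card (letters ws)" by (simp add: card_Un_le)
  also have "card (set w) \<le> length w" by (rule card_length)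
  finally show ?case using Cons by simp
qed simp

text \<open>The loop equation summed over all words, the leading letter included. The number of
  further occurrences on the left is dropped by positivity. When the leading letter is deleted, the
  sum over it gives at most p q from new letters, plus 1 for each letter already present, of which
  there are at most n + \<open>sum_list ns\<close>. When it splits or merges, it is determined by
  the position of its partner.\<close>

lemma wsum_recursion:
  "real d * wsum (Suc n # ns) \<le> (real p * q + real (n + sum_list ns)) * wsum (n # ns) +
    (\<Sum>j<n. wsum (Suc j # (n - 1 - j) # ns)) +
    (\<Sum>m<length ns. real (ns ! m) * wsum ((n + ns ! m) # remove_nth m ns))"
proof -
  define f where "f ws = q ^ card (letters ws) * wexp d p ws" for ws
  define G where "G a u R = q ^ card (letters ((a # u) # R))" for a and u :: "nat list" and R
  define W where "W = word_lists p ns"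
  define T1 where "T1 a u R = (\<Sum>j<length u. if u ! j = a then f ((a # take j u) # drop (Suc j) u # R) else 0)" for a u R
  define T2 where "T2 a u R = (\<Sum>m<length R. \<Sum>j<length (R ! m). if R ! m ! j = a
       then f ((a # u @ open_at j (R ! m)) # remove_nth m R) else 0)" for a u R
  have step: "real d * f ((a # u) # R) \<le> G a u R * wexp d p (u # R) + T1 a u R + T2 a u R"
    if "a < p" "u \<in> words p n" "R \<in> W" for a u R
  proof -
    have lt: "a < p" "set u \<subseteq> {..<p}" "letters R \<subseteq> {..<p}"
      using that by (auto simp: words_def W_def word_lists_def)
    define c where "c = count_list u a + (\<Sum>w\<leftarrow>R. count_list w a)"
    have "0 \<le> wexp d p ((a # u) # R)" by (rule wexp_nonneg[OF d]) (use lt in auto)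
    hence "real d * wexp d p ((a # u) # R) \<le> (real d + real c) * wexp d p ((a # u) # R)"
      by (intro mult_right_mono) auto
    moreover have "0 \<le> G a u R" using q by (simp add: G_def)
    ultimately have "G a u R * (real d * wexp d p ((a # u) # R)) \<le> G a u R * ((real d + real c) * wexp d p ((a # u) # R))"
      by (rule mult_left_mono)
    hence "real d * f ((a # u) # R) \<le> G a u R * ((real d + real c) * wexp d p ((a # u) # R))"
      by (simp only: f_def G_def mult.left_commute)
    also have "\<dots> = loop_sum (\<lambda>ws. G a u R * wexp d p ws) a u R"
      unfolding c_def wexp_loop[OF d lt] by (rule loop_sum_distrib)
    also have "\<dots> = G a u R * wexp d p (u # R) + T1 a u R + T2 a u R"
      unfolding T1_def T2_def f_def G_def loop_sum_def
      by (intro arg_cong2[where f = "(+)"] sum.cong if_cong refl) (auto simp only: letters_split letters_merge lessThan_iff)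
    finally show ?thesis .
  qed
  have "real d * wsum (Suc n # ns) = (\<Sum>a<p. \<Sum>u\<in>words p n. \<Sum>R\<in>W. real d * f ((a # u) # R))"
    unfolding wsum_def f_def[symmetric] sum_word_lists_Cons sum_words_Cons W_def by (simp add: sum_distrib_left)
  also have "\<dots> \<le> (\<Sum>a<p. \<Sum>u\<in>words p n. \<Sum>R\<in>W. G a u R * wexp d p (u # R) + T1 a u R + T2 a u R)"
    by (intro sum_mono step) auto
  also have "\<dots> = (\<Sum>a<p. \<Sum>u\<in>words p n. \<Sum>R\<in>W. G a u R * wexp d p (u # R)) +
     (\<Sum>a<p. \<Sum>u\<in>words p n. \<Sum>R\<in>W. T1 a u R) + (\<Sum>a<p. \<Sum>u\<in>words p n. \<Sum>R\<in>W. T2 a u R)"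
    by (simp add: sum.distrib)
  also have "(\<Sum>a<p. \<Sum>u\<in>words p n. \<Sum>R\<in>W. G a u R * wexp d p (u # R)) \<le>
      (real p * q + real (n + sum_list ns)) * wsum (n # ns)"
  proof -
    have "(\<Sum>a<p. \<Sum>u\<in>words p n. \<Sum>R\<in>W. G a u R * wexp d p (u # R)) =
        (\<Sum>u\<in>words p n. \<Sum>R\<in>W. (\<Sum>a<p. G a u R) * wexp d p (u # R))"
      by (subst sum.swap, intro sum.cong refl, subst sum.swap) (simp add: sum_distrib_right)
    also have "\<dots> \<le> (\<Sum>u\<in>words p n. \<Sum>R\<in>W. (real p * q + real (n + sum_list ns)) * f (u # R))"
    proof (intro sum_mono)
      fix u R assume u: "u \<in> words p n" "R \<in> W"
      hence lt: "letters (u # R) \<subseteq> {..<p}" and lens: "length u = n" "map length R = ns"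
        by (auto simp: words_def W_def word_lists_def)
      have "(\<Sum>a<p. G a u R) \<le> (\<Sum>a<p. q * q ^ card (letters (u # R)) + (if a \<in> letters (u # R) then q ^ card (letters (u # R)) else 0))"
      proof (intro sum_mono)
        fix a
        have *: "letters ((a # u) # R) = insert a (letters (u # R))" by auto
        show "G a u R \<le> q * q ^ card (letters (u # R)) + (if a \<in> letters (u # R) then q ^ card (letters (u # R)) else 0)"
          unfolding G_def * using q
          by (cases "a \<in> letters (u # R)") (simp_all only: insert_absorb card_insert_disjoint finite_letters not_False_eq_True if_True if_False power_Suc, simp_all)
      qed
      also have "\<dots> = real p * q * q ^ card (letters (u # R)) + real (card (letters (u # R))) * q ^ card (letters (u # R))"
      proof -
        have "{..<p} \<inter> letters (u # R) = letters (u # R)" using lt by auto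
        thus ?thesis by (simp only: sum.distrib sum.If_cases[OF finite_lessThan] Int_def[symmetric] Collect_mem_eq) (simp add: sum.inter_restrict[symmetric])
      qed
      also have "\<dots> \<le> (real p * q + real (n + sum_list ns)) * q ^ card (letters (u # R))"
      proof -
        have "card (letters (u # R)) \<le> n + sum_list ns" using card_letters_le[of "u # R"] lens by simp
        hence "real (card (letters (u # R))) * q ^ card (letters (u # R)) \<le> real (n + sum_list ns) * q ^ card (letters (u # R))"
          using q by (intro mult_right_mono) (auto simp del: of_nat_add)
        thus ?thesis by (simp only: distrib_right)
      qed
      finally show "(\<Sum>a<p. G a u R) * wexp d p (u # R) \<le> (real p * q + real (n + sum_list ns)) * f (u # R)"
        unfolding f_def mult.assoc[symmetric] using wexp_nonneg[OF d lt] by (intro mult_right_mono)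
    qed
    also have "\<dots> = (real p * q + real (n + sum_list ns)) * wsum (n # ns)"
      unfolding wsum_def f_def[symmetric] sum_word_lists_Cons W_def by (simp add: sum_distrib_left)
    finally show ?thesis .
  qed
  also have "(\<Sum>a<p. \<Sum>u\<in>words p n. \<Sum>R\<in>W. T1 a u R) \<le> (\<Sum>j<n. wsum (Suc j # (n - 1 - j) # ns))"
  proof -
    have "(\<Sum>a<p. \<Sum>u\<in>words p n. \<Sum>R\<in>W. T1 a u R) =
        (\<Sum>a<p. \<Sum>u\<in>words p n. \<Sum>R\<in>W. \<Sum>j<n. if u ! j = a then f ((a # take j u) # drop (Suc j) u # R) else 0)"
      unfolding T1_def by (intro sum.cong refl) (auto simp: words_def)
    also have "\<dots> = (\<Sum>u\<in>words p n. \<Sum>R\<in>W. \<Sum>j<n. \<Sum>a<p. if u ! j = a then f ((a # take j u) # drop (Suc j) u # R) else 0)"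
      by (subst sum.swap, rule sum.cong[OF refl], subst sum.swap, rule sum.cong[OF refl], rule sum.swap)
    also have "\<dots> = (\<Sum>u\<in>words p n. \<Sum>R\<in>W. \<Sum>j<n. f ((u ! j # take j u) # drop (Suc j) u # R))"
      by (intro sum.cong refl) (auto simp: words_def subset_iff)
    also have "\<dots> = (\<Sum>j<n. \<Sum>(u, R)\<in>words p n \<times> W. f ((u ! j # take j u) # drop (Suc j) u # R))"
      by (simp add: sum.cartesian_product[symmetric]) (subst sum.swap[of _ _ "{..<n}"], intro sum.cong refl sum.swap)
    also have "\<dots> \<le> (\<Sum>j<n. wsum (Suc j # (n - 1 - j) # ns))"
    proof (intro sum_mono)
      fix j assume "j \<in> {..<n}" hence j: "j < n" by simp
      define h where "h = (\<lambda>(u :: nat list, R). (u ! j # take j u) # drop (Suc j) u # R)"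
      have "(\<Sum>(u, R)\<in>words p n \<times> W. f ((u ! j # take j u) # drop (Suc j) u # R)) = (\<Sum>z\<in>words p n \<times> W. f (h z))"
        by (simp add: h_def case_prod_unfold)
      also have "\<dots> \<le> (\<Sum>ws\<in>word_lists p (Suc j # (n - 1 - j) # ns). f ws)"
      proof (rule sum_inj_le)
        \<comment> \<open>The two pieces have known lengths, and the letter removed by the cut is
          the first letter of the new word.\<close>
        show "inj_on h (words p n \<times> W)"
          unfolding inj_on_def h_def
          by (auto simp: words_def) (metis id_take_nth_drop j)
        show "h ` (words p n \<times> W) \<subseteq> word_lists p (Suc j # (n - 1 - j) # ns)"
          using j by (auto simp: h_def words_def W_def word_lists_def subset_iff) (meson in_set_takeD in_set_dropD)+
        show "0 \<le> f ws" if "ws \<in> word_lists p (Suc j # (n - 1 - j) # ns)" for ws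
          using wsum_term_nonneg[OF that] by (simp add: f_def)
      qed simp
      also have "\<dots> = wsum (Suc j # (n - 1 - j) # ns)" by (simp add: wsum_def f_def)
      finally show "(\<Sum>(u, R)\<in>words p n \<times> W. f ((u ! j # take j u) # drop (Suc j) u # R)) \<le> wsum (Suc j # (n - 1 - j) # ns)" .
    qed
    finally show ?thesis .
  qed
  also have "(\<Sum>a<p. \<Sum>u\<in>words p n. \<Sum>R\<in>W. T2 a u R) \<le> (\<Sum>m<length ns. real (ns ! m) * wsum ((n + ns ! m) # remove_nth m ns))"
  proof -
    define g where "g m j u R = f ((R ! m ! j # u @ open_at j (R ! m)) # remove_nth m R)"
      for m j :: nat and u R
    have lenR: "length R = length ns" "m < length ns \<Longrightarrow> length (R ! m) = ns ! m" if "R \<in> W" for R m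
      using that by (auto simp: W_def word_lists_def)
    have "(\<Sum>a<p. \<Sum>u\<in>words p n. \<Sum>R\<in>W. T2 a u R) = (\<Sum>u\<in>words p n. \<Sum>R\<in>W. \<Sum>a<p. T2 a u R)"
      by (subst sum.swap, rule sum.cong[OF refl], rule sum.swap)
    also have "\<dots> = (\<Sum>u\<in>words p n. \<Sum>R\<in>W. \<Sum>m<length ns. \<Sum>j<ns ! m. g m j u R)"
    proof (rule sum.cong[OF refl], rule sum.cong[OF refl])
      fix u R assume u: "u \<in> words p n" "R \<in> W"
      have "(\<Sum>a<p. T2 a u R) = (\<Sum>m<length R. \<Sum>j<length (R ! m). \<Sum>a<p. if R ! m ! j = a
       then f ((a # u @ open_at j (R ! m)) # remove_nth m R) else 0)"
        unfolding T2_def by (subst sum.swap, rule sum.cong[OF refl], rule sum.swap)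
      also have "\<dots> = (\<Sum>m<length R. \<Sum>j<length (R ! m). g m j u R)"
      proof (intro sum.cong refl)
        fix m j assume "m \<in> {..<length R}" "j \<in> {..<length (R ! m)}"
        hence "R ! m ! j \<in> letters R" using letters_nth[of m R] nth_mem by fastforce
        hence "R ! m ! j < p" using u by (auto simp: W_def word_lists_def)
        thus "(\<Sum>a<p. if R ! m ! j = a then f ((a # u @ open_at j (R ! m)) # remove_nth m R) else 0) = g m j u R"
          by (simp add: g_def)
      qed
      finally show "(\<Sum>a<p. T2 a u R) = (\<Sum>m<length ns. \<Sum>j<ns ! m. g m j u R)"
        using lenR[OF u(2)] by simp
    qed
    also have "\<dots> = (\<Sum>(u, R)\<in>words p n \<times> W. \<Sum>m<length ns. \<Sum>j<ns ! m. g m j u R)"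
      by (rule sum.cartesian_product)
    also have "\<dots> = (\<Sum>m<length ns. \<Sum>(u, R)\<in>words p n \<times> W. \<Sum>j<ns ! m. g m j u R)"
      unfolding case_prod_unfold by (rule sum.swap)
    also have "\<dots> = (\<Sum>m<length ns. \<Sum>j<ns ! m. \<Sum>(u, R)\<in>words p n \<times> W. g m j u R)"
      unfolding case_prod_unfold by (intro sum.cong refl sum.swap)
    also have "\<dots> \<le> (\<Sum>m<length ns. \<Sum>j<ns ! m. wsum ((n + ns ! m) # remove_nth m ns))"
    proof (intro sum_mono)
      fix m j assume "m \<in> {..<length ns}" "j \<in> {..<ns ! m}"
      hence m: "m < length ns" and j: "j < ns ! m" by auto
      define h where "h = (\<lambda>(u :: nat list, R). (R ! m ! j # u @ open_at j (R ! m)) # remove_nth m R)"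
      have "(\<Sum>(u, R)\<in>words p n \<times> W. g m j u R) = (\<Sum>z\<in>words p n \<times> W. f (h z))"
        by (simp add: h_def g_def case_prod_unfold)
      also have "\<dots> \<le> (\<Sum>ws\<in>word_lists p ((n + ns ! m) # remove_nth m ns). f ws)"
      proof (rule sum_inj_le)
        \<comment> \<open>All lengths are fixed, so the merged word determines \<open>u\<close> and,
          with its first letter, the word that was cut open; \<open>m\<close> tells where to put it
          back.\<close>
        show "inj_on h (words p n \<times> W)"
        proof (rule inj_onI, clarify)
          fix u R u' R' assume in': "u \<in> words p n" "R \<in> W" "u' \<in> words p n" "R' \<in> W" and eq: "h (u, R) = h (u', R')"
          have lu: "length u = length u'" using in' by (simp add: words_def)
          have lR: "length R = length R'" "m < length R" "length (R ! m) = length (R' ! m)" "j < length (R ! m)"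
            using lenR in' m j by auto
          have e: "R ! m ! j = R' ! m ! j" "u = u'" 
            "open_at j (R ! m) = open_at j (R' ! m)" "remove_nth m R = remove_nth m R'"
            using eq lu by (auto simp: h_def append_eq_append_conv)
          have "R ! m = R' ! m" by (rule open_at_inject[OF lR(3,4) e(1,3)])
          with e(4) lR have "R = R'" by (intro remove_nth_inject[of R R' m])
          thus "u = u' \<and> R = R'" using e by simp
        qed
        show "h ` (words p n \<times> W) \<subseteq> word_lists p ((n + ns ! m) # remove_nth m ns)"
        proof clarify
          fix u R assume uR: "u \<in> words p n" "R \<in> W"
          have j': "j < length (R ! m)" and m': "m < length R" using lenR[OF uR(2)] m j by auto
          have "letters (h (u, R)) = set u \<union> letters R"
            unfolding h_def using letters_merge[OF m' j' refl, of u] letters_nth[OF m'] nth_mem[OF j'] by auto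
          moreover have "map length (h (u, R)) = (n + ns ! m) # remove_nth m ns"
            using uR lenR[OF uR(2)] m j length_open_at[OF j']
            by (auto simp: h_def words_def W_def word_lists_def remove_nth_def take_map drop_map)
          ultimately show "h (u, R) \<in> word_lists p ((n + ns ! m) # remove_nth m ns)"
            using uR by (auto simp: word_lists_def words_def W_def)
        qed
        show "0 \<le> f ws" if "ws \<in> word_lists p ((n + ns ! m) # remove_nth m ns)" for ws
          using wsum_term_nonneg[OF that] by (simp add: f_def)
      qed simp
      also have "\<dots> = wsum ((n + ns ! m) # remove_nth m ns)" by (simp add: wsum_def f_def)
      finally show "(\<Sum>(u, R)\<in>words p n \<times> W. g m j u R) \<le> wsum ((n + ns ! m) # remove_nth m ns)" .
    qed
    finally show ?thesis by simp
  qed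
  finally show ?thesis by simp
qed

end

section \<open>The upper bound\<close>

text \<open>Absorption gives s N = n C^2 for the Narayana number N, C = (n-1) choose (l-1) and s = l
  (n - l + 1), where n \<le> s \<le> n^2. Squares of binomials are preferred below because the
  Vandermonde identity applies to them.\<close>

lemma narayana_le_square:
  assumes "n \<ge> 1" "l \<ge> 1" "l \<le> n"
  shows "narayana n l \<le> (real ((n - 1) choose (l - 1)))\<^sup>2"
    and "(real ((n - 1) choose (l - 1)))\<^sup>2 \<le> real n * narayana n l"
proof -
  define C where "C = real ((n - 1) choose (l - 1))"
  define N where "N = narayana n l"
  define s where "s = real l * (real n - real l + 1)"
  have 1: "real l * real (n choose l) = real n * C"
  proof -
    have "l * (n choose l) = n * ((n - 1) choose (l - 1))"
      using assms times_binomial_minus1_eq[of l n] by simp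
    thus ?thesis unfolding C_def by (metis of_nat_mult)
  qed
  have 2: "(real n - real l + 1) * real (n choose (l - 1)) = real n * C"
  proof -
    have "(n - (l - 1)) * (n choose (l - 1)) = n * ((n - 1) choose (l - 1))"
      by (rule binomial_absorb_comp)
    hence "real (n - (l - 1)) * real (n choose (l - 1)) = real n * C" unfolding C_def by (metis of_nat_mult)
    moreover have "real (n - (l - 1)) = real n - real l + 1" using assms by (simp add: of_nat_diff)
    ultimately show ?thesis by (simp only:)
  qed
  have "s * (real n * N) = (real l * real (n choose l)) * ((real n - real l + 1) * real (n choose (l - 1)))"
    using assms by (simp add: s_def N_def narayana_def)
  also have "\<dots> = real n * (real n * C\<^sup>2)" unfolding 1 2 by (simp add: power2_eq_square)
  finally have eq: "s * N = real n * C\<^sup>2" using assms by simp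
  have "0 \<le> (real l - 1) * (real n - real l)" using assms by (intro mult_nonneg_nonneg) auto
  hence s1: "real n \<le> s" by (simp add: s_def algebra_simps)
  have s2: "s \<le> real n * real n" unfolding s_def using assms by (intro mult_mono) auto
  have n0: "real n > 0" and N0: "N \<ge> 0" using assms by (simp_all add: N_def narayana_def)
  have "real n * N \<le> s * N" using s1 N0 by (intro mult_right_mono)
  hence "N \<le> C\<^sup>2" unfolding eq using n0 by simp
  thus "narayana n l \<le> (real ((n - 1) choose (l - 1)))\<^sup>2" by (simp add: N_def C_def)
  have "real n * C\<^sup>2 \<le> real n * (real n * N)" using s2 N0 unfolding eq[symmetric] mult.assoc[symmetric] by (intro mult_right_mono)
  thus "(real ((n - 1) choose (l - 1)))\<^sup>2 \<le> real n * narayana n l" using n0 by (simp add: N_def C_def)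
qed

text \<open>The Narayana polynomials of type B. Up to the factor x they agree with
  \<open>beta_poly a\<close> within a factor a, and they behave well under multiplication.\<close>

definition square_sum :: "real \<Rightarrow> nat \<Rightarrow> real" where
  "square_sum x a = (\<Sum>i<a. (real ((a - 1) choose i))\<^sup>2 * x ^ i)"

lemma beta_poly_shift: "beta_poly a x = (\<Sum>i<a. narayana a (Suc i) * x ^ Suc i)"
  unfolding beta_poly_def by (rule sum.reindex_bij_witness[of _ Suc "\<lambda>i. i - 1"]) auto

lemma beta_poly_square_sum:
  assumes "x \<ge> 0" "a \<ge> 1"
  shows "beta_poly a x \<le> x * square_sum x a" "x * square_sum x a \<le> real a * beta_poly a x"
proof -
  have "narayana a (Suc i) * x ^ Suc i \<le> x * ((real ((a - 1) choose i))\<^sup>2 * x ^ i)" if "i < a" for i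
    using mult_right_mono[OF narayana_le_square(1)[of a "Suc i"], of "x ^ Suc i"] that assms by (simp add: mult_ac)
  thus "beta_poly a x \<le> x * square_sum x a"
    unfolding beta_poly_shift square_sum_def sum_distrib_left by (intro sum_mono) auto
  have "x * ((real ((a - 1) choose i))\<^sup>2 * x ^ i) \<le> real a * (narayana a (Suc i) * x ^ Suc i)" if "i < a" for i
    using mult_right_mono[OF narayana_le_square(2)[of a "Suc i"], of "x ^ Suc i"] that assms by (simp add: mult_ac)
  thus "x * square_sum x a \<le> real a * beta_poly a x"
    unfolding beta_poly_shift square_sum_def sum_distrib_left by (intro sum_mono) auto
qed

text \<open>The Vandermonde identity writes a binomial of (a-1) + (b-1) as a sum of at most a
  nonzero products. By Cauchy-Schwarz its square is at most a times the sum of their squares, which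
  is the corresponding coefficient of the product.\<close>

lemma square_sum_submult:
  assumes "x \<ge> 0" "a \<ge> 1" "b \<ge> 1"
  shows "square_sum x (a + b - 1) \<le> real a * (square_sum x a * square_sum x b)"
proof -
  define f where "f i j = (real ((a - 1) choose i))\<^sup>2 * (real ((b - 1) choose j))\<^sup>2 * x ^ (i + j)" for i j
  have "(real ((a + b - 1 - 1) choose k))\<^sup>2 * x ^ k \<le> real a * (\<Sum>i\<le>k. f i (k - i))" for k
  proof -
    define g where "g i = real ((a - 1) choose i) * real ((b - 1) choose (k - i))" for i
    define I where "I = {..k} \<inter> {..<a}"
    have "(a + b - 1 - 1) choose k = (\<Sum>i\<le>k. ((a - 1) choose i) * ((b - 1) choose (k - i)))"
      using vandermonde[of "a - 1" "b - 1" k] assms by (simp add: algebra_simps)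
    hence "real ((a + b - 1 - 1) choose k) = (\<Sum>i\<le>k. g i)" by (simp add: g_def)
    also have "\<dots> = (\<Sum>i\<in>I. g i)"
      unfolding I_def by (rule sum.mono_neutral_right) (use assms in \<open>auto simp: g_def not_less intro!: binomial_eq_0\<close>)
    finally have "(real ((a + b - 1 - 1) choose k))\<^sup>2 = (\<Sum>i\<in>I. g i)\<^sup>2" by simp
    also have "\<dots> \<le> (\<Sum>i\<in>I. (g i)\<^sup>2) * real (card I)"
      using sum_squared_le_sum_of_squares[of g I] by (simp add: I_def)
    also have "\<dots> \<le> (\<Sum>i\<le>k. (g i)\<^sup>2) * real a"
    proof (intro mult_mono sum_mono2)
      show "real (card I) \<le> real a" unfolding I_def using card_mono[of "{..<a}" "{..k} \<inter> {..<a}"] by simp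
    qed (auto simp: I_def sum_nonneg)
    finally have "(real ((a + b - 1 - 1) choose k))\<^sup>2 * x ^ k \<le> (\<Sum>i\<le>k. (g i)\<^sup>2) * real a * x ^ k"
      using assms by (intro mult_right_mono) auto
    also have "\<dots> = real a * (\<Sum>i\<le>k. f i (k - i))"
      by (simp add: sum_distrib_left sum_distrib_right f_def g_def power_mult_distrib mult_ac)
    finally show ?thesis .
  qed
  hence "square_sum x (a + b - 1) \<le> (\<Sum>k<a + b - 1. real a * (\<Sum>i\<le>k. f i (k - i)))"
    unfolding square_sum_def by (intro sum_mono) auto
  also have "\<dots> = real a * (\<Sum>(i, j)\<in>{(i, j). i + j < a + b - 1}. f i j)"
    by (simp add: sum.triangle_reindex sum_distrib_left)
  also have "(\<Sum>(i, j)\<in>{(i, j). i + j < a + b - 1}. f i j) = (\<Sum>(i, j)\<in>{..<a} \<times> {..<b}. f i j)"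
  proof (rule sum.mono_neutral_right)
    show "finite {(i, j). i + j < a + b - 1}"
      by (rule finite_subset[of _ "{..<a + b} \<times> {..<a + b}"]) auto
    show "\<forall>z\<in>{(i, j). i + j < a + b - 1} - {..<a} \<times> {..<b}. (case z of (i, j) \<Rightarrow> f i j) = 0"
    proof
      fix z assume z: "z \<in> {(i, j). i + j < a + b - 1} - {..<a} \<times> {..<b}"
      obtain i j where ij: "z = (i, j)" by (cases z)
      have "i > a - 1 \<or> j > b - 1" using z assms unfolding ij by auto
      thus "(case z of (i, j) \<Rightarrow> f i j) = 0" by (auto simp: ij f_def binomial_eq_0)
    qed
  qed auto
  also have "\<dots> = square_sum x a * square_sum x b"
    by (simp add: sum.cartesian_product[symmetric] square_sum_def sum_product f_def power_add mult_ac)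
  finally show ?thesis .
qed

text \<open>One factor a stems from Cauchy-Schwarz; the other a and the b are lost on the way back
  from square sums to Narayana polynomials.\<close>

lemma beta_poly_merge:
  assumes "x \<ge> 0" "a \<ge> 1" "b \<ge> 1"
  shows "x * beta_poly (a + b - 1) x \<le> real a * real a * real b * (beta_poly a x * beta_poly b x)"
proof -
  have ss: "square_sum x c \<ge> 0" for c using assms by (auto simp: square_sum_def intro!: sum_nonneg)
  have "x * beta_poly (a + b - 1) x \<le> x * (x * square_sum x (a + b - 1))"
    using beta_poly_square_sum(1)[of x "a + b - 1"] assms by (intro mult_left_mono) auto
  also have "\<dots> \<le> x * (x * (real a * (square_sum x a * square_sum x b)))"
    using square_sum_submult[OF assms] assms by (intro mult_left_mono) auto
  also have "\<dots> = real a * ((x * square_sum x a) * (x * square_sum x b))" by (simp add: mult_ac)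
  also have "\<dots> \<le> real a * ((real a * beta_poly a x) * (real b * beta_poly b x))"
  proof (rule mult_left_mono[OF mult_mono])
    show "x * square_sum x a \<le> real a * beta_poly a x" "x * square_sum x b \<le> real b * beta_poly b x"
      using beta_poly_square_sum(2) assms by auto
    show "0 \<le> x * square_sum x b" using assms ss by simp
    have "0 \<le> x * square_sum x a" using assms ss by simp
    also have "\<dots> \<le> real a * beta_poly a x" using beta_poly_square_sum(2) assms by auto
    finally show "0 \<le> real a * beta_poly a x" .
  qed simp
  finally show ?thesis by (simp add: mult_ac)
qed

text \<open>The form in which merging occurs in \<open>wsum_recursion\<close>: b is the number of
  places at which a word of length b can be cut open.\<close>

lemma nc_val_merge:
  assumes "x > 0" "b \<ge> 1"
  shows "real b * nc_val x (n + b) \<le> (real (Suc n) * real b)\<^sup>2 / x * (nc_val x (Suc n) * nc_val x b)"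
proof -
  have "x * nc_val x (n + b) \<le> real (Suc n) * real (Suc n) * real b * (nc_val x (Suc n) * nc_val x b)"
    using beta_poly_merge[of x "Suc n" b] assms by (simp add: beta_poly_eq_nc_val)
  hence "real b * (x * nc_val x (n + b)) \<le> real b * (real (Suc n) * real (Suc n) * real b * (nc_val x (Suc n) * nc_val x b))"
    by (intro mult_left_mono) auto
  thus ?thesis using assms by (simp add: pos_le_divide_eq power2_eq_square mult_ac del: of_nat_Suc)
qed

lemma sum_squares_le:
  fixes f :: "nat \<Rightarrow> real"
  assumes "\<And>m. 0 \<le> f m"
  shows "(\<Sum>m<n. (f m)\<^sup>2) \<le> (\<Sum>m<n. f m)\<^sup>2"
proof (induction n)
  case (Suc n)
  have "0 \<le> 2 * ((\<Sum>m<n. f m) * f n)" using assms by (intro mult_nonneg_nonneg sum_nonneg) auto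
  thus ?case using Suc by (simp add: power2_eq_square algebra_simps)
qed simp

text \<open>The main terms of \<open>wsum_recursion\<close> reproduce the recursion of
  \<open>nc_val\<close>, so the product on the right would be exact without corrections. Each letter
  costs a factor 1 + t \<le> exp t, and these factors accumulate in the exponential.\<close>

lemma wsum_bound:
  assumes d: "d \<ge> 1" and q: "q > 0" and p: "p \<ge> 1" and x: "x = real p * q / real d"
  shows "wsum d p q ns \<le> exp (2 * real (sum_list ns) ^ 5 / (real p * q)) * (\<Prod>n\<leftarrow>ns. real d * nc_val x n)"
proof (induction "2 * sum_list ns + length ns" arbitrary: ns rule: less_induct)
  case less
  have x0: "x > 0" using assms by simp
  define y where "y = real p * q"
  have y0: "y > 0" using assms by (simp add: y_def)
  have yx: "y = x * real d" using assms by (simp add: y_def)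
  have q0: "q \<ge> 0" using q by simp
  have pos: "0 < nc_val x n" for n by (rule nc_val_pos[OF x0])
  have ppos: "0 \<le> (\<Prod>n\<leftarrow>ns. real d * nc_val x n)" for ns
    by (intro prod_list_nonneg) (auto intro!: mult_nonneg_nonneg less_imp_le[OF pos])
  show ?case
  proof (cases ns)
    case Nil
    thus ?thesis using wsum_Nil[OF d q0] by simp
  next
    case (Cons k ms)
    show ?thesis
    proof (cases k)
      case 0
      have "wsum d p q ms \<le> exp (2 * real (sum_list ms) ^ 5 / y) * (\<Prod>n\<leftarrow>ms. real d * nc_val x n)"
        unfolding y_def by (rule less) (use Cons 0 in auto)
      thus ?thesis unfolding Cons 0 wsum_0_Cons[OF d q0] y_def[symmetric] using d by (simp add: mult.left_commute)
    next
      case (Suc n)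
      define N where "N = n + sum_list ms"
      define e where "e = exp (2 * real N ^ 5 / y)"
      define PR where "PR = (\<Prod>n\<leftarrow>ms. real d * nc_val x n)"
      have e0: "e > 0" by (simp add: e_def)
      have P0: "PR \<ge> 0" unfolding PR_def by (rule ppos)
      let ?b = "nc_val x"
      have IH: "wsum d p q ns' \<le> e * (\<Prod>n\<leftarrow>ns'. real d * ?b n)"
        if "sum_list ns' = N" "length ns' \<le> length ms + 2" for ns'
        using less[of ns'] that Cons Suc unfolding e_def y_def by (simp add: N_def)
      have A: "wsum d p q (n # ms) \<le> e * (real d * ?b n * PR)"
        using IH[of "n # ms"] by (simp add: N_def PR_def)
      have B: "wsum d p q (Suc j # (n - 1 - j) # ms) \<le> e * ((real d)\<^sup>2 * (?b (Suc j) * ?b (n - 1 - j)) * PR)" if "j < n" for j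
        using IH[of "Suc j # (n - 1 - j) # ms"] that by (simp add: N_def PR_def power2_eq_square mult_ac)
      have C: "real (ms ! m) * wsum d p q ((n + ms ! m) # remove_nth m ms) \<le>
          e * ((real (Suc n) * real (ms ! m))\<^sup>2 / x * ?b (Suc n) * PR)" if m: "m < length ms" for m
      proof (cases "ms ! m = 0")
        case False
        define r where "r = ms ! m"
        define PR' where "PR' = (\<Prod>n\<leftarrow>remove_nth m ms. real d * nc_val x n)"
        have P': "PR = real d * ?b r * PR'"
          unfolding PR_def PR'_def r_def
          by (metis (mono_tags) mset_remove_nth[OF m] mset_map prod_mset_prod_list image_mset_add_mset prod_mset.add_mset)
        have s: "sum_list ms = r + sum_list (remove_nth m ms)"
          using sum_list_remove_nth[OF m, of id] by (simp add: r_def)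
        have "wsum d p q ((n + r) # remove_nth m ms) \<le> e * (real d * ?b (n + r) * PR')"
          using IH[of "(n + r) # remove_nth m ms"] s m by (simp add: N_def PR'_def length_remove_nth)
        hence "real r * wsum d p q ((n + r) # remove_nth m ms) \<le> real r * (e * (real d * ?b (n + r) * PR'))"
          by (intro mult_left_mono) auto
        also have "\<dots> = (real r * ?b (n + r)) * (e * real d * PR')" by (simp add: mult_ac)
        also have "\<dots> \<le> ((real (Suc n) * real r)\<^sup>2 / x * (?b (Suc n) * ?b r)) * (e * real d * PR')"
          using False e0 ppos[of "remove_nth m ms"] unfolding r_def PR'_def
          by (intro mult_right_mono nc_val_merge[OF x0]) auto
        also have "\<dots> = e * ((real (Suc n) * real r)\<^sup>2 / x * ?b (Suc n) * PR)" unfolding P' by (simp add: mult_ac)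
        finally show ?thesis by (simp add: r_def)
      qed simp
      have len: "(\<Sum>m<length ms. (real (ms ! m))\<^sup>2) \<le> (real (sum_list ms))\<^sup>2"
      proof -
        have "(\<Sum>m<length ms. (real (ms ! m))\<^sup>2) \<le> (\<Sum>m<length ms. real (ms ! m))\<^sup>2"
          by (rule sum_squares_le) simp
        also have "(\<Sum>m<length ms. real (ms ! m)) = real (sum_list ms)"
          by (simp add: sum_list_sum_nth atLeast0LessThan)
        finally show ?thesis .
      qed
      \<comment> \<open>The two corrections, letters already present and merged traces, are each at
        most (N + 1)^4 / y relative to the main term.\<close>
      define t where "t = 2 * (real N + 1) ^ 4 / y"
      have "real d * wsum d p q (Suc n # ms) \<le> (y + real N) * wsum d p q (n # ms) +
          (\<Sum>j<n. wsum d p q (Suc j # (n - 1 - j) # ms)) +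
          (\<Sum>m<length ms. real (ms ! m) * wsum d p q ((n + ms ! m) # remove_nth m ms))"
        unfolding y_def N_def by (rule wsum_recursion[OF d q0])
      also have "\<dots> \<le> (y + real N) * (e * (real d * ?b n * PR)) +
          (\<Sum>j<n. e * ((real d)\<^sup>2 * (?b (Suc j) * ?b (n - 1 - j)) * PR)) +
          (\<Sum>m<length ms. e * ((real (Suc n) * real (ms ! m))\<^sup>2 / x * ?b (Suc n) * PR))"
        using y0 by (intro add_mono mult_left_mono sum_mono A B C) auto
      also have "\<dots> = e * PR * ((y + real N) * (real d * ?b n) + (real d)\<^sup>2 * (\<Sum>j<n. ?b (Suc j) * ?b (n - 1 - j)) +
          (real (Suc n))\<^sup>2 * (\<Sum>m<length ms. (real (ms ! m))\<^sup>2) / x * ?b (Suc n))"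
        by (simp add: sum_distrib_left sum_distrib_right sum_divide_distrib distrib_left power_mult_distrib mult_ac del: of_nat_Suc)
      \<comment> \<open>Since y d = x d^2, the deletion term and the splitting terms together are
        d^2 times the recursion for \<open>nc_val x (Suc n)\<close>.\<close>
      also have "\<dots> = e * PR * ((real d)\<^sup>2 * ?b (Suc n) + real N * real d * ?b n +
          (real (Suc n))\<^sup>2 * (\<Sum>m<length ms. (real (ms ! m))\<^sup>2) / x * ?b (Suc n))"
        unfolding nc_val_Suc[of x n] yx by (simp add: power2_eq_square algebra_simps del: of_nat_Suc)
      also have "\<dots> \<le> e * PR * ((real d)\<^sup>2 * ?b (Suc n) * (1 + t))"
      proof (intro mult_left_mono)
        have i1: "real N * real d * ?b n \<le> (real N + 1) ^ 4 / y * ((real d)\<^sup>2 * ?b (Suc n))"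
        proof -
          have "real N \<le> (real N + 1) ^ 4" using self_le_power[of "real N + 1" 4] by simp
          hence "real N * (real d * ?b n) \<le> (real N + 1) ^ 4 * (real d * ?b n)"
            using pos[of n] by (intro mult_right_mono) auto
          also have "\<dots> = (real N + 1) ^ 4 * (1 / y * ((real d)\<^sup>2 * (x * ?b n)))"
            using x0 d unfolding yx by (simp add: power2_eq_square)
          also have "\<dots> \<le> (real N + 1) ^ 4 * (1 / y * ((real d)\<^sup>2 * ?b (Suc n)))"
            using x0 y0 nc_val_Suc_ge[of x n] by (intro mult_left_mono) auto
          finally show ?thesis by (simp add: mult_ac)
        qed
        have i2: "(real (Suc n))\<^sup>2 * (\<Sum>m<length ms. (real (ms ! m))\<^sup>2) / x * ?b (Suc n) \<le> (real N + 1) ^ 4 / y * ((real d)\<^sup>2 * ?b (Suc n))"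
        proof -
          have "(real (Suc n))\<^sup>2 * (\<Sum>m<length ms. (real (ms ! m))\<^sup>2) \<le> (real N + 1)\<^sup>2 * (real N + 1)\<^sup>2"
          proof (intro mult_mono)
            show "(\<Sum>m<length ms. (real (ms ! m))\<^sup>2) \<le> (real N + 1)\<^sup>2"
              using len by (rule order_trans) (auto simp: N_def intro!: power_mono)
          qed (auto simp: N_def sum_nonneg intro!: power_mono)
          also have "\<dots> = (real N + 1) ^ 4" by (simp flip: power_add)
          finally have "(real (Suc n))\<^sup>2 * (\<Sum>m<length ms. (real (ms ! m))\<^sup>2) / x * ?b (Suc n) \<le> (real N + 1) ^ 4 / x * ?b (Suc n)"
            using x0 pos[of "Suc n"] by (intro mult_right_mono divide_right_mono) auto
          also have "\<dots> = (real N + 1) ^ 4 / y * (real d * ?b (Suc n))"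
            using x0 d unfolding yx by simp
          \<comment> \<open>Merging loses two powers of d against splitting. One of them is given
            away here so that both corrections have the same bound.\<close>
          also have "\<dots> \<le> (real N + 1) ^ 4 / y * ((real d)\<^sup>2 * ?b (Suc n))"
            using y0 d pos[of "Suc n"] self_le_power[of "real d" 2]
            by (intro mult_left_mono mult_right_mono) auto
          finally show ?thesis .
        qed
        have "(real d)\<^sup>2 * ?b (Suc n) * (1 + t) = (real d)\<^sup>2 * ?b (Suc n) +
          (real N + 1) ^ 4 / y * ((real d)\<^sup>2 * ?b (Suc n)) + (real N + 1) ^ 4 / y * ((real d)\<^sup>2 * ?b (Suc n))"
          by (simp add: t_def algebra_simps)
        thus "(real d)\<^sup>2 * ?b (Suc n) + real N * real d * ?b n +
          (real (Suc n))\<^sup>2 * (\<Sum>m<length ms. (real (ms ! m))\<^sup>2) / x * ?b (Suc n) \<le> (real d)\<^sup>2 * ?b (Suc n) * (1 + t)"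
          using i1 i2 by linarith
      qed (use e0 P0 in auto)
      also have "\<dots> \<le> e * PR * ((real d)\<^sup>2 * ?b (Suc n) * exp t)"
        using e0 P0 pos[of "Suc n"] exp_ge_add_one_self[of t] by (intro mult_left_mono) auto
      also have "\<dots> = real d * ((e * exp t) * (real d * ?b (Suc n) * PR))" by (simp add: power2_eq_square mult_ac)
      finally have "wsum d p q (Suc n # ms) \<le> (e * exp t) * (real d * ?b (Suc n) * PR)" using d by simp
      \<comment> \<open>The origin of the exponent 5: N^5 + (N + 1)^4 \<le> (N + 1)^5.\<close>
      also have "e * exp t \<le> exp (2 * (real N + 1) ^ 5 / y)"
      proof -
        have "real N ^ 5 \<le> real N * (real N + 1) ^ 4"
          using power_mono[of "real N" "real N + 1" 4] by (simp add: power_Suc[of _ 4, simplified] mult_left_mono)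
        hence "real N ^ 5 + (real N + 1) ^ 4 \<le> (real N + 1) * (real N + 1) ^ 4" by (simp add: distrib_right)
        also have "\<dots> = (real N + 1) ^ 5" by (simp add: power_Suc[of _ 4, simplified])
        finally have "2 * real N ^ 5 + 2 * (real N + 1) ^ 4 \<le> 2 * (real N + 1) ^ 5" by simp
        hence "2 * real N ^ 5 / y + t \<le> 2 * (real N + 1) ^ 5 / y"
          using y0 unfolding t_def add_divide_distrib[symmetric] by (intro divide_right_mono) auto
        thus ?thesis unfolding e_def by (simp flip: exp_add)
      qed
      hence "(e * exp t) * (real d * ?b (Suc n) * PR) \<le> exp (2 * (real N + 1) ^ 5 / y) * (real d * ?b (Suc n) * PR)"
        using P0 pos[of "Suc n"] by (intro mult_right_mono) auto
      finally show ?thesis unfolding Cons Suc y_def[symmetric] by (simp add: N_def PR_def add_ac)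
    qed
  qed
qed

text \<open>All but one of the k equal factors are replaced by their bound d^(1-l). With q = d^(1-k)
  this leaves a \<open>wsum\<close> over single words, for which p q / d = p / d^k is the same x as
  in the claim.\<close>

lemma expected_trace_upper:
  assumes "d \<ge> 1" "k \<ge> 1" "p \<ge> 1" "m \<ge> 1" and x: "x = real p / real d ^ k"
  shows "expected_trace d k p m / real d ^ k \<le> exp (2 * real m ^ 5 / (x * real d)) * beta_poly m x"
proof -
  define q where "q = 1 / real d ^ (k - 1)"
  have d0: "real d > 0" using assms by simp
  have q0: "q > 0" using d0 by (simp add: q_def)
  have dk: "real d ^ k = real d * real d ^ (k - 1)" using assms by (simp flip: power_Suc)
  have x': "x = real p * q / real d" unfolding x q_def dk by (simp add: field_simps)
  have xd: "real p * q = x * real d" using d0 by (simp add: x')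
  have "expected_trace d k p m = (\<Sum>s\<in>words p m. wexp d p [s] ^ k)"
    by (rule expected_trace_words[OF assms(1)])
  also have "\<dots> \<le> (\<Sum>s\<in>words p m. real d ^ (k - 1) * (q ^ card (set s) * wexp d p [s]))"
  proof (intro sum_mono)
    fix s assume s: "s \<in> words p m"
    hence s': "set s \<subseteq> {..<p}" "s \<noteq> []" using assms by (auto simp: words_def)
    have w0: "0 \<le> wexp d p [s]" by (rule wexp_nonneg[OF assms(1)]) (use s' in simp)
    have "wexp d p [s] ^ k = wexp d p [s] ^ (k - 1) * wexp d p [s]"
      using assms by (simp flip: power_Suc2)
    also have "\<dots> \<le> (real d / real d ^ card (set s)) ^ (k - 1) * wexp d p [s]"
      using w0 wexp_le[OF assms(1) s'] by (intro mult_right_mono power_mono) auto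
    also have "\<dots> = real d ^ (k - 1) * (q ^ card (set s) * wexp d p [s])"
      by (simp add: q_def power_divide flip: power_mult) (simp add: mult.commute)
    finally show "wexp d p [s] ^ k \<le> real d ^ (k - 1) * (q ^ card (set s) * wexp d p [s])" .
  qed
  also have "\<dots> = real d ^ (k - 1) * wsum d p q [m]"
    using q0 by (simp add: wsum_def[OF assms(1)] sum_word_lists_Cons sum_distrib_left)
  also have "\<dots> \<le> real d ^ (k - 1) * (exp (2 * real m ^ 5 / (x * real d)) * (real d * nc_val x m))"
    using wsum_bound[OF assms(1) q0 assms(3) x', of "[m]"] d0 unfolding xd by (intro mult_left_mono) auto
  also have "\<dots> = real d ^ k * (exp (2 * real m ^ 5 / (x * real d)) * beta_poly m x)"
    using assms by (simp add: dk beta_poly_eq_nc_val)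
  finally show ?thesis using d0 by (simp add: field_simps)
qed

section \<open>Noncrossing words and the lower bound\<close>

text \<open>Words whose sets of positions of equal letters form a noncrossing partition. The first
  letter is either alone, or the stretch \<open>u\<close> up to its next occurrence shares no letter
  with the rest.\<close>

inductive nc_word :: "nat list \<Rightarrow> bool" where
  Nil: "nc_word []"
| single: "nc_word u \<Longrightarrow> a \<notin> set u \<Longrightarrow> nc_word (a # u)"
| block: "nc_word u \<Longrightarrow> nc_word (a # w) \<Longrightarrow> set u \<inter> set (a # w) = {} \<Longrightarrow> nc_word (a # u @ a # w)"

text \<open>The suffix x is there for the induction. In the block case the leading \<open>a\<close>
  is rotated to the end and \<open>u\<close> is stripped off; then the two copies of
  \<open>a\<close> are cyclic neighbours and fuse by idempotence, and \<open>a # w\<close> is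
  stripped off.\<close>

lemma wexp_nc_append:
  assumes d: "d \<ge> 1"
  shows "nc_word u \<Longrightarrow> set u \<subseteq> {..<p} \<Longrightarrow> set x \<subseteq> {..<p} \<Longrightarrow> set u \<inter> set x = {} \<Longrightarrow>
    real d ^ card (set u) * wexp d p [u @ x] = wexp d p [x]"
proof (induction arbitrary: x rule: nc_word.induct)
  case (single u a)
  have "real d * wexp d p [a # u @ x] = wexp d p [u @ x]"
    by (rule wexp_single[OF d]) (use single in auto)
  moreover have "real d ^ card (set u) * wexp d p [u @ x] = wexp d p [x]"
    by (rule single.IH) (use single in auto)
  moreover have "real d ^ card (set (a # u)) * wexp d p [(a # u) @ x] =
      real d ^ card (set u) * (real d * wexp d p [a # u @ x])"
    using single.hyps by (simp add: mult_ac)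
  ultimately show ?case by simp
next
  case (block u a w)
  have 1: "real d ^ card (set u) * wexp d p [u @ (a # w @ x @ [a])] = wexp d p [a # w @ x @ [a]]"
    by (rule block.IH(1)) (use block in auto)
  have 2: "wexp d p [a # w @ x @ [a]] = wexp d p [a # w @ x]"
    using wexp_rotate[OF d, of p "a # w @ x" "[a]" "[]"] wexp_repeat[OF d, of a p "w @ x" "[]"] block.prems by auto
  have 3: "real d ^ card (set (a # w)) * wexp d p [(a # w) @ x] = wexp d p [x]"
    by (rule block.IH(2)) (use block in auto)
  have 4: "wexp d p [a # u @ a # w @ x] = wexp d p [u @ (a # w @ x @ [a])]"
    using wexp_rotate[OF d, of p "[a]" "u @ a # w @ x" "[]"] by simp
  have "card (set (a # u @ a # w)) = card (set u) + card (set (a # w))"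
  proof -
    have "set (a # u @ a # w) = set u \<union> set (a # w)" by auto
    thus ?thesis using block.hyps(3) by (simp only: card_Un_disjoint finite_set)
  qed
  hence "real d ^ card (set (a # u @ a # w)) * wexp d p [(a # u @ a # w) @ x] =
      real d ^ card (set (a # w)) * (real d ^ card (set u) * wexp d p [a # u @ a # w @ x])"
    by (simp add: power_add mult_ac)
  also have "\<dots> = wexp d p [x]" unfolding 4 1 2 using 3 by simp
  finally show ?case .
qed simp

lemma wexp_nc:
  assumes "d \<ge> 1" "nc_word s" "set s \<subseteq> {..<p}"
  shows "wexp d p [s] = real d / real d ^ card (set s)"
proof -
  have "real d ^ card (set s) * wexp d p [s] = real d"
    using wexp_nc_append[OF assms(1,2,3), of "[]"] assms(1) by simp
  thus ?thesis using assms(1) by (simp add: field_simps)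
qed

section \<open>Counting noncrossing words\<close>

definition nc_words :: "nat \<Rightarrow> nat \<Rightarrow> nat set \<Rightarrow> nat list set" where
  "nc_words m l S = {s. nc_word s \<and> length s = m \<and> set s \<subseteq> S \<and> card (set s) = l}"

lemma finite_nc_words [simp]: "finite S \<Longrightarrow> finite (nc_words m l S)"
  by (rule finite_subset[OF _ finite_lists_length_eq[of S m]]) (auto simp: nc_words_def)

text \<open>The number of ways to name l blocks by distinct letters out of n; truncated subtraction
  makes it 0 for l > n.\<close>

definition falling :: "nat \<Rightarrow> nat \<Rightarrow> real" where
  "falling n l = (\<Prod>i<l. real (n - i))"

lemma falling_0 [simp]: "falling n 0 = 1"
  and falling_Suc: "falling n (Suc l) = falling n l * real (n - l)"
  by (simp_all add: falling_def)

lemma falling_add: "falling n (a + b) = falling n a * falling (n - a) b"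
  by (induction b) (simp_all add: falling_Suc)

lemma falling_nonneg [simp]: "0 \<le> falling n l"
  by (simp add: falling_def prod_nonneg)

lemma coeff_nc_poly_nonneg: "0 \<le> coeff (nc_poly m) l"
proof (induction m arbitrary: l rule: less_induct)
  case (less m)
  show ?case
  proof (cases m)
    case (Suc n)
    show ?thesis unfolding Suc nc_poly.simps(2)[of n]
      using less Suc by (auto simp: coeff_pCons coeff_sum coeff_mult intro!: add_nonneg_nonneg sum_nonneg mult_nonneg_nonneg split: nat.split)
  qed auto
qed

lemma card_nc_words_single:
  assumes S: "finite S"
  shows "real (card ((\<lambda>(u, a). a # u) ` (SIGMA u:nc_words n l S. S - set u))) = real (card (nc_words n l S)) * real (card S - l)"
proof -
  have "card ((\<lambda>(u, a). a # u) ` (SIGMA u:nc_words n l S. S - set u)) = card (SIGMA u:nc_words n l S. S - set u)"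
    by (rule card_image) (auto simp: inj_on_def)
  also have "\<dots> = (\<Sum>u\<in>nc_words n l S. card (S - set u))" using S by simp
  also have "\<dots> = (\<Sum>u\<in>nc_words n l S. card S - l)"
    by (intro sum.cong refl) (auto simp: nc_words_def card_Diff_subset)
  finally show ?thesis by simp
qed

text \<open>Cutting a word at the next occurrence of its first letter mirrors the recursion of \<open>nc_poly\<close>.\<close>

lemma card_nc_words_Suc:
  assumes S: "finite S"
  shows "real (card (nc_words (Suc n) l S)) \<ge>
    (case l of 0 \<Rightarrow> 0 | Suc l' \<Rightarrow> real (card (nc_words n l' S)) * real (card S - l')) +
    (\<Sum>j<n. \<Sum>i\<le>l. \<Sum>w\<in>nc_words (Suc j) i S. real (card (nc_words (n - 1 - j) (l - i) (S - set w))))"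
proof -
  define A where "A = (case l of 0 \<Rightarrow> {} | Suc l' \<Rightarrow> (\<lambda>(u, a). a # u) ` (SIGMA u:nc_words n l' S. S - set u))"
  \<comment> \<open>Here w is the part from the next occurrence of the first letter on, with j + 1
    positions and i letters; the enclosed u takes the other l - i letters from outside w.\<close>
  define I where "I = (SIGMA ji:{..<n} \<times> {..l}. SIGMA w:nc_words (Suc (fst ji)) (snd ji) S. nc_words (n - 1 - fst ji) (l - snd ji) (S - set w))"
  define h where "h = (\<lambda>(ji :: nat \<times> nat, w :: nat list, u). hd w # u @ w)"
  have cA: "real (card A) = (case l of 0 \<Rightarrow> 0 | Suc l' \<Rightarrow> real (card (nc_words n l' S)) * real (card S - l'))"
    unfolding A_def using card_nc_words_single[OF S] by (auto split: nat.split)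
  have cI: "card I = (\<Sum>j<n. \<Sum>i\<le>l. \<Sum>w\<in>nc_words (Suc j) i S. card (nc_words (n - 1 - j) (l - i) (S - set w)))"
    unfolding I_def using S by (simp add: sum.cartesian_product case_prod_unfold)
  have inI: "\<exists>a w'. w = a # w' \<and> a \<notin> set u \<and> nc_word u \<and> nc_word w \<and> set w \<subseteq> S \<and> set u \<subseteq> S - set w \<and>
      length w = Suc j \<and> length u = n - 1 - j \<and> j < n \<and> i \<le> l \<and> card (set w) = i \<and> card (set u) = l - i"
    if "((j, i), w, u) \<in> I" for j i w u
    using that unfolding I_def nc_words_def by (cases w) auto
  have inj: "inj_on h I"
  proof (rule inj_onI)
    fix z z' assume "z \<in> I" "z' \<in> I" "h z = h z'"
    moreover obtain j i w u where z: "z = ((j, i), w, u)" by (cases z) auto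
    moreover obtain j' i' w' u' where z': "z' = ((j', i'), w', u')" by (cases z') auto
    ultimately have x: "((j, i), w, u) \<in> I" and y: "((j', i'), w', u') \<in> I"
      and e: "h ((j, i), w, u) = h ((j', i'), w', u')" by auto
    obtain a v where a: "w = a # v" "a \<notin> set u" "length w = Suc j" "card (set w) = i" using inI[OF x] by blast
    obtain a' v' where a': "w' = a' # v'" "a' \<notin> set u'" "length w' = Suc j'" "card (set w') = i'" using inI[OF y] by blast
    have aa: "a = a'" and eq: "u @ w = u' @ w'" using e by (auto simp: h_def a a')
    \<comment> \<open>As \<open>a\<close> does not occur in u but is the first letter of w, the cut
      is found again at the first \<open>a\<close>.\<close>
    have "takeWhile (\<lambda>t. t \<noteq> a) (u @ w) = u" "dropWhile (\<lambda>t. t \<noteq> a) (u @ w) = w"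
      using a(1,2) by (auto simp: takeWhile_append dropWhile_append)
    moreover have "takeWhile (\<lambda>t. t \<noteq> a) (u' @ w') = u'" "dropWhile (\<lambda>t. t \<noteq> a) (u' @ w') = w'"
      using a'(1,2) aa by (auto simp: takeWhile_append dropWhile_append)
    ultimately have "u = u'" "w = w'" using eq by auto
    thus "z = z'"
      unfolding z z' using a(3,4) a'(3,4) by auto
  qed
  have hI: "h ` I \<subseteq> nc_words (Suc n) l S"
  proof
    fix s assume "s \<in> h ` I"
    then obtain j i w u where x: "((j, i), w, u) \<in> I" and s: "s = h ((j, i), w, u)" by auto
    obtain a v where a: "w = a # v" "a \<notin> set u" "nc_word u" "nc_word w" "set w \<subseteq> S" "set u \<subseteq> S - set w"
      "length w = Suc j" "length u = n - 1 - j" "j < n" "i \<le> l" "card (set w) = i" "card (set u) = l - i"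
      using inI[OF x] by blast
    have "nc_word (a # u @ a # v)" by (rule nc_word.block) (use a in auto)
    moreover have "card (set (a # u @ a # v)) = l"
    proof -
      have "set (a # u @ a # v) = set u \<union> set w" using a(1) by auto
      moreover have "card (set u \<union> set w) = card (set u) + card (set w)"
        using a(6) by (intro card_Un_disjoint) auto
      ultimately show ?thesis using a by simp
    qed
    ultimately show "s \<in> nc_words (Suc n) l S"
      unfolding s using a by (auto simp: h_def nc_words_def)
  qed
  have AS: "A \<subseteq> nc_words (Suc n) l S"
    unfolding A_def nc_words_def by (auto split: nat.splits intro: nc_word.single simp: card_insert_if)
  have disj: "A \<inter> h ` I = {}"
  proof -
    have "hd s \<notin> set (tl s)" if "s \<in> A" for s using that unfolding A_def by (auto split: nat.splits)
    moreover have "hd s \<in> set (tl s)" if s: "s \<in> h ` I" for s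
    proof -
      obtain j i w u where "((j, i), w, u) \<in> I" "s = h ((j, i), w, u)" using s by auto
      thus ?thesis using inI[of j i w u] by (auto simp: h_def)
    qed
    ultimately show ?thesis by blast
  qed
  have fin: "finite (nc_words (Suc n) l S)" using S by simp
  have "card A + card I = card (A \<union> h ` I)"
    using disj AS hI fin inj by (subst card_Un_disjoint) (auto intro: finite_subset simp: card_image)
  also have "\<dots> \<le> card (nc_words (Suc n) l S)" using AS hI fin by (intro card_mono) auto
  finally have "real (card A) + real (card I) \<le> real (card (nc_words (Suc n) l S))" by simp
  thus ?thesis unfolding cA cI by simp
qed

text \<open>The coefficient stands for the noncrossing patterns with l blocks and the falling
  factorial for their labellings. In the induction w uses i letters, which leaves
  \<open>card S - i\<close> for u, and \<open>falling_add\<close> fits the two factors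
  together.\<close>

lemma card_nc_words:
  assumes "finite S"
  shows "coeff (nc_poly m) l * falling (card S) l \<le> real (card (nc_words m l S))"
  using assms
proof (induction m arbitrary: l S rule: less_induct)
  case (less m)
  show ?case
  proof (cases m)
    case 0
    have "nc_words 0 0 S = {[]}" by (auto simp: nc_words_def intro: nc_word.Nil)
    thus ?thesis using 0 by (cases l) auto
  next
    case (Suc n)
    define s where "s = card S"
    have IH: "coeff (nc_poly m') l * falling (card S') l \<le> real (card (nc_words m' l S'))"
      if "m' \<le> n" "finite S'" for m' l S' using less.IH[of m' S' l] that Suc by auto
    have 1: "coeff (pCons 0 (nc_poly n)) l * falling s l \<le>
        (case l of 0 \<Rightarrow> 0 | Suc l' \<Rightarrow> real (card (nc_words n l' S)) * real (card S - l'))"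
    proof (cases l)
      case (Suc l')
      have "coeff (nc_poly n) l' * falling s l' * real (s - l') \<le> real (card (nc_words n l' S)) * real (s - l')"
        using IH[of n S l'] less.prems unfolding s_def by (intro mult_right_mono) auto
      thus ?thesis using Suc by (simp add: falling_Suc s_def mult.assoc)
    qed simp
    have 2: "coeff (nc_poly (Suc j)) i * coeff (nc_poly (n - 1 - j)) (l - i) * falling s l \<le>
      (\<Sum>w\<in>nc_words (Suc j) i S. real (card (nc_words (n - 1 - j) (l - i) (S - set w))))" if "j < n" "i \<le> l" for j i
    proof -
      have "coeff (nc_poly (Suc j)) i * coeff (nc_poly (n - 1 - j)) (l - i) * falling s l =
        (coeff (nc_poly (Suc j)) i * falling s i) * (coeff (nc_poly (n - 1 - j)) (l - i) * falling (s - i) (l - i))"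
        using falling_add[of s i "l - i"] that by (simp add: mult_ac)
      also have "\<dots> \<le> real (card (nc_words (Suc j) i S)) * (coeff (nc_poly (n - 1 - j)) (l - i) * falling (s - i) (l - i))"
        using IH[of "Suc j" S i] that less.prems unfolding s_def
        by (intro mult_right_mono mult_nonneg_nonneg coeff_nc_poly_nonneg) auto
      also have "\<dots> = (\<Sum>w\<in>nc_words (Suc j) i S. coeff (nc_poly (n - 1 - j)) (l - i) * falling (s - i) (l - i))"
        by simp
      also have "\<dots> \<le> (\<Sum>w\<in>nc_words (Suc j) i S. real (card (nc_words (n - 1 - j) (l - i) (S - set w))))"
      proof (rule sum_mono)
        fix w assume "w \<in> nc_words (Suc j) i S"
        hence "card (S - set w) = s - i" by (auto simp: nc_words_def s_def card_Diff_subset)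
        thus "coeff (nc_poly (n - 1 - j)) (l - i) * falling (s - i) (l - i) \<le> real (card (nc_words (n - 1 - j) (l - i) (S - set w)))"
          using IH[of "n - 1 - j" "S - set w" "l - i"] less.prems by simp
      qed
      finally show ?thesis .
    qed
    have "coeff (nc_poly m) l * falling s l = coeff (pCons 0 (nc_poly n)) l * falling s l +
       (\<Sum>j<n. \<Sum>i\<le>l. coeff (nc_poly (Suc j)) i * coeff (nc_poly (n - 1 - j)) (l - i) * falling s l)"
      unfolding Suc nc_poly.simps(2)[of n] by (simp only: coeff_add coeff_sum coeff_mult distrib_right sum_distrib_right)
    also have "\<dots> \<le> (case l of 0 \<Rightarrow> 0 | Suc l' \<Rightarrow> real (card (nc_words n l' S)) * real (card S - l')) +
       (\<Sum>j<n. \<Sum>i\<le>l. \<Sum>w\<in>nc_words (Suc j) i S. real (card (nc_words (n - 1 - j) (l - i) (S - set w))))"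
      by (intro add_mono sum_mono 1 2) auto
    also have "\<dots> \<le> real (card (nc_words m l S))"
      unfolding Suc by (rule card_nc_words_Suc[OF less.prems])
    finally show ?thesis by (simp add: s_def)
  qed
qed

text \<open>A consequence of the counting: with an alphabet of l letters the falling factorial is
  positive, but no word of length m < l has l distinct letters.\<close>

lemma coeff_nc_poly_eq_0:
  assumes "l > m" shows "coeff (nc_poly m) l = 0"
proof -
  have "nc_words m l {..<l} = {}"
  proof -
    have "card (set s) \<noteq> l" if "length s = m" for s :: "nat list"
      using card_length[of s] that assms by simp
    thus ?thesis by (auto simp: nc_words_def)
  qed
  hence "coeff (nc_poly m) l * falling l l \<le> 0" using card_nc_words[of "{..<l}" m l] by simp
  moreover have "falling l l > 0" by (auto simp: falling_def intro!: prod_pos)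
  ultimately show ?thesis using coeff_nc_poly_nonneg[of m l] by (simp add: mult_le_0_iff)
qed

lemma nc_val_eq_sum: "nc_val x m = (\<Sum>l\<le>m. coeff (nc_poly m) l * x ^ l)"
proof -
  have "degree (nc_poly m) \<le> m" by (rule degree_le) (auto intro: coeff_nc_poly_eq_0)
  thus ?thesis unfolding nc_val_def poly_altdef
    by (intro sum.mono_neutral_left) (auto simp: coeff_eq_0)
qed

text \<open>Induction with the factor 1 - l/p per step, as (1 - l^2/p) (1 - l/p) \<ge> 1 - (l^2 +
  l)/p.\<close>

lemma falling_ge:
  assumes "l \<le> p" "p \<ge> 1"
  shows "real p ^ l * (1 - real l ^ 2 / real p) \<le> falling p l"
  using assms(1)
proof (induction l)
  case (Suc l)
  have p: "real p > 0" using assms by simp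
  have "real p ^ Suc l * (1 - real (Suc l) ^ 2 / real p) \<le> real p ^ Suc l * ((1 - real l ^ 2 / real p) * (1 - real l / real p))"
  proof (rule mult_left_mono)
    have "(1 - real l ^ 2 / real p) * (1 - real l / real p) = 1 - (real l ^ 2 + real l) / real p + real l ^ 2 * real l / (real p)\<^sup>2"
      using p by (simp add: field_simps power2_eq_square)
    moreover have "0 \<le> real l ^ 2 * real l / (real p)\<^sup>2" by simp
    moreover have "(real l ^ 2 + real l) / real p \<le> real (Suc l) ^ 2 / real p"
      by (intro divide_right_mono) (auto simp: power2_eq_square algebra_simps)
    ultimately show "1 - real (Suc l) ^ 2 / real p \<le> (1 - real l ^ 2 / real p) * (1 - real l / real p)" by linarith
  qed simp
  also have "\<dots> = (real p ^ l * (1 - real l ^ 2 / real p)) * real (p - l)"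
    using p Suc.prems by (simp add: of_nat_diff field_simps)
  also have "\<dots> \<le> falling p l * real (p - l)" using Suc by (intro mult_right_mono) auto
  finally show ?case by (simp add: falling_Suc)
qed simp

text \<open>By positivity the sum may be restricted to noncrossing words. One with l letters
  contributes exactly (d^k)^(-l) after normalization, and their number is at least the l-th
  coefficient times p^l (1 - m^2/p), as l \<le> m.\<close>

lemma expected_trace_lower:
  assumes "d \<ge> 1" "p \<ge> 1" "m \<ge> 1" "real m < sqrt (real p)" and x: "x = real p / real d ^ k"
  shows "(1 - real m ^ 2 / real p) * beta_poly m x \<le> expected_trace d k p m / real d ^ k"
proof -
  have d0: "real d > 0" and p0: "real p > 0" using assms by simp_all
  have mp: "m \<le> p"
  proof -
    have "real m ^ 2 < sqrt (real p) ^ 2" using assms(4) by (intro power_strict_mono) auto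
    hence "real m ^ 2 < real p" by simp
    moreover have "real m \<le> real m ^ 2" using assms(3) by (intro self_le_power) auto
    ultimately show ?thesis by linarith
  qed
  define D where "D = real d ^ k"
  have D0: "D > 0" using d0 by (simp add: D_def)
  have "(1 - real m ^ 2 / real p) * beta_poly m x = (\<Sum>l\<le>m. coeff (nc_poly m) l * (real p ^ l * (1 - real m ^ 2 / real p)) / D ^ l)"
    using assms(3) unfolding beta_poly_eq_nc_val[OF assms(3)] nc_val_eq_sum sum_distrib_left x D_def[symmetric]
    by (intro sum.cong refl) (simp add: power_divide)
  also have "\<dots> \<le> (\<Sum>l\<le>m. coeff (nc_poly m) l * falling p l / D ^ l)"
  proof (intro sum_mono divide_right_mono mult_left_mono coeff_nc_poly_nonneg)
    fix l assume l: "l \<in> {..m}"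
    have "real p ^ l * (1 - real m ^ 2 / real p) \<le> real p ^ l * (1 - real l ^ 2 / real p)"
      using l p0 by (intro mult_left_mono diff_left_mono divide_right_mono power_mono) auto
    also have "\<dots> \<le> falling p l" using l mp assms by (intro falling_ge) auto
    finally show "real p ^ l * (1 - real m ^ 2 / real p) \<le> falling p l" .
  qed (use D0 in auto)
  also have "\<dots> \<le> (\<Sum>l\<le>m. \<Sum>s\<in>nc_words m l {..<p}. wexp d p [s] ^ k / D)"
  proof (rule sum_mono)
    fix l
    have "wexp d p [s] ^ k / D = 1 / D ^ l" if "s \<in> nc_words m l {..<p}" for s
      using that wexp_nc[OF assms(1), of s p] d0
      by (auto simp: nc_words_def D_def power_divide power_mult[symmetric] mult.commute)
    hence "(\<Sum>s\<in>nc_words m l {..<p}. wexp d p [s] ^ k / D) = real (card (nc_words m l {..<p})) / D ^ l" by simp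
    thus "coeff (nc_poly m) l * falling p l / D ^ l \<le> (\<Sum>s\<in>nc_words m l {..<p}. wexp d p [s] ^ k / D)"
      using card_nc_words[of "{..<p}" m l] D0 by (simp add: divide_right_mono)
  qed
  also have "\<dots> = (\<Sum>s\<in>(\<Union>l\<le>m. nc_words m l {..<p}). wexp d p [s] ^ k / D)"
  proof -
    have "\<forall>i\<in>{..m}. \<forall>j\<in>{..m}. i \<noteq> j \<longrightarrow> nc_words m i {..<p} \<inter> nc_words m j {..<p} = {}"
      by (auto simp: nc_words_def)
    thus ?thesis by (intro sum.UNION_disjoint[symmetric]) simp_all
  qed
  also have "\<dots> \<le> (\<Sum>s\<in>words p m. wexp d p [s] ^ k / D)"
  proof (rule sum_mono2)
    show "0 \<le> wexp d p [s] ^ k / D" if "s \<in> words p m - (\<Union>l\<le>m. nc_words m l {..<p})" for s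
      using that D0 wexp_nonneg[OF assms(1), of "[s]" p] by (auto simp: words_def)
    show "(\<Union>l\<le>m. nc_words m l {..<p}) \<subseteq> words p m" by (auto simp: nc_words_def words_def)
  qed simp
  also have "\<dots> = expected_trace d k p m / real d ^ k"
    unfolding expected_trace_words[OF assms(1)] D_def by (simp add: sum_divide_distrib)
  finally show ?thesis .
qed

theorem theorem1:
  shows "(\<forall>d k p m :: nat. d \<ge> 1 \<longrightarrow> k \<ge> 1 \<longrightarrow> p \<ge> 1 \<longrightarrow> m \<ge> 1 \<longrightarrow>
            (let x = real p / real d ^ k in
              (real m < sqrt (real p) \<longrightarrow>
                 (1 - real m ^ 2 / real p) * beta_poly m x \<le> expected_trace d k p m / real d ^ k) \<and>
              expected_trace d k p m / real d ^ k
                \<le> exp (3 * real m ^ (k + 4) / (x * real d powr (1 / real k))) * beta_poly m x))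
       \<and>
       (\<forall>(m::nat) (k::nat) (x::real) (p :: nat \<Rightarrow> nat). m \<ge> 1 \<longrightarrow> k \<ge> 1 \<longrightarrow> x > 0 \<longrightarrow>
            ((\<lambda>d. real (p d) / real d ^ k) \<longlonglongrightarrow> x) \<longrightarrow>
            ((\<lambda>d. expected_trace d k (p d) m / real d ^ k) \<longlonglongrightarrow> beta_poly m x))"
proof (intro conjI allI impI)
  fix d k p m :: nat
  assume dk: "d \<ge> 1" "k \<ge> 1" "p \<ge> 1" "m \<ge> 1"
  define x where "x = real p / real d ^ k"
  have x0: "x > 0" using dk by (simp add: x_def)
  have "expected_trace d k p m / real d ^ k \<le> exp (2 * real m ^ 5 / (x * real d)) * beta_poly m x"
    by (rule expected_trace_upper[OF dk x_def])
  also have "\<dots> \<le> exp (3 * real m ^ (k + 4) / (x * real d powr (1 / real k))) * beta_poly m x"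
  proof (rule mult_right_mono)
    \<comment> \<open>The bound obtained has d and m^5 in place of d^(1/k) and m^(k+4); for d, m, k
      \<ge> 1 the passage to the latter only enlarges the exponent.\<close>
    have "real d powr (1 / real k) \<le> real d powr 1" using dk by (intro powr_mono) auto
    hence "real d powr (1 / real k) \<le> real d" using dk by simp
    moreover have "real m ^ 5 \<le> real m ^ (k + 4)" using dk by (intro power_increasing) auto
    ultimately have "2 * real m ^ 5 / (x * real d) \<le> 3 * real m ^ (k + 4) / (x * real d powr (1 / real k))"
      using x0 dk by (intro frac_le mult_mono mult_left_mono) auto
    thus "exp (2 * real m ^ 5 / (x * real d)) \<le> exp (3 * real m ^ (k + 4) / (x * real d powr (1 / real k)))" by simp
    show "0 \<le> beta_poly m x" using dk x0 by (simp add: beta_poly_eq_nc_val nc_val_nonneg)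
  qed
  finally show "let x = real p / real d ^ k in
              (real m < sqrt (real p) \<longrightarrow>
                 (1 - real m ^ 2 / real p) * beta_poly m x \<le> expected_trace d k p m / real d ^ k) \<and>
              expected_trace d k p m / real d ^ k
                \<le> exp (3 * real m ^ (k + 4) / (x * real d powr (1 / real k))) * beta_poly m x"
    unfolding Let_def x_def[symmetric] using expected_trace_lower[OF dk(1,3,4) _ x_def] by blast
next
  \<comment> \<open>As x d^k need not be an integer, the limit is taken along arbitrary integers
    \<open>p d\<close> whose ratio to d^k tends to x.\<close>
  fix m k :: nat and x :: real and p :: "nat \<Rightarrow> nat"
  assume mk: "m \<ge> 1" "k \<ge> 1" and x0: "x > 0" and lim: "(\<lambda>d. real (p d) / real d ^ k) \<longlonglongrightarrow> x"
  define y where "y d = real (p d) / real d ^ k" for d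
  have y: "y \<longlonglongrightarrow> x" using lim unfolding y_def[abs_def] .
  have dinf: "filterlim (\<lambda>d. real d) at_top sequentially" by (rule filterlim_real_sequentially)
  \<comment> \<open>This makes the hypothesis m < sqrt p of the lower bound hold eventually, and its
    factor 1 - m^2 / p tend to 1.\<close>
  have pinf: "filterlim (\<lambda>d. real (p d)) at_top sequentially"
  proof -
    have lim: "filterlim (\<lambda>d. y d * real d ^ k) at_top sequentially"
      using filterlim_tendsto_pos_mult_at_top[OF y x0] filterlim_pow_at_top[OF _ dinf, of k] mk by simp
    have "eventually (\<lambda>d. y d * real d ^ k = real (p d)) sequentially"
      using eventually_gt_at_top[of 0] by eventually_elim (simp add: y_def)
    from filterlim_cong[OF refl refl this] lim show ?thesis by simp
  qed
  have beta: "(\<lambda>d. beta_poly m (y d)) \<longlonglongrightarrow> beta_poly m x"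
    unfolding beta_poly_def by (intro tendsto_intros y)
  have ev: "eventually (\<lambda>d. d \<ge> 1 \<and> p d \<ge> 1 \<and> real m < sqrt (real (p d))) sequentially"
  proof -
    have "eventually (\<lambda>d. real (p d) > (real m)\<^sup>2 + 1) sequentially"
      using pinf by (auto simp: filterlim_at_top_dense)
    thus ?thesis using eventually_ge_at_top[of 1]
    proof eventually_elim
      case (elim d)
      have "(real m)\<^sup>2 < real (p d)" using elim by linarith
      hence "real m < sqrt (real (p d))" by (rule real_less_rsqrt)
      moreover have "0 < real (p d)" using elim zero_le_power2[of "real m"] by linarith
      ultimately show ?case using elim by (simp add: Suc_le_eq)
    qed
  qed
  show "(\<lambda>d. expected_trace d k (p d) m / real d ^ k) \<longlonglongrightarrow> beta_poly m x"
  proof (rule tendsto_sandwich)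
    show "eventually (\<lambda>d. (1 - real m ^ 2 / real (p d)) * beta_poly m (y d) \<le> expected_trace d k (p d) m / real d ^ k) sequentially"
      using ev by eventually_elim (rule expected_trace_lower[OF _ _ mk(1)], auto simp: y_def)
    show "eventually (\<lambda>d. expected_trace d k (p d) m / real d ^ k \<le> exp (2 * real m ^ 5 / (y d * real d)) * beta_poly m (y d)) sequentially"
      using ev by eventually_elim (rule expected_trace_upper[OF _ mk(2) _ mk(1)], auto simp: y_def)
    have "((\<lambda>d. (1 - real m ^ 2 / real (p d)) * beta_poly m (y d)) \<longlongrightarrow> (1 - 0) * beta_poly m x) sequentially"
      by (intro tendsto_intros beta tendsto_divide_0[OF tendsto_const] filterlim_at_top_imp_at_infinity pinf)
    thus "(\<lambda>d. (1 - real m ^ 2 / real (p d)) * beta_poly m (y d)) \<longlonglongrightarrow> beta_poly m x" by simp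
    have "((\<lambda>d. exp (2 * real m ^ 5 / (y d * real d)) * beta_poly m (y d)) \<longlongrightarrow> exp 0 * beta_poly m x) sequentially"
      by (intro tendsto_intros beta tendsto_divide_0[OF tendsto_const] filterlim_at_top_imp_at_infinity
          filterlim_tendsto_pos_mult_at_top[OF y x0] dinf)
    thus "(\<lambda>d. exp (2 * real m ^ 5 / (y d * real d)) * beta_poly m (y d)) \<longlonglongrightarrow> beta_poly m x" by simp
  qed
qed

end
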